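(* Let $G$ be a diffeological group. Then the principal $G$-bundle $EG\to BG$ (the diffeological Milnor construction) admits a connection 1-form $\omega$.
   Context: Diffeology. A diffeology on a set $X$ is a collection of maps $p\colon U\to X$ ("plots"), $U$ open in some $\mathbb{R}^n$, $n\ge 0$, that contains constant maps, is closed under precomposition with smooth maps between open subsets of Euclidean spaces, and contains every map that is locally a plot. A map is smooth if its composition with every plot is a plot. Subsets, products, quotients carry the subset, product, quotient diffeologies; $[0,1]\subseteq\mathbb{R}$ has the subset diffeology. A diffeological group is a group with a diffeology for which multiplication and inversion are smooth; $e$ denotes its identity. Tangent spaces. $T_xX$ is the colimit in real vector spaces of $T_0U$ over the category of plots $p\colon U\to X$ with $U$ connected, $0\in U$, $p(0)=x$, arrows from $p\colon U\to X$ to $q\colon V\to X$ being smooth $f\colon U\to V$ with $f(0)=0$, $q\circ f=p$. $TX=\bigsqcup_xT_xX$; each plot $p$ induces $Tp=p_*\colon TU\to TX$, and $TX$ has the smallest diffeology such that all $Tp$ are smooth and $TX\to X$ is a vector pseudo-bundle (smooth surjection whose fibres are diffeological vector spaces, i.e. have smooth addition and scalar multiplication, with smooth fibrewise addition, scalar multiplication and zero section). $T$ is a functor; $f_*=Tf$; for a smooth curve $c$, $\frac{dc}{dt}=c_*(\frac{d}{dt})$. The adjoint action of $G$ on $T_eG$ is $g\cdot\xi=(C_g)_*\xi$, where $C_g(h)=ghg^{-1}$. Connection 1-forms. For a principal $G$-bundle $E\to X$, a connection 1-form on $E$ is a $G$-equivariant (with respect to the adjoint action on $T_eG$) smooth fibrewise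 linear map $\omega\colon TE\to T_eG$ such that for any $y\in E$ and $\xi\in T_eG$, $\omega(\xi_E|_y)=\xi$, where $\xi_E|_y:=\frac{d}{dt}\big|_{t=0}(g(t)\cdot y)$ for a smooth curve $g(t)$ in $G$ with $g(0)=e$ and $\dot g(0)=\xi$. Milnor construction. Let $S_G\subseteq[0,1]^{\mathbb{N}}\times G^{\mathbb{N}}$ be the set of $(t_i,g_i)_{i\in\mathbb{N}}$ with only finitely many $t_i\ne 0$ and $\sum_i t_i=1$, with the subset diffeology of the product diffeology. Define $(t_i,g_i)\sim(t_i',g_i')$ iff $t_i=t_i'$ for all $i$ and $g_i=g_i'$ whenever $t_i=t'_i\neq0$. $EG:=S_G/\!\sim$ with the quotient diffeology, with elements $(t_ig_i)$; $G$ acts on $EG$ by $h\cdot(t_ig_i)=(t_ig_ih^{-1})$, and $BG:=EG/G$ with the quotient diffeology. *)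

theory Defs
  imports
    "HOL-Analysis.Analysis"
    "HOL-Library.Function_Algebras"
    "HOL-Algebra.Module"
begin

section \<open>Smooth maps between open subsets of Euclidean spaces\<close>

text \<open>
  The dimension of the domain of a plot varies, so \<open>\<real>\<^sup>n\<close> is realised as the set of sequences
  that vanish from index \<open>n\<close> on, topologised by \<^const>\<open>Euclidean_space\<close> (which is the subspace
  topology of the product topology on \<^typ>\<open>nat \<Rightarrow> real\<close>).
\<close>

type_synonym rvec = "nat \<Rightarrow> real"

abbreviation Rn :: "nat \<Rightarrow> rvec set" where
  "Rn n \<equiv> topspace (Euclidean_space n)"

instantiation "fun" :: (type, real_vector) real_vector
begin

definition scaleR_fun :: "real \<Rightarrow> ('a \<Rightarrow> 'b) \<Rightarrow> 'a \<Rightarrow> 'b" where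
  "scaleR_fun c f = (\<lambda>x. c *\<^sub>R f x)"

instance
  by standard (simp_all add: scaleR_fun_def fun_eq_iff scaleR_add_right scaleR_add_left)

end

text \<open>
  \<open>Ck_on n k U f\<close>: all partial derivatives of \<open>f\<close> of order at most \<open>k\<close> exist and are continuous on
  the open set \<open>U \<subseteq> \<real>\<^sup>n\<close>.  Since \<open>U\<close> is open, this depends only on the values of \<open>f\<close> on \<open>U\<close>.
\<close>

primrec Ck_on :: "nat \<Rightarrow> nat \<Rightarrow> rvec set \<Rightarrow> (rvec \<Rightarrow> real) \<Rightarrow> bool" where
  "Ck_on n 0 U f \<longleftrightarrow> continuous_on U f"
| "Ck_on n (Suc k) U f \<longleftrightarrow> continuous_on U f \<and>
     (\<forall>i<n. \<exists>f'. (\<forall>x\<in>U. ((\<lambda>t. f (x(i := t))) has_real_derivative f' x) (at (x i))) \<and> Ck_on n k U f')"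

definition smooth_fun :: "nat \<Rightarrow> rvec set \<Rightarrow> (rvec \<Rightarrow> real) \<Rightarrow> bool" where
  "smooth_fun n U f \<longleftrightarrow> (\<forall>k. Ck_on n k U f)"

definition smooth_between ::
  "nat \<Rightarrow> rvec set \<Rightarrow> nat \<Rightarrow> rvec set \<Rightarrow> (rvec \<Rightarrow> rvec) \<Rightarrow> bool" where
  "smooth_between n U m V f \<longleftrightarrow> f ` U \<subseteq> V \<and> (\<forall>j<m. smooth_fun n U (\<lambda>u. f u j))"

text \<open>The differential at \<open>u\<close> of a map defined near \<open>u \<in> \<real>\<^sup>n\<close>, applied to \<open>v \<in> \<real>\<^sup>n\<close>.\<close>

definition differential :: "nat \<Rightarrow> (rvec \<Rightarrow> rvec) \<Rightarrow> rvec \<Rightarrow> rvec \<Rightarrow> rvec" where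
  "differential n f u v = (\<lambda>j. \<Sum>i<n. v i * deriv (\<lambda>t. f (u(i := t)) j) (u i))"

section \<open>Diffeological spaces\<close>

text \<open>
  A plot \<open>p: U \<rightarrow> X\<close> with \<open>U \<subseteq> \<real>\<^sup>n\<close> is a triple \<open>(n, U, p)\<close>; the values of \<open>p\<close> outside \<open>U\<close> are
  irrelevant, which is the content of the third clause of \<open>diffeological_space\<close> below.
\<close>

type_synonym 'a plot = "nat \<times> rvec set \<times> (rvec \<Rightarrow> 'a)"

record 'a dspace =
  points :: "'a set"
  plots :: "'a plot set"

definition diffeological_space :: "'a dspace \<Rightarrow> bool" where
  "diffeological_space X \<longleftrightarrow>
     (\<forall>(n, U, p)\<in>plots X. openin (Euclidean_space n) U) \<and>
     (\<forall>(n, U, p)\<in>plots X. p ` U \<subseteq> points X) \<and>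
     (\<forall>(n, U, p)\<in>plots X. \<forall>q. (\<forall>u\<in>U. p u = q u) \<longrightarrow> (n, U, q) \<in> plots X) \<and>
     (\<forall>n U. \<forall>x\<in>points X. openin (Euclidean_space n) U \<longrightarrow> (n, U, \<lambda>_. x) \<in> plots X) \<and>
     (\<forall>(n, U, p)\<in>plots X. \<forall>m V f. openin (Euclidean_space m) V \<longrightarrow> smooth_between m V n U f \<longrightarrow>
        (m, V, p \<circ> f) \<in> plots X) \<and>
     (\<forall>n U p. openin (Euclidean_space n) U \<longrightarrow>
        (\<forall>u\<in>U. \<exists>V. u \<in> V \<and> V \<subseteq> U \<and> (n, V, p) \<in> plots X) \<longrightarrow> (n, U, p) \<in> plots X)"

definition smooth_map :: "'a dspace \<Rightarrow> 'b dspace \<Rightarrow> ('a \<Rightarrow> 'b) \<Rightarrow> bool" where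
  "smooth_map X Y f \<longleftrightarrow> f ` points X \<subseteq> points Y \<and> (\<forall>(n, U, p)\<in>plots X. (n, U, f \<circ> p) \<in> plots Y)"

definition subspace_of :: "'a dspace \<Rightarrow> 'a set \<Rightarrow> 'a dspace" where
  "subspace_of X A =
     \<lparr>points = points X \<inter> A, plots = {(n, U, p). (n, U, p) \<in> plots X \<and> p ` U \<subseteq> A}\<rparr>"

definition prod_space :: "'a dspace \<Rightarrow> 'b dspace \<Rightarrow> ('a \<times> 'b) dspace" where
  "prod_space X Y =
     \<lparr>points = points X \<times> points Y,
      plots = {(n, U, p). (n, U, fst \<circ> p) \<in> plots X \<and> (n, U, snd \<circ> p) \<in> plots Y}\<rparr>"

text \<open>The countable power \<open>X\<^sup>\<nat>\<close>.\<close>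

definition seq_space :: "'a dspace \<Rightarrow> (nat \<Rightarrow> 'a) dspace" where
  "seq_space X =
     \<lparr>points = {x. \<forall>i. x i \<in> points X},
      plots = {(n, U, p). \<forall>i. (n, U, \<lambda>u. p u i) \<in> plots X}\<rparr>"

definition quotient_space :: "'a dspace \<Rightarrow> ('a \<times> 'a) set \<Rightarrow> 'a set dspace" where
  "quotient_space X R =
     \<lparr>points = points X // R,
      plots = {(n, U, p). openin (Euclidean_space n) U \<and>
        (\<forall>u\<in>U. \<exists>V q. u \<in> V \<and> V \<subseteq> U \<and> (n, V, q) \<in> plots X \<and> (\<forall>v\<in>V. p v = R `` {q v}))}\<rparr>"

definition real_space :: "real dspace" where
  "real_space =
     \<lparr>points = UNIV, plots = {(n, U, f). openin (Euclidean_space n) U \<and> smooth_fun n U f}\<rparr>"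

text \<open>An open subset \<open>U\<close> of \<open>\<real>\<^sup>n\<close> with its standard diffeology.\<close>

definition domain_space :: "nat \<Rightarrow> rvec set \<Rightarrow> rvec dspace" where
  "domain_space n U =
     \<lparr>points = U, plots = {(m, V, f). openin (Euclidean_space m) V \<and> smooth_between m V n U f}\<rparr>"

definition diffeological_group :: "('g, 'm) monoid_scheme \<Rightarrow> 'g dspace \<Rightarrow> bool" where
  "diffeological_group G D \<longleftrightarrow>
     group G \<and> diffeological_space D \<and> points D = carrier G \<and>
     smooth_map (prod_space D D) D (\<lambda>(g, h). g \<otimes>\<^bsub>G\<^esub> h) \<and>
     smooth_map D D (\<lambda>g. inv\<^bsub>G\<^esub> g)"

section \<open>Diffeological vector spaces and vector pseudo-bundles\<close>

definition real_ring :: "real ring" where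
  "real_ring = \<lparr>carrier = UNIV, mult = (*), one = 1, zero = 0, add = (+)\<rparr>"

definition diffeological_vector_space :: "(real, 'v, 'm) module_scheme \<Rightarrow> 'v dspace \<Rightarrow> bool" where
  "diffeological_vector_space V D \<longleftrightarrow>
     Module.module real_ring V \<and> diffeological_space D \<and> points D = carrier V \<and>
     smooth_map (prod_space D D) D (\<lambda>(a, b). a \<oplus>\<^bsub>V\<^esub> b) \<and>
     smooth_map (prod_space real_space D) D (\<lambda>(c, a). c \<odot>\<^bsub>V\<^esub> a)"

text \<open>\<open>V x\<close> is the vector space structure on the fibre of \<open>\<pi>: E \<rightarrow> X\<close> over \<open>x\<close>.\<close>

definition vector_pseudo_bundle ::
  "'e dspace \<Rightarrow> 'x dspace \<Rightarrow> ('e \<Rightarrow> 'x) \<Rightarrow> ('x \<Rightarrow> (real, 'e, 'm) module_scheme) \<Rightarrow> bool" where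
  "vector_pseudo_bundle E X \<pi> V \<longleftrightarrow>
     smooth_map E X \<pi> \<and> \<pi> ` points E = points X \<and>
     (\<forall>x\<in>points X. carrier (V x) = {a \<in> points E. \<pi> a = x} \<and>
        diffeological_vector_space (V x) (subspace_of E (carrier (V x)))) \<and>
     smooth_map (subspace_of (prod_space E E) {(a, b). \<pi> a = \<pi> b}) E (\<lambda>(a, b). a \<oplus>\<^bsub>V (\<pi> a)\<^esub> b) \<and>
     smooth_map (prod_space real_space E) E (\<lambda>(c, a). c \<odot>\<^bsub>V (\<pi> a)\<^esub> a) \<and>
     smooth_map X E (\<lambda>x. \<zero>\<^bsub>V x\<^esub>)"

section \<open>Tangent spaces and tangent bundles\<close>

text \<open>Objects and arrows of the category of plots centred at \<open>x\<close>.\<close>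

definition plots_at :: "'a dspace \<Rightarrow> 'a \<Rightarrow> 'a plot set" where
  "plots_at X x = {(n, U, p). (n, U, p) \<in> plots X \<and> connected U \<and> 0 \<in> U \<and> p 0 = x}"

definition plot_arrow :: "'a plot \<Rightarrow> 'a plot \<Rightarrow> (rvec \<Rightarrow> rvec) \<Rightarrow> bool" where
  "plot_arrow P Q f \<longleftrightarrow> (case P of (n, U, p) \<Rightarrow> case Q of (m, V, q) \<Rightarrow>
     smooth_between n U m V f \<and> f 0 = 0 \<and> (\<forall>u\<in>U. q (f u) = p u))"

text \<open>
  The colimit \<open>T\<^sub>x X\<close> is the quotient of the direct sum of the spaces \<open>T\<^sub>0 U = \<real>\<^sup>n\<close> over all
  plots \<open>(n, U, p)\<close> centred at \<open>x\<close> by the span of the elements \<open>\<iota>\<^sub>P v - \<iota>\<^sub>Q (df\<^sub>0 v)\<close> for arrows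
  \<open>f: P \<rightarrow> Q\<close>.  (Two triples that differ only outside \<open>U\<close> are distinct but isomorphic objects, so
  they do not affect the colimit.)  Tangent vectors are tagged with their base point.
\<close>

type_synonym 'a tvec = "'a \<times> ('a plot \<Rightarrow> rvec) set"

definition tangent_sum :: "'a dspace \<Rightarrow> 'a \<Rightarrow> ('a plot \<Rightarrow> rvec) set" where
  "tangent_sum X x =
     {\<phi>. finite {P. \<phi> P \<noteq> 0} \<and> {P. \<phi> P \<noteq> 0} \<subseteq> plots_at X x \<and> (\<forall>P. \<phi> P \<in> Rn (fst P))}"

definition incl :: "'a plot \<Rightarrow> rvec \<Rightarrow> 'a plot \<Rightarrow> rvec" where
  "incl P v = (\<lambda>Q. if Q = P then v else 0)"

definition tangent_relations :: "'a dspace \<Rightarrow> 'a \<Rightarrow> ('a plot \<Rightarrow> rvec) set" where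
  "tangent_relations X x =
     span {incl P v - incl Q (differential (fst P) f 0 v) | P Q f v.
             P \<in> plots_at X x \<and> Q \<in> plots_at X x \<and> plot_arrow P Q f \<and> v \<in> Rn (fst P)}"

definition tangent_class :: "'a dspace \<Rightarrow> 'a \<Rightarrow> ('a plot \<Rightarrow> rvec) \<Rightarrow> 'a tvec" where
  "tangent_class X x \<phi> = (x, {\<phi> + \<nu> | \<nu>. \<nu> \<in> tangent_relations X x})"

definition tangent_space :: "'a dspace \<Rightarrow> 'a \<Rightarrow> (real, 'a tvec) module" where
  "tangent_space X x =
     \<lparr>carrier = tangent_class X x ` tangent_sum X x,
      mult = undefined, one = undefined,
      zero = tangent_class X x 0,
      add = (\<lambda>a b. (x, {\<phi> + \<psi> | \<phi> \<psi>. \<phi> \<in> snd a \<and> \<psi> \<in> snd b})),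
      smult = (\<lambda>c a. (x, {c *\<^sub>R \<phi> + \<nu> | \<phi> \<nu>. \<phi> \<in> snd a \<and> \<nu> \<in> tangent_relations X x}))\<rparr>"

text \<open>
  The tangent map \<open>f\<^sub>* = Tf\<close> of \<open>f: X \<rightarrow> Y\<close>, induced by \<open>\<iota>\<^sub>p v \<mapsto> \<iota>\<^bsub>f\<circ>p\<^esub> v\<close>.  The sum accounts for
  distinct plots of \<open>X\<close> with the same composite.
\<close>

definition push_plot :: "('a \<Rightarrow> 'b) \<Rightarrow> 'a plot \<Rightarrow> 'b plot" where
  "push_plot f P = (case P of (n, U, p) \<Rightarrow> (n, U, f \<circ> p))"

definition push_sum :: "('a \<Rightarrow> 'b) \<Rightarrow> ('a plot \<Rightarrow> rvec) \<Rightarrow> 'b plot \<Rightarrow> rvec" where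
  "push_sum f \<phi> = (\<lambda>Q. \<Sum>P | \<phi> P \<noteq> 0 \<and> push_plot f P = Q. \<phi> P)"

definition pushforward :: "'a dspace \<Rightarrow> 'b dspace \<Rightarrow> ('a \<Rightarrow> 'b) \<Rightarrow> 'a tvec \<Rightarrow> 'b tvec" where
  "pushforward X Y f a =
     (f (fst a), \<Union>\<phi>\<in>snd a. snd (tangent_class Y (f (fst a)) (push_sum f \<phi>)))"

text \<open>
  The standard identification \<open>U \<times> \<real>\<^sup>n \<cong> TU\<close>: \<open>(u, v)\<close> is represented by the vector \<open>v\<close> at \<open>0\<close> in
  the plot \<open>w \<mapsto> u + w\<close>, defined on the connected component of \<open>0\<close> in \<open>U - u\<close>.
\<close>

definition domain_tvec :: "nat \<Rightarrow> rvec set \<Rightarrow> rvec \<times> rvec \<Rightarrow> rvec tvec" where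
  "domain_tvec n U = (\<lambda>(u, v). tangent_class (domain_space n U) u
     (incl (n, connected_component_set {w. u + w \<in> U} 0, \<lambda>w. u + w) v))"

definition plot_tangent :: "'a dspace \<Rightarrow> 'a plot \<Rightarrow> rvec \<times> rvec \<Rightarrow> 'a tvec" where
  "plot_tangent X P = (case P of (n, U, p) \<Rightarrow>
     (\<lambda>uv. pushforward (domain_space n U) X p (domain_tvec n U uv)))"

definition tangent_points :: "'a dspace \<Rightarrow> 'a tvec set" where
  "tangent_points X = (\<Union>x\<in>points X. carrier (tangent_space X x))"

text \<open>The diffeologies on \<open>TX\<close> among which that of the tangent bundle is the smallest.\<close>

definition admissible_tangent_diffeology :: "'a dspace \<Rightarrow> 'a tvec plot set \<Rightarrow> bool" where
  "admissible_tangent_diffeology X \<P> \<longleftrightarrow>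
     (let E = \<lparr>points = tangent_points X, plots = \<P>\<rparr> in
        diffeological_space E \<and>
        (\<forall>(n, U, p)\<in>plots X.
           smooth_map (prod_space (domain_space n U) (domain_space n (Rn n))) E
             (plot_tangent X (n, U, p))) \<and>
        vector_pseudo_bundle E X fst (tangent_space X))"

definition tangent_bundle :: "'a dspace \<Rightarrow> 'a tvec dspace" where
  "tangent_bundle X =
     \<lparr>points = tangent_points X, plots = \<Inter>{\<P>. admissible_tangent_diffeology X \<P>}\<rparr>"

text \<open>\<open>velocity X c t\<close> is \<open>dc/dt = c\<^sub>*(d/dt)\<close> at \<open>t\<close>; \<open>d/dt\<close> is represented by the unit vector of
  \<open>\<real>\<^sup>1\<close> in the plot \<open>w \<mapsto> t + w\<close> of \<open>\<real>\<close>.\<close>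

definition d_dt :: "real \<Rightarrow> real tvec" where
  "d_dt t = tangent_class real_space t (incl (1, Rn 1, \<lambda>w. t + w 0) (\<lambda>i. if i = 0 then 1 else 0))"

definition velocity :: "'a dspace \<Rightarrow> (real \<Rightarrow> 'a) \<Rightarrow> real \<Rightarrow> 'a tvec" where
  "velocity X c t = pushforward real_space X c (d_dt t)"

section \<open>Connection 1-forms\<close>

text \<open>The data of a bundle \<open>E \<rightarrow> X\<close> with a left \<open>G\<close>-action on \<open>E\<close>.  A connection 1-form involves only
  the total space and the action.\<close>

record ('g, 'e, 'x) G_bundle =
  total :: "'e dspace"
  base :: "'x dspace"
  proj :: "'e \<Rightarrow> 'x"
  act :: "'g \<Rightarrow> 'e \<Rightarrow> 'e"

definition lie_space :: "('g, 'm) monoid_scheme \<Rightarrow> 'g dspace \<Rightarrow> (real, 'g tvec) module" where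
  "lie_space G D = tangent_space D \<one>\<^bsub>G\<^esub>"

definition adjoint :: "('g, 'm) monoid_scheme \<Rightarrow> 'g dspace \<Rightarrow> 'g \<Rightarrow> 'g tvec \<Rightarrow> 'g tvec" where
  "adjoint G D g = pushforward D D (\<lambda>h. g \<otimes>\<^bsub>G\<^esub> h \<otimes>\<^bsub>G\<^esub> inv\<^bsub>G\<^esub> g)"

text \<open>
  \<open>\<xi>\<^sub>E|\<^sub>y\<close>.  Every \<open>\<xi> \<in> T\<^sub>e G\<close> is the velocity of a smooth curve through \<open>e\<close>, and the
  resulting vector does not depend on the curve.
\<close>

definition fundamental_vector ::
  "('g, 'm) monoid_scheme \<Rightarrow> 'g dspace \<Rightarrow> ('g, 'e, 'x) G_bundle \<Rightarrow> 'g tvec \<Rightarrow> 'e \<Rightarrow> 'e tvec" where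
  "fundamental_vector G D B \<xi> y =
     (THE v. \<exists>g. smooth_map real_space D g \<and> g 0 = \<one>\<^bsub>G\<^esub> \<and> velocity D g 0 = \<xi> \<and>
        v = velocity (total B) (\<lambda>t. act B (g t) y) 0)"

definition connection_form ::
  "('g, 'm) monoid_scheme \<Rightarrow> 'g dspace \<Rightarrow> ('g, 'e, 'x) G_bundle \<Rightarrow> ('e tvec \<Rightarrow> 'g tvec) \<Rightarrow> bool" where
  "connection_form G D B \<omega> \<longleftrightarrow>
     smooth_map (tangent_bundle (total B))
       (subspace_of (tangent_bundle D) (carrier (lie_space G D))) \<omega> \<and>
     (\<forall>y\<in>points (total B). \<forall>a\<in>carrier (tangent_space (total B) y).
        (\<forall>b\<in>carrier (tangent_space (total B) y).
           \<omega> (a \<oplus>\<^bsub>tangent_space (total B) y\<^esub> b) = \<omega> a \<oplus>\<^bsub>lie_space G D\<^esub> \<omega> b) \<and>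
        (\<forall>c. \<omega> (c \<odot>\<^bsub>tangent_space (total B) y\<^esub> a) = c \<odot>\<^bsub>lie_space G D\<^esub> \<omega> a)) \<and>
     (\<forall>h\<in>carrier G. \<forall>a\<in>points (tangent_bundle (total B)).
        \<omega> (pushforward (total B) (total B) (act B h) a) = adjoint G D h (\<omega> a)) \<and>
     (\<forall>y\<in>points (total B). \<forall>\<xi>\<in>carrier (lie_space G D). \<omega> (fundamental_vector G D B \<xi> y) = \<xi>)"

section \<open>The Milnor construction\<close>

type_synonym 'g milnor_pre = "(nat \<Rightarrow> real) \<times> (nat \<Rightarrow> 'g)"

definition milnor_S :: "'g dspace \<Rightarrow> 'g milnor_pre dspace" where
  "milnor_S D =
     subspace_of (prod_space (seq_space (subspace_of real_space {0..1})) (seq_space D))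
       {(t, g). finite {i. t i \<noteq> 0} \<and> (\<Sum>i | t i \<noteq> 0. t i) = 1}"

definition milnor_rel :: "'g dspace \<Rightarrow> ('g milnor_pre \<times> 'g milnor_pre) set" where
  "milnor_rel D =
     {((t, g), (t', g')). (t, g) \<in> points (milnor_S D) \<and> (t', g') \<in> points (milnor_S D) \<and>
        (\<forall>i. t i = t' i) \<and> (\<forall>i. t i \<noteq> 0 \<longrightarrow> g i = g' i)}"

definition milnor_E :: "'g dspace \<Rightarrow> 'g milnor_pre set dspace" where
  "milnor_E D = quotient_space (milnor_S D) (milnor_rel D)"

definition milnor_act ::
  "('g, 'm) monoid_scheme \<Rightarrow> 'g dspace \<Rightarrow> 'g \<Rightarrow> 'g milnor_pre set \<Rightarrow> 'g milnor_pre set" where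
  "milnor_act G D h y =
     milnor_rel D `` ((\<lambda>(t, g). (t, \<lambda>i. g i \<otimes>\<^bsub>G\<^esub> inv\<^bsub>G\<^esub> h)) ` y)"

definition milnor_orbit_rel ::
  "('g, 'm) monoid_scheme \<Rightarrow> 'g dspace \<Rightarrow> ('g milnor_pre set \<times> 'g milnor_pre set) set" where
  "milnor_orbit_rel G D =
     {(y, milnor_act G D h y) | y h. y \<in> points (milnor_E D) \<and> h \<in> carrier G}"

definition milnor_B ::
  "('g, 'm) monoid_scheme \<Rightarrow> 'g dspace \<Rightarrow> 'g milnor_pre set set dspace" where
  "milnor_B G D = quotient_space (milnor_E D) (milnor_orbit_rel G D)"

definition milnor_bundle ::
  "('g, 'm) monoid_scheme \<Rightarrow> 'g dspace \<Rightarrow>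
     ('g, 'g milnor_pre set, 'g milnor_pre set set) G_bundle" where
  "milnor_bundle G D =
     \<lparr>total = milnor_E D, base = milnor_B G D,
      proj = (\<lambda>y. milnor_orbit_rel G D `` {y}), act = milnor_act G D\<rparr>"

end

theory Submission
  imports Defs
begin

text \<open>
  Write a point of \<open>EG\<close> near which a coordinate \<open>t\<^sub>i\<close> is nonzero in the chart \<open>g\<^sub>i\<close>. There the
  Maurer-Cartan form \<open>\<theta>\<^sub>i = -g\<^sub>i\<inverse> dg\<^sub>i\<close>, that is, the derivative of \<open>w \<mapsto> g\<^sub>i(u + w)\<inverse> g\<^sub>i(u)\<close> at
  \<open>w = 0\<close>, is an equivariant form that reproduces fundamental vectors, and any convex combination
  \<open>\<omega> = \<Sum>\<^sub>i w\<^sub>i \<theta>\<^sub>i\<close> with invariant weights inherits both properties. The choice \<open>w\<^sub>i = t\<^sub>i\<close> is not smooth: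
  along a plot of \<open>EG\<close> infinitely many \<open>t\<^sub>i\<close> may be nonzero arbitrarily close to a point, with no
  control on the derivatives of the \<open>g\<^sub>i\<close>. Taking \<open>w\<^sub>i\<close> proportional to \<open>\<beta>(t\<^sub>i - \<Sum>\<^sub>j\<^sub><\<^sub>i t\<^sub>j)\<close>, where
  \<open>\<beta>(s) = e\<^bsup>-1/s\<^esup>\<close> for \<open>s > 0\<close> and \<open>0\<close> otherwise, makes the sum locally finite along plots: as soon as
  \<open>\<Sum>\<^sub>j\<^sub><\<^sub>N t\<^sub>j > 1/2\<close>, all \<open>w\<^sub>i\<close> with \<open>i \<ge> N\<close> vanish.
\<close>

section \<open>Calculus on open subsets of Euclidean spaces\<close>

text \<open>The element \<open>h\<close> acts by right multiplication with \<open>inv h\<close>, so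
  it is the inverse of \<open>g_i\<close> that has to be differentiated: replacing
  \<open>g_i\<close> by \<open>g_i inv h\<close> conjugates \<open>inv (g_i(u+w)) g_i(u)\<close> by
  \<open>h\<close>, which is the adjoint action, and moving only the first factor along the orbit,
  from \<open>g_i\<close> to \<open>g_i inv h\<close>, makes the product equal to \<open>h\<close>
  itself. Two obstacles come from the notion of tangent bundle. A tangent vector is a class in a
  colimit, so the form is prescribed on generators \<open>incl P v\<close>, extended linearly, and
  shown to respect arrows between plots. The diffeology of a tangent bundle is an intersection of
  all admissible ones, which gives no explicit list of its plots; smoothness of the form is
  therefore tested on the vectors that tangent maps of plots of \<open>EG\<close> produce. There the
  plots of \<open>G\<close> that represent the \<open>i\<close>-th form change with the base point,
  and have to be gathered into a single plot.\<close>

lemma mem_Rn [simp]: "x \<in> Rn n \<longleftrightarrow> (\<forall>i\<ge>n. x i = 0)"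
  by (simp add: topspace_Euclidean_space)

lemma Euclidean_space_top_of_set: "Euclidean_space n = top_of_set {x. \<forall>i\<ge>n. x i = 0}"
  by (simp add: Euclidean_space_def euclidean_product_topology)

lemma openin_Euclidean_trans:
  "openin (Euclidean_space n) U \<Longrightarrow> openin (top_of_set U) S \<Longrightarrow> openin (Euclidean_space n) S"
  unfolding Euclidean_space_top_of_set using openin_trans by blast

text \<open>Basic open sets of the product topology restrict finitely many coordinates, and on
  \<open>Rn n\<close> only the first \<open>n\<close> coordinates vary, so cubes form a
  neighbourhood basis.\<close>

lemma openin_Euclidean_box:
  "openin (Euclidean_space n) U \<longleftrightarrow> U \<subseteq> Rn n \<and>
     (\<forall>y\<in>U. \<exists>\<delta>>0. \<forall>z\<in>Rn n. (\<forall>j<n. \<bar>z j - y j\<bar> < \<delta>) \<longrightarrow> z \<in> U)"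
proof (intro iffI conjI ballI)
  assume U: "openin (Euclidean_space n) U"
  then show sub: "U \<subseteq> Rn n" by (rule openin_subset)
  fix y assume y: "y \<in> U"
  from U obtain T where T: "open T" "U = T \<inter> Rn n"
    unfolding Euclidean_space_top_of_set openin_open by auto
  have "openin (product_topology (\<lambda>i. euclidean) (UNIV::nat set)) T"
    using T by (simp add: euclidean_product_topology)
  from product_topology_open_contains_basis[OF this, of y] y T obtain X where
    X: "y \<in> (\<Pi>\<^sub>E i\<in>UNIV. X i)" "\<And>i. open (X i)" "(\<Pi>\<^sub>E i\<in>UNIV. X i) \<subseteq> T" by auto
  have "\<exists>d>0. \<forall>s. \<bar>s - y j\<bar> < d \<longrightarrow> s \<in> X j" for j
    using X(1) X(2)[of j] open_real by (auto simp: open_dist dist_real_def PiE_iff)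
  then obtain d where d: "\<And>j. d j > 0" "\<And>j s. \<bar>s - y j\<bar> < d j \<Longrightarrow> s \<in> X j" by metis
  \<comment> \<open>The inserted 1 keeps the set nonempty when \<open>n = 0\<close>.\<close>
  define \<delta> where "\<delta> = Min (insert 1 (d ` {..<n}))"
  have "\<delta> > 0" using d by (simp add: \<delta>_def)
  moreover have "z \<in> U" if z: "z \<in> Rn n" "\<forall>j<n. \<bar>z j - y j\<bar> < \<delta>" for z
  proof -
    have "z j \<in> X j" for j
    proof (cases "j < n")
      case True
      then have "\<delta> \<le> d j" by (simp add: \<delta>_def)
      then show ?thesis using z True d(2)[of "z j" j] by force
    next
      case False
      then have "z j = y j" using z y sub by (auto simp: not_less)
      then show ?thesis using X(1) by auto
    qed
    then show ?thesis using X(3) T z by blast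
  qed
  ultimately show "\<exists>\<delta>>0. \<forall>z\<in>Rn n. (\<forall>j<n. \<bar>z j - y j\<bar> < \<delta>) \<longrightarrow> z \<in> U" by blast
next
  assume *: "U \<subseteq> Rn n \<and> (\<forall>y\<in>U. \<exists>\<delta>>0. \<forall>z\<in>Rn n. (\<forall>j<n. \<bar>z j - y j\<bar> < \<delta>) \<longrightarrow> z \<in> U)"
  show "openin (Euclidean_space n) U"
  proof (subst openin_subopen, intro ballI)
    fix y assume y: "y \<in> U"
    with * obtain \<delta> where \<delta>: "\<delta> > 0" "\<forall>z\<in>Rn n. (\<forall>j<n. \<bar>z j - y j\<bar> < \<delta>) \<longrightarrow> z \<in> U" by blast
    have "open (\<Inter>j\<in>{..<n}. {z::rvec. \<bar>z j - y j\<bar> < \<delta>})"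
      by (intro open_INT finite_lessThan ballI open_Collect_less continuous_intros) auto
    then have "openin (Euclidean_space n) (Rn n \<inter> (\<Inter>j\<in>{..<n}. {z::rvec. \<bar>z j - y j\<bar> < \<delta>}))"
      unfolding Euclidean_space_top_of_set topspace_euclidean_subtopology by (rule openin_open_Int)
    then show "\<exists>T. openin (Euclidean_space n) T \<and> y \<in> T \<and> T \<subseteq> U"
      using \<delta> y * by (intro exI[of _ "Rn n \<inter> (\<Inter>j\<in>{..<n}. {z::rvec. \<bar>z j - y j\<bar> < \<delta>})"]) auto
  qed
qed

lemma openin_Euclidean_subset: "openin (Euclidean_space n) U \<Longrightarrow> x \<in> U \<Longrightarrow> x \<in> Rn n"
  using openin_subset by blast

lemma openin_Euclidean_boxE:
  assumes "openin (Euclidean_space n) U" "y \<in> U"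
  obtains \<delta> where "\<delta> > 0" "\<And>z. z \<in> Rn n \<Longrightarrow> (\<And>j. j < n \<Longrightarrow> \<bar>z j - y j\<bar> < \<delta>) \<Longrightarrow> z \<in> U"
  using assms unfolding openin_Euclidean_box by metis

lemma eventually_fun_upd_mem:
  assumes "openin (Euclidean_space n) U" "x \<in> U" "i < n"
  shows "eventually (\<lambda>t. x(i := t) \<in> U) (nhds (x i))"
proof -
  obtain \<delta> where \<delta>: "\<delta> > 0" "\<And>z. z \<in> Rn n \<Longrightarrow> (\<And>j. j < n \<Longrightarrow> \<bar>z j - x j\<bar> < \<delta>) \<Longrightarrow> z \<in> U"
    using openin_Euclidean_boxE[OF assms(1,2)] by metis
  have x: "x \<in> Rn n" using assms openin_Euclidean_subset by blast
  show ?thesis unfolding eventually_nhds_metric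
    by (intro exI[of _ \<delta>] conjI \<delta>(1) allI impI \<delta>(2)) (use x assms \<delta>(1) in \<open>auto simp: dist_real_def\<close>)
qed

text \<open>A small cube around a point lies in the component of that point, since segments join it
  to its centre. Objects of the colimit must have connected domains, so plots are repeatedly cut
  down to components, and these have to be open.\<close>

lemma connected_component_openin_Euclidean:
  assumes "openin (Euclidean_space n) U"
  shows "openin (Euclidean_space n) (connected_component_set U x)"
  unfolding openin_Euclidean_box
proof (intro conjI ballI)
  show "connected_component_set U x \<subseteq> Rn n"
    using connected_component_subset openin_subset[OF assms] by blast
next
  fix y assume y: "y \<in> connected_component_set U x"
  then have yU: "y \<in> U" using connected_component_subset by blast
  obtain \<delta> where \<delta>: "\<delta> > 0" "\<And>z. z \<in> Rn n \<Longrightarrow> (\<And>j. j < n \<Longrightarrow> \<bar>z j - y j\<bar> < \<delta>) \<Longrightarrow> z \<in> U"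
    using openin_Euclidean_boxE[OF assms yU] by metis
  have "z \<in> connected_component_set U x" if z: "z \<in> Rn n" "\<forall>j<n. \<bar>z j - y j\<bar> < \<delta>" for z
  proof -
    define \<gamma> where "\<gamma> s = (\<lambda>j. y j + s * (z j - y j))" for s :: real
    have yR: "y \<in> Rn n" using yU assms openin_Euclidean_subset by blast
    have "continuous_on {0..1} \<gamma>" unfolding \<gamma>_def
      by (rule continuous_on_coordinatewise_then_product) (intro continuous_intros)
    then have "connected (\<gamma> ` {0..1})" by (intro connected_continuous_image) auto
    moreover have "\<gamma> ` {0..1} \<subseteq> U"
    proof safe
      fix s :: real assume s: "s \<in> {0..1}"
      show "\<gamma> s \<in> U"
      proof (rule \<delta>(2))
        show "\<gamma> s \<in> Rn n" using yR z by (auto simp: \<gamma>_def)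
        fix j assume j: "j < n"
        have "\<bar>s * (z j - y j)\<bar> \<le> 1 * \<bar>z j - y j\<bar>"
          unfolding abs_mult using s by (intro mult_right_mono) auto
        then show "\<bar>\<gamma> s j - y j\<bar> < \<delta>" using z j by (force simp: \<gamma>_def)
      qed
    qed
    moreover have "y \<in> \<gamma> ` {0..1}" by (rule image_eqI[of _ _ 0]) (auto simp: \<gamma>_def)
    moreover have "z \<in> \<gamma> ` {0..1}" by (rule image_eqI[of _ _ 1]) (auto simp: \<gamma>_def)
    ultimately have "connected_component U y z" unfolding connected_component_def by blast
    with y show ?thesis using connected_component_trans by (metis mem_Collect_eq)
  qed
  then show "\<exists>\<delta>>0. \<forall>z\<in>Rn n. (\<forall>j<n. \<bar>z j - y j\<bar> < \<delta>) \<longrightarrow> z \<in> connected_component_set U x"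
    using \<delta>(1) by blast
qed

section \<open>Functions of class C^k\<close>

lemma Ck_on_continuous: "Ck_on n k U f \<Longrightarrow> continuous_on U f"
  by (cases k) auto

lemma Ck_on_Suc_imp: "Ck_on n (Suc k) U f \<Longrightarrow> Ck_on n k U f"
  by (induction k arbitrary: f) (simp, metis Ck_on.simps(2))

lemma Ck_on_subset: "Ck_on n k U f \<Longrightarrow> V \<subseteq> U \<Longrightarrow> Ck_on n k V f"
  by (induction k arbitrary: f) (simp_all, use continuous_on_subset in blast, meson continuous_on_subset subsetD)

lemma partial_derivative_cong:
  assumes "openin (Euclidean_space n) U" "x \<in> U" "i < n" "\<And>x. x \<in> U \<Longrightarrow> f x = g x"
  shows "((\<lambda>t. f (x(i := t))) has_real_derivative c) (at (x i)) \<longleftrightarrow>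
         ((\<lambda>t. g (x(i := t))) has_real_derivative c) (at (x i))"
  by (rule DERIV_cong_ev) (auto intro: eventually_mono[OF eventually_fun_upd_mem[OF assms(1-3)]] assms(4))

lemma Ck_on_cong:
  assumes U: "openin (Euclidean_space n) U" and eq: "\<And>x. x \<in> U \<Longrightarrow> f x = g x"
  shows "Ck_on n k U f = Ck_on n k U g"
proof -
  have "continuous_on U f = continuous_on U g" using eq by (intro continuous_on_cong) auto
  moreover have "(\<forall>x\<in>U. ((\<lambda>t. f (x(i := t))) has_real_derivative f' x) (at (x i))) \<longleftrightarrow>
      (\<forall>x\<in>U. ((\<lambda>t. g (x(i := t))) has_real_derivative f' x) (at (x i)))" if "i < n" for i f'
    by (intro ball_cong refl partial_derivative_cong[OF U _ that eq])
  ultimately show ?thesis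
    by (cases k) (simp_all cong: imp_cong)
qed

text \<open>A partial derivative is unique where it exists, so the witness in \<open>Ck_on\<close>
  can be replaced by \<open>deriv\<close>. With a canonical witness, local information glues, as
  \<open>Ck_on_local\<close> requires.\<close>

lemma Ck_on_Suc_deriv:
  assumes U: "openin (Euclidean_space n) U"
  shows "Ck_on n (Suc k) U f \<longleftrightarrow> continuous_on U f \<and>
    (\<forall>i<n. (\<forall>x\<in>U. ((\<lambda>t. f (x(i := t))) has_real_derivative deriv (\<lambda>t. f (x(i := t))) (x i)) (at (x i))) \<and>
           Ck_on n k U (\<lambda>x. deriv (\<lambda>t. f (x(i := t))) (x i)))"
    (is "_ \<longleftrightarrow> _ \<and> (\<forall>i<n. ?Q i)")
proof -
  have "(\<exists>f'. (\<forall>x\<in>U. ((\<lambda>t. f (x(i := t))) has_real_derivative f' x) (at (x i))) \<and> Ck_on n k U f')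
       \<longleftrightarrow> ?Q i" for i
  proof
    assume "\<exists>f'. (\<forall>x\<in>U. ((\<lambda>t. f (x(i := t))) has_real_derivative f' x) (at (x i))) \<and> Ck_on n k U f'"
    then obtain f' where f': "\<And>x. x \<in> U \<Longrightarrow> ((\<lambda>t. f (x(i := t))) has_real_derivative f' x) (at (x i))"
      "Ck_on n k U f'" by blast
    have e: "deriv (\<lambda>t. f (x(i := t))) (x i) = f' x" if "x \<in> U" for x
      by (rule DERIV_imp_deriv[OF f'(1)[OF that]])
    have "Ck_on n k U (\<lambda>x. deriv (\<lambda>t. f (x(i := t))) (x i))"
      by (rule iffD2[OF Ck_on_cong[OF U, of "\<lambda>x. deriv (\<lambda>t. f (x(i := t))) (x i)" f', OF e] f'(2)])
    moreover have "((\<lambda>t. f (x(i := t))) has_real_derivative deriv (\<lambda>t. f (x(i := t))) (x i)) (at (x i))"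
      if "x \<in> U" for x unfolding e[OF that] by (rule f'(1)[OF that])
    ultimately show "?Q i" by blast
  next
    assume "?Q i"
    then show "\<exists>f'. (\<forall>x\<in>U. ((\<lambda>t. f (x(i := t))) has_real_derivative f' x) (at (x i))) \<and> Ck_on n k U f'"
      by (rule exI[of _ "\<lambda>x. deriv (\<lambda>t. f (x(i := t))) (x i)"])
  qed
  note eq = this
  show ?thesis unfolding Ck_on.simps(2)
    by (rule conj_cong[OF refl], rule all_cong1, rule imp_cong[OF refl], rule eq)
qed

lemma continuous_on_openin_Euclidean_local:
  assumes U: "openin (Euclidean_space n) U"
    and loc: "\<And>u. u \<in> U \<Longrightarrow> \<exists>V. u \<in> V \<and> V \<subseteq> U \<and> openin (Euclidean_space n) V \<and> continuous_on V f"
  shows "continuous_on U f"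
proof -
  have "continuous (at u within U) f" if u: "u \<in> U" for u
  proof -
    obtain V where V: "u \<in> V" "V \<subseteq> U" "openin (Euclidean_space n) V" "continuous_on V f"
      using loc u by metis
    then obtain T where T: "open T" "V = Rn n \<inter> T"
      unfolding Euclidean_space_top_of_set openin_open by auto
    have "at u within V = at u within U"
      by (rule at_within_nhd[of u T]) (use V T openin_subset[OF U] in auto)
    moreover have "continuous (at u within V) f"
      using V(1,4) unfolding continuous_on_eq_continuous_within by blast
    ultimately show ?thesis by (simp only:)
  qed
  then show ?thesis unfolding continuous_on_eq_continuous_within by blast
qed

lemma Ck_on_local:
  assumes U: "openin (Euclidean_space n) U"
    and loc: "\<And>u. u \<in> U \<Longrightarrow> \<exists>V. u \<in> V \<and> V \<subseteq> U \<and> openin (Euclidean_space n) V \<and> Ck_on n k V f"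
  shows "Ck_on n k U f"
  using loc
proof (induction k arbitrary: f)
  case 0
  then have "continuous_on U f" by (intro continuous_on_openin_Euclidean_local[OF U]) simp
  then show ?case by simp
next
  case (Suc k)
  have loc: "\<exists>V. u \<in> V \<and> V \<subseteq> U \<and> openin (Euclidean_space n) V \<and> continuous_on V f \<and>
      (\<forall>i<n. (\<forall>x\<in>V. ((\<lambda>t. f (x(i := t))) has_real_derivative deriv (\<lambda>t. f (x(i := t))) (x i)) (at (x i))) \<and>
           Ck_on n k V (\<lambda>x. deriv (\<lambda>t. f (x(i := t))) (x i)))" if u: "u \<in> U" for u
    using Suc.prems[OF u] by (elim exE conjE) (subst (asm) Ck_on_Suc_deriv, assumption, blast)
  show ?case unfolding Ck_on_Suc_deriv[OF U]
  proof (intro conjI allI impI ballI)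
    show "continuous_on U f"
      by (rule continuous_on_openin_Euclidean_local[OF U]) (use loc in blast)
    fix i assume i: "i < n"
    show "((\<lambda>t. f (x(i := t))) has_real_derivative deriv (\<lambda>t. f (x(i := t))) (x i)) (at (x i))" if "x \<in> U" for x
      using loc[OF that] i by blast
    show "Ck_on n k U (\<lambda>x. deriv (\<lambda>t. f (x(i := t))) (x i))"
      by (rule Suc.IH) (use loc i in blast)
  qed
qed

lemma Ck_on_const: "Ck_on n k U (\<lambda>_. c)"
proof (induction k arbitrary: c)
  case (Suc k)
  have "\<exists>f'. (\<forall>x\<in>U. ((\<lambda>t. c) has_real_derivative f' x) (at (x i))) \<and> Ck_on n k U f'" for i
    by (intro exI[of _ "\<lambda>_. 0"] conjI Suc.IH ballI DERIV_const)
  then show ?case by (simp only: Ck_on.simps) (simp add: continuous_on_const)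
qed (simp add: continuous_on_const)

lemma continuous_on_coord: "continuous_on U (\<lambda>x::rvec. x j)"
  by (rule continuous_on_subset[OF continuous_on_product_coordinates subset_UNIV])

lemma Ck_on_coord: "Ck_on n k U (\<lambda>x. x j)"
proof (cases k)
  case (Suc k')
  have "((\<lambda>t. (x(i := t)) j) has_real_derivative (if i = j then 1 else 0)) (at (x i))" for x :: rvec and i
    by (cases "i = j") (simp_all add: DERIV_ident)
  then have "\<exists>f'. (\<forall>x\<in>U. ((\<lambda>t. (x(i := t)) j) has_real_derivative f' x) (at (x i))) \<and> Ck_on n k' U f'" for i
    by (intro exI[of _ "\<lambda>_. if i = j then 1 else 0"] conjI Ck_on_const ballI)
  then show ?thesis unfolding Suc Ck_on.simps by (intro conjI allI impI continuous_on_coord)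
qed (simp add: continuous_on_coord)

lemma Ck_on_add: "Ck_on n k U f \<Longrightarrow> Ck_on n k U g \<Longrightarrow> Ck_on n k U (\<lambda>x. f x + g x)"
proof (induction k arbitrary: f g)
  case (Suc k)
  show ?case unfolding Ck_on.simps
  proof (intro conjI allI impI)
    fix i assume i: "i < n"
    from Suc.prems i obtain f' g' where
      "\<forall>x\<in>U. ((\<lambda>t. f (x(i := t))) has_real_derivative f' x) (at (x i))" "Ck_on n k U f'"
      "\<forall>x\<in>U. ((\<lambda>t. g (x(i := t))) has_real_derivative g' x) (at (x i))" "Ck_on n k U g'"
      unfolding Ck_on.simps by blast
    then show "\<exists>h. (\<forall>x\<in>U. ((\<lambda>t. f (x(i := t)) + g (x(i := t))) has_real_derivative h x) (at (x i))) \<and> Ck_on n k U h"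
      using Suc.IH by (intro exI[of _ "\<lambda>x. f' x + g' x"]) (auto intro: DERIV_add)
  qed (use Suc.prems[THEN Ck_on_continuous] in \<open>rule continuous_on_add\<close>)
qed (simp add: continuous_on_add)

lemma Ck_on_mult: "Ck_on n k U f \<Longrightarrow> Ck_on n k U g \<Longrightarrow> Ck_on n k U (\<lambda>x. f x * g x)"
proof (induction k arbitrary: f g)
  case (Suc k)
  show ?case unfolding Ck_on.simps
  proof (intro conjI allI impI)
    fix i assume i: "i < n"
    from Suc.prems i obtain f' g' where *:
      "\<forall>x\<in>U. ((\<lambda>t. f (x(i := t))) has_real_derivative f' x) (at (x i))" "Ck_on n k U f'"
      "\<forall>x\<in>U. ((\<lambda>t. g (x(i := t))) has_real_derivative g' x) (at (x i))" "Ck_on n k U g'"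
      unfolding Ck_on.simps by blast
    have "((\<lambda>t. f (x(i := t)) * g (x(i := t))) has_real_derivative f' x * g x + g' x * f x) (at (x i))"
      if "x \<in> U" for x using DERIV_mult[of "\<lambda>t. f (x(i := t))" "f' x" "x i" UNIV "\<lambda>t. g (x(i := t))" "g' x"] * that
      by simp
    then show "\<exists>h. (\<forall>x\<in>U. ((\<lambda>t. f (x(i := t)) * g (x(i := t))) has_real_derivative h x) (at (x i))) \<and> Ck_on n k U h"
      using * Suc.prems[THEN Ck_on_Suc_imp]
      by (intro exI[of _ "\<lambda>x. f' x * g x + g' x * f x"] conjI Ck_on_add Suc.IH) auto
  qed (use Suc.prems[THEN Ck_on_continuous] in \<open>rule continuous_on_mult\<close>)
qed (simp add: continuous_on_mult)

lemma Ck_on_sum: "(\<And>a. a \<in> A \<Longrightarrow> Ck_on n k U (f a)) \<Longrightarrow> Ck_on n k U (\<lambda>x. \<Sum>a\<in>A. f a x)"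
  by (induction A rule: infinite_finite_induct) (auto intro: Ck_on_const Ck_on_add)

text \<open>Giving the whole sequence of derivatives of the outer function closes the induction:
  differentiating \<open>D j (f x)\<close> yields \<open>D (Suc j) (f x)\<close> times a partial
  derivative of \<open>f\<close>.\<close>

lemma Ck_on_compose_real:
  assumes "\<And>j x. x \<in> A \<Longrightarrow> (D j has_real_derivative D (Suc j) x) (at x)"
    and "f ` U \<subseteq> A" "Ck_on n k U f"
  shows "Ck_on n k U (\<lambda>x. D j (f x))"
  using assms(3)
proof (induction k arbitrary: j)
  have cont: "continuous_on A (D j)" for j
    using assms(1) by (meson DERIV_isCont continuous_at_imp_continuous_on)
  { case 0
    then show ?case using continuous_on_compose2[OF cont _ assms(2)] by auto }
  { case (Suc k)
    show ?case unfolding Ck_on.simps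
    proof (intro conjI allI impI)
      show "continuous_on U (\<lambda>x. D j (f x))"
        using continuous_on_compose2[OF cont _ assms(2)] Suc.prems by auto
      fix i assume i: "i < n"
      from Suc.prems i obtain f' where *:
        "\<forall>x\<in>U. ((\<lambda>t. f (x(i := t))) has_real_derivative f' x) (at (x i))" "Ck_on n k U f'"
        unfolding Ck_on.simps by blast
      have "((\<lambda>t. D j (f (x(i := t)))) has_real_derivative D (Suc j) (f x) * f' x) (at (x i))"
        if "x \<in> U" for x
        using DERIV_chain2[of "D j" "D (Suc j) (f x)" "\<lambda>t. f (x(i := t))" "x i" "f' x" UNIV] * that assms(1,2)
        by (auto simp: image_subset_iff)
      then show "\<exists>h. (\<forall>x\<in>U. ((\<lambda>t. D j (f (x(i := t)))) has_real_derivative h x) (at (x i))) \<and> Ck_on n k U h"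
        using * Suc.prems[THEN Ck_on_Suc_imp]
        by (intro exI[of _ "\<lambda>x. D (Suc j) (f x) * f' x"] conjI Ck_on_mult Suc.IH) auto
    qed }
qed

text \<open>Move from \<open>y\<close> to \<open>z\<close> one coordinate at a time. In a cube where
  every partial derivative stays within \<epsilon> of its value at \<open>y\<close>, the mean value
  inequality bounds the error of each move, and the moves telescope.\<close>

lemma C1_approx:
  assumes U: "openin (Euclidean_space n) U" and y: "y \<in> U" and e: "\<epsilon> > 0"
    and der: "\<And>j x. j < n \<Longrightarrow> x \<in> U \<Longrightarrow> ((\<lambda>t. g (x(j := t))) has_real_derivative g' j x) (at (x j))"
    and cont: "\<And>j. j < n \<Longrightarrow> continuous_on U (g' j)"
  shows "\<exists>\<delta>>0. \<forall>z\<in>Rn n. (\<forall>j<n. \<bar>z j - y j\<bar> < \<delta>) \<longrightarrow>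
    \<bar>g z - g y - (\<Sum>j<n. g' j y * (z j - y j))\<bar> \<le> \<epsilon> * (\<Sum>j<n. \<bar>z j - y j\<bar>)"
proof -
  define W where "W = U \<inter> (\<Inter>j\<in>{..<n}. {x\<in>U. g' j x \<in> ball (g' j y) \<epsilon>})"
  have "openin (top_of_set U) {x\<in>U. g' j x \<in> ball (g' j y) \<epsilon>}" if "j < n" for j
    using continuous_openin_preimage_gen[OF cont[OF that] open_ball, of "g' j y" \<epsilon>]
    by (simp add: vimage_def Int_def)
  then have "openin (Euclidean_space n) {x\<in>U. g' j x \<in> ball (g' j y) \<epsilon>}" if "j < n" for j
    using openin_Euclidean_trans[OF U] that by blast
  then have W: "openin (Euclidean_space n) W" unfolding W_def
    using U by (intro openin_Int_Inter[of "(\<lambda>j. {x\<in>U. g' j x \<in> ball (g' j y) \<epsilon>}) ` {..<n}"]) auto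
  have "y \<in> W" using y e by (simp add: W_def)
  then obtain \<delta> where \<delta>: "\<delta> > 0" "\<And>z. z \<in> Rn n \<Longrightarrow> (\<And>j. j < n \<Longrightarrow> \<bar>z j - y j\<bar> < \<delta>) \<Longrightarrow> z \<in> W"
    using openin_Euclidean_boxE[OF W] by metis
  have yR: "y \<in> Rn n" using openin_Euclidean_subset[OF U y] .
  have "\<bar>g z - g y - (\<Sum>j<n. g' j y * (z j - y j))\<bar> \<le> \<epsilon> * (\<Sum>j<n. \<bar>z j - y j\<bar>)"
    if z: "z \<in> Rn n" "\<forall>j<n. \<bar>z j - y j\<bar> < \<delta>" for z
  proof -
    define h where "h k = (\<lambda>j. if j < k then z j else y j)" for k
    have h0: "h 0 = y" by (simp add: h_def)
    have hn: "h n = z" using z yR by (auto simp: h_def fun_eq_iff)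
    have step: "\<bar>g (h (Suc k)) - g (h k) - g' k y * (z k - y k)\<bar> \<le> \<epsilon> * \<bar>z k - y k\<bar>" if k: "k < n" for k
    proof -
      have inW: "(h k)(k := t) \<in> W" if t: "\<bar>t - y k\<bar> < \<delta>" for t
      proof (rule \<delta>(2))
        show "(h k)(k := t) \<in> Rn n" using z yR k by (auto simp: h_def)
        show "\<bar>((h k)(k := t)) j - y j\<bar> < \<delta>" if "j < n" for j using z t that \<delta>(1) by (auto simp: h_def)
      qed
      define F where "F t = g ((h k)(k := t)) - g' k y * t" for t
      have "norm (F (z k) - F (y k)) \<le> \<epsilon> * norm (z k - y k)"
      proof (rule field_differentiable_bound[where S = "ball (y k) \<delta>" and f' = "\<lambda>t. g' k ((h k)(k := t)) - g' k y"])
        fix t assume "t \<in> ball (y k) \<delta>"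
        then have t: "(h k)(k := t) \<in> W" by (intro inW) (simp add: dist_real_def abs_minus_commute)
        then have "(h k)(k := t) \<in> U" by (simp add: W_def)
        from der[OF k this] have "((\<lambda>t. g ((h k)(k := t))) has_real_derivative g' k ((h k)(k := t))) (at t)" by simp
        then have "(F has_real_derivative g' k ((h k)(k := t)) - g' k y) (at t)"
          unfolding F_def by (rule DERIV_diff) (auto intro!: derivative_eq_intros)
        then show "(F has_real_derivative g' k ((h k)(k := t)) - g' k y) (at t within ball (y k) \<delta>)"
          by (rule has_field_derivative_at_within)
        show "norm (g' k ((h k)(k := t)) - g' k y) \<le> \<epsilon>"
          using t k by (auto simp: W_def dist_real_def abs_minus_commute intro: less_imp_le)
      qed (use \<delta>(1) z k in \<open>auto simp: dist_real_def abs_minus_commute\<close>)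
      moreover have "(h k)(k := z k) = h (Suc k)" "(h k)(k := y k) = h k" by (auto simp: h_def fun_eq_iff less_Suc_eq)
      ultimately show ?thesis by (simp add: F_def algebra_simps)
    qed
    have "g z - g y - (\<Sum>j<n. g' j y * (z j - y j)) = (\<Sum>k<n. g (h (Suc k)) - g (h k) - g' k y * (z k - y k))"
      using sum_lessThan_telescope[of "\<lambda>k. g (h k)" n] by (simp add: sum_subtractf h0 hn)
    also have "\<bar>\<dots>\<bar> \<le> (\<Sum>k<n. \<epsilon> * \<bar>z k - y k\<bar>)"
      by (rule order_trans[OF sum_abs sum_mono]) (use step in auto)
    finally show ?thesis by (simp add: sum_distrib_left)
  qed
  then show ?thesis using \<delta>(1) by blast
qed

text \<open>By \<open>C1_approx\<close> the nonlinear remainder along \<open>c\<close> is small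
  compared with the sum of the coordinate increments, and the difference quotients of these
  increments stay bounded near \<open>s\<close>.\<close>

lemma C1_chain:
  assumes U: "openin (Euclidean_space n) U"
    and der: "\<And>j x. j < n \<Longrightarrow> x \<in> U \<Longrightarrow> ((\<lambda>t. g (x(j := t))) has_real_derivative g' j x) (at (x j))"
    and cont: "\<And>j. j < n \<Longrightarrow> continuous_on U (g' j)"
    and c: "eventually (\<lambda>t. c t \<in> U) (nhds s)"
    and c': "\<And>j. j < n \<Longrightarrow> ((\<lambda>t. c t j) has_real_derivative c' j) (at s)"
  shows "((\<lambda>t. g (c t)) has_real_derivative (\<Sum>j<n. g' j (c s) * c' j)) (at s)"
proof -
  have y: "c s \<in> U" using c by (rule eventually_nhds_x_imp_x)
  define K where "K = (\<Sum>j<n. \<bar>c' j\<bar>)"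
  have quot: "((\<lambda>t. (c t j - c s j) / (t - s)) \<longlongrightarrow> c' j) (at s)" if "j < n" for j
    using c'[OF that] by (simp add: has_field_derivative_iff)
  have "((\<lambda>t. \<Sum>j<n. \<bar>(c t j - c s j) / (t - s)\<bar>) \<longlongrightarrow> K) (at s)"
    unfolding K_def by (intro tendsto_sum tendsto_rabs quot) auto
  then have evK: "eventually (\<lambda>t. (\<Sum>j<n. \<bar>(c t j - c s j) / (t - s)\<bar>) < K + 1) (at s)"
    by (rule order_tendstoD(2)) simp
  have K0: "K \<ge> 0" by (simp add: K_def sum_nonneg)
  have near: "eventually (\<lambda>t. \<forall>j<n. \<bar>c t j - c s j\<bar> < \<delta>) (at s)" if "\<delta> > 0" for \<delta>
  proof -
    have "eventually (\<lambda>t. \<bar>c t j - c s j\<bar> < \<delta>) (at s)" if "j < n" for j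
    proof -
      have "((\<lambda>t. c t j) \<longlongrightarrow> c s j) (at s)" using c'[OF that] DERIV_isCont isCont_def by blast
      then show ?thesis using tendstoD[of "\<lambda>t. c t j" "c s j" "at s" \<delta>] \<open>\<delta> > 0\<close> by (simp add: dist_real_def)
    qed
    then have "eventually (\<lambda>t. \<forall>j\<in>{..<n}. \<bar>c t j - c s j\<bar> < \<delta>) (at s)"
      by (intro eventually_ball_finite) auto
    then show ?thesis by (rule eventually_mono) auto
  qed
  define R where "R t = g (c t) - g (c s) - (\<Sum>j<n. g' j (c s) * (c t j - c s j))" for t
  have "((\<lambda>t. R t / (t - s)) \<longlongrightarrow> 0) (at s)"
  proof (rule tendstoI)
    fix \<epsilon> :: real assume e: "\<epsilon> > 0"
    \<comment> \<open>The limit \<open>K\<close> of the summed difference quotients may be 0;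
      \<open>K + 1\<close> is positive and eventually a strict upper bound for them.\<close>
    then have "\<epsilon> / (K + 1) > 0" using K0 by simp
    from C1_approx[OF U y this der cont] obtain \<delta> where \<delta>: "\<delta> > 0"
      "\<forall>z\<in>Rn n. (\<forall>j<n. \<bar>z j - c s j\<bar> < \<delta>) \<longrightarrow>
        \<bar>g z - g (c s) - (\<Sum>j<n. g' j (c s) * (z j - c s j))\<bar> \<le> \<epsilon> / (K + 1) * (\<Sum>j<n. \<bar>z j - c s j\<bar>)"
      by blast
    have "eventually (\<lambda>t. c t \<in> U) (at s)" using c by (simp add: eventually_at_filter eventually_mono)
    moreover have "eventually (\<lambda>t. t \<noteq> s) (at s)" by (rule eventually_neq_at_within)
    ultimately show "eventually (\<lambda>t. dist (R t / (t - s)) 0 < \<epsilon>) (at s)"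
      using near[OF \<delta>(1)] evK
    proof eventually_elim
      case (elim t)
      have "\<bar>R t\<bar> \<le> \<epsilon> / (K + 1) * (\<Sum>j<n. \<bar>c t j - c s j\<bar>)"
        unfolding R_def using \<delta>(2) elim openin_Euclidean_subset[OF U] by blast
      then have "\<bar>R t\<bar> / \<bar>t - s\<bar> \<le> \<epsilon> / (K + 1) * (\<Sum>j<n. \<bar>c t j - c s j\<bar>) / \<bar>t - s\<bar>"
        by (rule divide_right_mono) simp
      also have "\<dots> = \<epsilon> / (K + 1) * (\<Sum>j<n. \<bar>(c t j - c s j) / (t - s)\<bar>)"
        by (simp add: sum_divide_distrib[symmetric])
      also have "\<dots> < \<epsilon> / (K + 1) * (K + 1)"
        using elim e K0 by (intro mult_strict_left_mono) auto
      also have "\<dots> = \<epsilon>" using K0 by simp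
      finally show ?case by (simp add: dist_real_def)
    qed
  qed
  moreover have "((\<lambda>t. \<Sum>j<n. g' j (c s) * ((c t j - c s j) / (t - s))) \<longlongrightarrow> (\<Sum>j<n. g' j (c s) * c' j)) (at s)"
    by (intro tendsto_sum tendsto_mult_left quot) auto
  ultimately have "((\<lambda>t. R t / (t - s) + (\<Sum>j<n. g' j (c s) * ((c t j - c s j) / (t - s))))
      \<longlongrightarrow> 0 + (\<Sum>j<n. g' j (c s) * c' j)) (at s)"
    by (rule tendsto_add)
  moreover have "R t / (t - s) + (\<Sum>j<n. g' j (c s) * ((c t j - c s j) / (t - s))) = (g (c t) - g (c s)) / (t - s)" for t
    unfolding R_def times_divide_eq_right sum_divide_distrib[symmetric] add_divide_distrib[symmetric] by simp
  ultimately show ?thesis by (simp add: has_field_derivative_iff)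
qed

lemma continuous_on_smooth_coords:
  assumes "f ` U \<subseteq> Rn n" "\<And>j. j < n \<Longrightarrow> continuous_on U (\<lambda>u. f u j)"
  shows "continuous_on U (f :: 'a::topological_space \<Rightarrow> rvec)"
proof (rule continuous_on_coordinatewise_then_product)
  fix j show "continuous_on U (\<lambda>u. f u j)"
  proof (cases "j < n")
    case False
    have "continuous_on U (\<lambda>u. f u j) \<longleftrightarrow> continuous_on U (\<lambda>u. 0::real)"
      by (rule continuous_on_cong) (use False assms(1) in auto)
    then show ?thesis by simp
  qed (rule assms(2))
qed

text \<open>By the chain rule a partial derivative of the composite is a sum of products of
  \<open>g' j (f x)\<close> with partial derivatives of \<open>f\<close>. The induction leaves
  \<open>g\<close> arbitrary so that it applies to each \<open>g' j\<close>.\<close>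

lemma Ck_on_compose:
  assumes V: "openin (Euclidean_space m) V" and U: "openin (Euclidean_space n) U"
    and fV: "f ` V \<subseteq> U" and f: "\<And>j. j < n \<Longrightarrow> Ck_on m k V (\<lambda>u. f u j)"
    and g: "Ck_on n k U g"
  shows "Ck_on m k V (\<lambda>u. g (f u))"
  using f g
proof (induction k arbitrary: g)
  have cont: "continuous_on V (\<lambda>u. g (f u))" if "continuous_on U g"  "\<And>j. j < n \<Longrightarrow> continuous_on V (\<lambda>u. f u j)" for g
  proof -
    have "f ` V \<subseteq> Rn n" using fV openin_subset[OF U] by blast
    then have "continuous_on V f" using that(2) by (rule continuous_on_smooth_coords)
    then show ?thesis by (rule continuous_on_compose2[OF that(1) _ fV])
  qed
  { case 0
    then show ?case using cont[of g] by simp }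
  { case (Suc k)
    define g' where "g' j x = deriv (\<lambda>t. g (x(j := t))) (x j)" for j x
    have g':
      "\<And>j x. j < n \<Longrightarrow> x \<in> U \<Longrightarrow> ((\<lambda>t. g (x(j := t))) has_real_derivative g' j x) (at (x j))"
      "\<And>j. j < n \<Longrightarrow> Ck_on n k U (g' j)"
      using Suc.prems(2)[unfolded Ck_on_Suc_deriv[OF U], folded g'_def] by blast+
    show ?case unfolding Ck_on.simps(2)
    proof (intro conjI allI impI)
      show "continuous_on V (\<lambda>u. g (f u))"
        by (rule cont) (rule Ck_on_continuous[OF Suc.prems(2)], rule Ck_on_continuous[OF Suc.prems(1)])
      fix i assume i: "i < m"
      define f' where "f' j x = deriv (\<lambda>t. f (x(i := t)) j) (x i)" for j x
      have f':
        "\<And>j x. j < n \<Longrightarrow> x \<in> V \<Longrightarrow> ((\<lambda>t. f (x(i := t)) j) has_real_derivative f' j x) (at (x i))"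
        "\<And>j. j < n \<Longrightarrow> Ck_on m k V (f' j)"
        using Suc.prems(1)[unfolded Ck_on_Suc_deriv[OF V]] i unfolding f'_def by blast+
      have "((\<lambda>t. g (f (x(i := t)))) has_real_derivative (\<Sum>j<n. g' j (f x) * f' j x)) (at (x i))"
        if x: "x \<in> V" for x
      proof -
        have "eventually (\<lambda>t. f (x(i := t)) \<in> U) (nhds (x i))"
          using eventually_fun_upd_mem[OF V x i] by (rule eventually_mono) (use fV in blast)
        from C1_chain[OF U g'(1) Ck_on_continuous[OF g'(2)] this f'(1)[OF _ x]] show ?thesis by simp
      qed
      moreover have "Ck_on m k V (\<lambda>x. \<Sum>j<n. g' j (f x) * f' j x)"
      proof (rule Ck_on_sum, rule Ck_on_mult)
        fix j assume "j \<in> {..<n}"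
        then have j: "j < n" by simp
        show "Ck_on m k V (\<lambda>x. g' j (f x))"
          by (rule Suc.IH[of "g' j"]) (rule Ck_on_Suc_imp[OF Suc.prems(1)], assumption, rule g'(2)[OF j])
        show "Ck_on m k V (f' j)" by (rule f'(2)[OF j])
      qed
      ultimately show "\<exists>f'. (\<forall>x\<in>V. ((\<lambda>t. g (f (x(i := t)))) has_real_derivative f' x) (at (x i))) \<and> Ck_on m k V f'"
        by (intro exI[of _ "\<lambda>x. \<Sum>j<n. g' j (f x) * f' j x"] conjI ballI)
    qed }
qed

section \<open>Smooth functions\<close>

lemma smooth_fun_const [simp]: "smooth_fun n U (\<lambda>_. c)"
  by (simp add: smooth_fun_def Ck_on_const)

lemma smooth_fun_coord [simp]: "smooth_fun n U (\<lambda>x. x j)"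
  by (simp add: smooth_fun_def Ck_on_coord)

lemma smooth_fun_add: "smooth_fun n U f \<Longrightarrow> smooth_fun n U g \<Longrightarrow> smooth_fun n U (\<lambda>x. f x + g x)"
  by (simp add: smooth_fun_def Ck_on_add)

lemma smooth_fun_mult: "smooth_fun n U f \<Longrightarrow> smooth_fun n U g \<Longrightarrow> smooth_fun n U (\<lambda>x. f x * g x)"
  by (simp add: smooth_fun_def Ck_on_mult)

lemma smooth_fun_sum: "(\<And>a. a \<in> A \<Longrightarrow> smooth_fun n U (f a)) \<Longrightarrow> smooth_fun n U (\<lambda>x. \<Sum>a\<in>A. f a x)"
  by (simp add: smooth_fun_def Ck_on_sum)

lemma smooth_fun_diff:
  assumes "smooth_fun n U f" "smooth_fun n U g"
  shows "smooth_fun n U (\<lambda>x. f x - g x)"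
  using smooth_fun_add[OF assms(1) smooth_fun_mult[OF smooth_fun_const assms(2), of "-1"]] by simp

lemma smooth_fun_subset: "smooth_fun n U f \<Longrightarrow> V \<subseteq> U \<Longrightarrow> smooth_fun n V f"
  unfolding smooth_fun_def using Ck_on_subset by blast

lemma smooth_fun_cong:
  "openin (Euclidean_space n) U \<Longrightarrow> (\<And>x. x \<in> U \<Longrightarrow> f x = g x) \<Longrightarrow> smooth_fun n U f = smooth_fun n U g"
  unfolding smooth_fun_def using Ck_on_cong by blast

lemma smooth_fun_continuous: "smooth_fun n U f \<Longrightarrow> continuous_on U f"
  using Ck_on_continuous unfolding smooth_fun_def by blast

lemma smooth_fun_local:
  assumes "openin (Euclidean_space n) U"
    and "\<And>u. u \<in> U \<Longrightarrow> \<exists>V. u \<in> V \<and> V \<subseteq> U \<and> openin (Euclidean_space n) V \<and> smooth_fun n V f"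
  shows "smooth_fun n U f"
  unfolding smooth_fun_def
proof
  fix k show "Ck_on n k U f"
  proof (rule Ck_on_local[OF assms(1)])
    fix u assume "u \<in> U"
    from assms(2)[OF this] show "\<exists>V. u \<in> V \<and> V \<subseteq> U \<and> openin (Euclidean_space n) V \<and> Ck_on n k V f"
      by (rule ex_forward) (simp add: smooth_fun_def)
  qed
qed

lemma smooth_fun_compose:
  assumes "openin (Euclidean_space m) V" "openin (Euclidean_space n) U"
    and "smooth_between m V n U f" "smooth_fun n U g"
  shows "smooth_fun m V (\<lambda>u. g (f u))"
  unfolding smooth_fun_def
proof
  fix k show "Ck_on m k V (\<lambda>u. g (f u))"
    by (rule Ck_on_compose[OF assms(1,2)]) (use assms(3,4) in \<open>simp_all add: smooth_between_def smooth_fun_def\<close>)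
qed

lemma smooth_fun_compose_real:
  assumes "\<And>j x. x \<in> A \<Longrightarrow> (D j has_real_derivative D (Suc j) x) (at x)"
    and "f ` U \<subseteq> A" "smooth_fun n U f"
  shows "smooth_fun n U (\<lambda>x. D j (f x))"
  unfolding smooth_fun_def
proof
  fix k show "Ck_on n k U (\<lambda>x. D j (f x))"
    using assms(3) unfolding smooth_fun_def
    by (intro Ck_on_compose_real[where A = A and D = D and f = f and j = j and U = U] assms(1,2)) auto
qed

lemma smooth_fun_inverse:
  assumes "smooth_fun n U f" "\<And>x. x \<in> U \<Longrightarrow> f x \<noteq> 0"
  shows "smooth_fun n U (\<lambda>x. inverse (f x))"
proof -
  \<comment> \<open>The \<open>j\<close>-th derivative of the reciprocal.\<close>
  define D :: "nat \<Rightarrow> real \<Rightarrow> real" where "D j x = (-1) ^ j * fact j * inverse x ^ Suc j" for j x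
  have D: "(D j has_real_derivative D (Suc j) x) (at x)" if "x \<in> - {0}" for j x
    unfolding D_def using that
    by (auto intro!: derivative_eq_intros simp: field_simps power2_eq_square power_eq_if[of x j])
  have "smooth_fun n U (\<lambda>x. D 0 (f x))"
    by (rule smooth_fun_compose_real[where A = "- {0}" and D = D, OF D]) (use assms in auto)
  then show ?thesis by (simp add: D_def)
qed

lemma smooth_fun_sin:
  assumes "smooth_fun n U f"
  shows "smooth_fun n U (\<lambda>x. sin (f x))"
proof -
  \<comment> \<open>Each differentiation shifts the sine by a quarter period.\<close>
  define D :: "nat \<Rightarrow> real \<Rightarrow> real" where "D j x = sin (x + real j * pi / 2)" for j x
  have "D (Suc j) x = cos (x + real j * pi / 2)" for j x
    unfolding D_def using sin_cos_eq[of "x + real j * pi/2"]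
    by (simp add: sin_add cos_add algebra_simps add_divide_distrib)
  then have D: "(D j has_real_derivative D (Suc j) x) (at x)" for j x
    unfolding D_def by (auto intro!: derivative_eq_intros)
  have "smooth_fun n U (\<lambda>x. D 0 (f x))"
    by (rule smooth_fun_compose_real[where A = UNIV and D = D, OF D]) (use assms in auto)
  then show ?thesis by (simp add: D_def)
qed

text \<open>Letting the polynomial vary makes this class of functions closed under differentiation.\<close>

definition flat :: "real poly \<Rightarrow> real \<Rightarrow> real" where
  "flat p s = (if s > 0 then poly p (1 / s) * exp (- (1 / s)) else 0)"

text \<open>The free exponent \<open>k\<close> absorbs the factor \<open>x\<close> that
  \<open>pCons\<close> puts in front of the remaining polynomial.\<close>

lemma poly_div_exp_tendsto_0: "((\<lambda>x::real. x ^ k * poly p x / exp x) \<longlongrightarrow> 0) at_top"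
proof (induction p arbitrary: k)
  case (pCons a p)
  have "((\<lambda>x::real. a * (x ^ k / exp x) + x ^ Suc k * poly p x / exp x) \<longlongrightarrow> a * 0 + 0) at_top"
    by (intro tendsto_add tendsto_mult_left tendsto_power_div_exp_0 pCons.IH)
  then show ?case by (simp add: algebra_simps add_divide_distrib)
qed simp

text \<open>For s > 0 the derivative of p(1/s) exp(-1/s) is s^(-2) (p - p')(1/s) exp(-1/s), which
  has the same form with the polynomial X^2 (p - p'). At 0 the substitution x = 1/s turns the right
  difference quotient into x p(x) / exp x, which tends to 0.\<close>

lemma flat_has_derivative:
  "(flat p has_real_derivative flat ([:0, 0, 1:] * (p - pderiv p)) s) (at s)"
proof -
  consider "s < 0" | "s = 0" | "s > 0" by linarith
  then show ?thesis
  proof cases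
    case 1
    have "((\<lambda>_. 0) has_real_derivative 0) (at s)" by simp
    then have "(flat p has_real_derivative 0) (at s)"
      by (rule has_field_derivative_transform_within_open[of _ _ _ "{..<0}"]) (use 1 in \<open>auto simp: flat_def\<close>)
    then show ?thesis using 1 by (simp add: flat_def)
  next
    case 2
    have "((\<lambda>t. flat p t / t) \<longlongrightarrow> 0) (at_left 0)"
      by (rule tendsto_eventually) (auto simp: flat_def eventually_at_filter)
    moreover have "((\<lambda>t. flat p t / t) \<longlongrightarrow> 0) (at_right 0)"
    proof -
      have "((\<lambda>x::real. x ^ 1 * poly p x / exp x) \<longlongrightarrow> 0) at_top" by (rule poly_div_exp_tendsto_0)
      then have "((\<lambda>x. flat p (inverse x) / inverse x) \<longlongrightarrow> 0) at_top"
        by (rule Lim_transform_eventually)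
           (auto intro!: eventually_mono[OF eventually_gt_at_top[of 0]] simp: flat_def exp_minus field_simps)
      then show ?thesis by (simp add: at_right_to_top filterlim_filtermap)
    qed
    ultimately have "((\<lambda>t. flat p t / t) \<longlongrightarrow> 0) (at 0)" by (simp add: filterlim_at_split)
    then show ?thesis using 2 by (simp add: has_field_derivative_iff flat_def)
  next
    case 3
    have "((\<lambda>s. poly p (1 / s) * exp (- (1 / s))) has_real_derivative
        flat ([:0, 0, 1:] * (p - pderiv p)) s) (at s)"
      using 3 by (auto intro!: derivative_eq_intros simp: flat_def poly_diff field_simps power2_eq_square)
    then show ?thesis
      by (rule has_field_derivative_transform_within_open[of _ _ _ "{0<..}"]) (use 3 in \<open>auto simp: flat_def\<close>)
  qed
qed

lemma smooth_fun_flat: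
  assumes "smooth_fun n U f"
  shows "smooth_fun n U (\<lambda>x. flat p (f x))"
proof -
  define q where "q j = ((\<lambda>p. [:0, 0, 1:] * (p - pderiv p)) ^^ j) p" for j
  have D: "(flat (q j) has_real_derivative flat (q (Suc j)) x) (at x)" for j x
    using flat_has_derivative[of "q j" x] by (simp add: q_def)
  have "smooth_fun n U (\<lambda>x. flat (q 0) (f x))"
    by (rule smooth_fun_compose_real[where A = UNIV and D = "\<lambda>j. flat (q j)", OF D]) (use assms in auto)
  then show ?thesis by (simp add: q_def)
qed

section \<open>Smooth maps between open sets\<close>

lemma smooth_betweenI:
  "f ` U \<subseteq> V \<Longrightarrow> (\<And>j. j < m \<Longrightarrow> smooth_fun n U (\<lambda>u. f u j)) \<Longrightarrow> smooth_between n U m V f"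
  by (simp add: smooth_between_def)

lemma smooth_between_mem: "smooth_between n U m V f \<Longrightarrow> u \<in> U \<Longrightarrow> f u \<in> V"
  unfolding smooth_between_def by (elim conjE) (rule subsetD, assumption, rule imageI)

lemma smooth_between_id: "V \<subseteq> U \<Longrightarrow> smooth_between n V n U (\<lambda>x. x)"
  by (auto intro!: smooth_betweenI)

lemma smooth_between_subset:
  assumes "smooth_between n U m V f" "U' \<subseteq> U" "f ` U' \<subseteq> V'"
  shows "smooth_between n U' m V' f"
proof (rule smooth_betweenI[OF assms(3)])
  show "smooth_fun n U' (\<lambda>u. f u j)" if "j < m" for j
    using assms(1) that by (intro smooth_fun_subset[OF _ assms(2)]) (simp add: smooth_between_def)
qed

lemma smooth_between_continuous:
  assumes "openin (Euclidean_space m) V" "smooth_between n U m V f"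
  shows "continuous_on U f"
proof (rule continuous_on_smooth_coords)
  show "f ` U \<subseteq> Rn m" using smooth_between_mem[OF assms(2)] openin_subset[OF assms(1)] by blast
  show "continuous_on U (\<lambda>u. f u j)" if "j < m" for j
    using assms(2) that by (intro smooth_fun_continuous[of n]) (simp add: smooth_between_def)
qed

lemma smooth_between_preimage:
  assumes U: "openin (Euclidean_space n) U" and V: "openin (Euclidean_space m) V"
    and f: "smooth_between n U m V f" and W: "openin (Euclidean_space m) W"
  shows "openin (Euclidean_space n) {u\<in>U. f u \<in> W}"
proof -
  obtain T where T: "open T" "W = Rn m \<inter> T"
    using W unfolding Euclidean_space_top_of_set openin_open by auto
  have "{u\<in>U. f u \<in> W} = U \<inter> f -` T"
    using smooth_between_mem[OF f] T openin_subset[OF V] by blast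
  then show ?thesis
    using openin_Euclidean_trans[OF U] continuous_openin_preimage_gen[OF smooth_between_continuous[OF V f] T(1)]
    by simp
qed

lemma smooth_fun_preimage:
  assumes "openin (Euclidean_space n) U" "smooth_fun n U f" "open S"
  shows "openin (Euclidean_space n) {u\<in>U. f u \<in> S}"
proof -
  have "{u\<in>U. f u \<in> S} = U \<inter> f -` S" by blast
  then show ?thesis
    using openin_Euclidean_trans[OF assms(1)] continuous_openin_preimage_gen[OF smooth_fun_continuous[OF assms(2)] assms(3)]
    by simp
qed

section \<open>Diffeological spaces\<close>

lemma diffeological_spaceI:
  assumes "\<And>n U p. (n, U, p) \<in> plots X \<Longrightarrow> openin (Euclidean_space n) U"
    and "\<And>n U p u. (n, U, p) \<in> plots X \<Longrightarrow> u \<in> U \<Longrightarrow> p u \<in> points X"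
    and "\<And>n U p q. (n, U, p) \<in> plots X \<Longrightarrow> (\<And>u. u \<in> U \<Longrightarrow> p u = q u) \<Longrightarrow> (n, U, q) \<in> plots X"
    and "\<And>n U x. x \<in> points X \<Longrightarrow> openin (Euclidean_space n) U \<Longrightarrow> (n, U, \<lambda>_. x) \<in> plots X"
    and "\<And>n U p m V f. (n, U, p) \<in> plots X \<Longrightarrow> openin (Euclidean_space m) V \<Longrightarrow> smooth_between m V n U f \<Longrightarrow>
           (m, V, p \<circ> f) \<in> plots X"
    and "\<And>n U p. openin (Euclidean_space n) U \<Longrightarrow>
        (\<And>u. u \<in> U \<Longrightarrow> \<exists>V. u \<in> V \<and> V \<subseteq> U \<and> (n, V, p) \<in> plots X) \<Longrightarrow> (n, U, p) \<in> plots X"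
  shows "diffeological_space X"
  unfolding diffeological_space_def
  apply (intro conjI ballI allI impI; (elim case_prodE)?)
       apply (safe)
       apply (erule assms(1))
      apply (erule (1) assms(2))
     apply (erule assms(3), blast)
    apply (erule (1) assms(4))
   apply (erule (2) assms(5))
  apply (erule assms(6), blast)
  done

lemma
  assumes "diffeological_space X"
  shows dspace_open: "(n, U, p) \<in> plots X \<Longrightarrow> openin (Euclidean_space n) U"
    and dspace_points: "(n, U, p) \<in> plots X \<Longrightarrow> u \<in> U \<Longrightarrow> p u \<in> points X"
    and dspace_cong: "(n, U, p) \<in> plots X \<Longrightarrow> (\<And>u. u \<in> U \<Longrightarrow> p u = q u) \<Longrightarrow> (n, U, q) \<in> plots X"
    and dspace_const: "x \<in> points X \<Longrightarrow> openin (Euclidean_space n) U \<Longrightarrow> (n, U, \<lambda>_. x) \<in> plots X"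
    and dspace_precomp: "(n, U, p) \<in> plots X \<Longrightarrow> openin (Euclidean_space m) V \<Longrightarrow> smooth_between m V n U f \<Longrightarrow>
           (m, V, p \<circ> f) \<in> plots X"
    and dspace_local: "openin (Euclidean_space n) U \<Longrightarrow>
        (\<And>u. u \<in> U \<Longrightarrow> \<exists>V. u \<in> V \<and> V \<subseteq> U \<and> (n, V, p) \<in> plots X) \<Longrightarrow> (n, U, p) \<in> plots X"
proof -
  note d = assms[unfolded diffeological_space_def]
  have P: "\<And>Q n U p. (\<forall>(n, U, p)\<in>plots X. Q n U p) \<Longrightarrow> (n, U, p) \<in> plots X \<Longrightarrow> Q n U p"
    by (drule (1) bspec) simp
  note d1 = d[THEN conjunct1] and d2 = d[THEN conjunct2, THEN conjunct1]
    and d3 = d[THEN conjunct2, THEN conjunct2, THEN conjunct1]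
    and d4 = d[THEN conjunct2, THEN conjunct2, THEN conjunct2, THEN conjunct1]
    and d5 = d[THEN conjunct2, THEN conjunct2, THEN conjunct2, THEN conjunct2, THEN conjunct1]
    and d6 = d[THEN conjunct2, THEN conjunct2, THEN conjunct2, THEN conjunct2, THEN conjunct2]
  show "(n, U, p) \<in> plots X \<Longrightarrow> openin (Euclidean_space n) U"
    by (drule P[OF d1])
  show "(n, U, p) \<in> plots X \<Longrightarrow> u \<in> U \<Longrightarrow> p u \<in> points X"
    by (drule P[OF d2]) (erule image_subset_iff[THEN iffD1, THEN bspec])
  show "(n, U, p) \<in> plots X \<Longrightarrow> (\<And>u. u \<in> U \<Longrightarrow> p u = q u) \<Longrightarrow> (n, U, q) \<in> plots X"
    by (drule P[OF d3]) simp
  show "x \<in> points X \<Longrightarrow> openin (Euclidean_space n) U \<Longrightarrow> (n, U, \<lambda>_. x) \<in> plots X"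
    using d4 by simp
  show "(n, U, p) \<in> plots X \<Longrightarrow> openin (Euclidean_space m) V \<Longrightarrow> smooth_between m V n U f \<Longrightarrow>
           (m, V, p \<circ> f) \<in> plots X"
    by (drule P[OF d5]) simp
  show "openin (Euclidean_space n) U \<Longrightarrow>
        (\<And>u. u \<in> U \<Longrightarrow> \<exists>V. u \<in> V \<and> V \<subseteq> U \<and> (n, V, p) \<in> plots X) \<Longrightarrow> (n, U, p) \<in> plots X"
    using d6 by simp
qed

lemma dspace_restrict:
  assumes "diffeological_space X" "(n, U, p) \<in> plots X" "openin (Euclidean_space n) V" "V \<subseteq> U"
  shows "(n, V, p) \<in> plots X"
  using dspace_precomp[OF assms(1,2,3) smooth_between_id[OF assms(4)]] by (simp add: o_def)

lemma smooth_mapI: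
  "(\<And>x. x \<in> points X \<Longrightarrow> f x \<in> points Y) \<Longrightarrow>
   (\<And>n U p. (n, U, p) \<in> plots X \<Longrightarrow> (n, U, \<lambda>u. f (p u)) \<in> plots Y) \<Longrightarrow> smooth_map X Y f"
  unfolding smooth_map_def by (auto simp: o_def)

lemma
  assumes "smooth_map X Y f"
  shows smooth_map_points: "x \<in> points X \<Longrightarrow> f x \<in> points Y"
    and smooth_map_plots: "(n, U, p) \<in> plots X \<Longrightarrow> (n, U, \<lambda>u. f (p u)) \<in> plots Y"
  using assms unfolding smooth_map_def by (auto simp: o_def)

lemma smooth_map_compose: "smooth_map X Y f \<Longrightarrow> smooth_map Y Z g \<Longrightarrow> smooth_map X Z (g \<circ> f)"
  by (intro smooth_mapI) (auto dest: smooth_map_points smooth_map_plots)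

lemma plots_real_space [simp]:
  "(n, U, f) \<in> plots real_space \<longleftrightarrow> openin (Euclidean_space n) U \<and> smooth_fun n U f"
  by (simp add: real_space_def)

lemma points_real_space [simp]: "points real_space = UNIV"
  by (simp add: real_space_def)

lemma diffeological_space_real: "diffeological_space real_space"
proof (rule diffeological_spaceI)
  fix n U p m V f
  assume "(n, U, p) \<in> plots real_space" "openin (Euclidean_space m) V" "smooth_between m V n U f"
  then show "(m, V, p \<circ> f) \<in> plots real_space"
    using smooth_fun_compose[of m V n U f p] by (simp add: o_def)
next
  fix n U p q
  assume "(n, U, p) \<in> plots real_space" "\<And>u. u \<in> U \<Longrightarrow> p u = (q u :: real)"
  then show "(n, U, q) \<in> plots real_space" using smooth_fun_cong[of n U p q] by simp
next
  fix n U p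
  assume "openin (Euclidean_space n) U" "\<And>u. u \<in> U \<Longrightarrow> \<exists>V. u \<in> V \<and> V \<subseteq> U \<and> (n, V, p) \<in> plots real_space"
  then show "(n, U, p) \<in> plots real_space" using smooth_fun_local[of n U p] by simp
qed auto

section \<open>Subspaces, products, powers and quotients\<close>

lemma points_subspace_of [simp]: "points (subspace_of X A) = points X \<inter> A"
  and plots_subspace_of [simp]: "(n, U, p) \<in> plots (subspace_of X A) \<longleftrightarrow> (n, U, p) \<in> plots X \<and> p ` U \<subseteq> A"
  by (simp_all add: subspace_of_def)

lemma diffeological_space_subspace:
  assumes "diffeological_space X"
  shows "diffeological_space (subspace_of X A)"
proof (rule diffeological_spaceI)
  fix n U p m V f
  assume "(n, U, p) \<in> plots (subspace_of X A)" "openin (Euclidean_space m) V" "smooth_between m V n U f"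
  then show "(m, V, p \<circ> f) \<in> plots (subspace_of X A)"
    using dspace_precomp[OF assms, of n U p m V f] smooth_between_mem[of m V n U f]
    by (simp add: image_subset_iff)
next
  fix n U p
  assume U: "openin (Euclidean_space n) U"
    and loc: "\<And>u. u \<in> U \<Longrightarrow> \<exists>V. u \<in> V \<and> V \<subseteq> U \<and> (n, V, p) \<in> plots (subspace_of X A)"
  have "(n, U, p) \<in> plots X" by (rule dspace_local[OF assms U], drule loc, erule ex_forward) simp
  moreover have "p u \<in> A" if "u \<in> U" for u
    using loc[OF that] by (elim exE conjE) (simp add: image_subset_iff)
  ultimately show "(n, U, p) \<in> plots (subspace_of X A)" by (simp add: image_subset_iff)
qed (auto dest: dspace_open[OF assms] dspace_points[OF assms] dspace_const[OF assms] intro: dspace_cong[OF assms])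

lemma points_prod_space [simp]: "points (prod_space X Y) = points X \<times> points Y"
  and plots_prod_space [simp]: "(n, U, p) \<in> plots (prod_space X Y) \<longleftrightarrow>
    (n, U, \<lambda>u. fst (p u)) \<in> plots X \<and> (n, U, \<lambda>u. snd (p u)) \<in> plots Y"
  by (simp_all add: prod_space_def o_def)

lemma diffeological_space_prod:
  assumes X: "diffeological_space X" and Y: "diffeological_space Y"
  shows "diffeological_space (prod_space X Y)"
proof (rule diffeological_spaceI)
  fix n U p m V f
  assume "(n, U, p) \<in> plots (prod_space X Y)" "openin (Euclidean_space m) V" "smooth_between m V n U f"
  then show "(m, V, p \<circ> f) \<in> plots (prod_space X Y)"
    using dspace_precomp[OF X, of n U "\<lambda>u. fst (p u)" m V f]
      dspace_precomp[OF Y, of n U "\<lambda>u. snd (p u)" m V f] by (simp add: o_def)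
next
  fix n U p
  assume U: "openin (Euclidean_space n) U"
    and loc: "\<And>u. u \<in> U \<Longrightarrow> \<exists>V. u \<in> V \<and> V \<subseteq> U \<and> (n, V, p) \<in> plots (prod_space X Y)"
  have "(n, U, \<lambda>u. fst (p u)) \<in> plots X" by (rule dspace_local[OF X U], drule loc, erule ex_forward) simp
  moreover have "(n, U, \<lambda>u. snd (p u)) \<in> plots Y" by (rule dspace_local[OF Y U], drule loc, erule ex_forward) simp
  ultimately show "(n, U, p) \<in> plots (prod_space X Y)" by simp
next
  fix n U p u assume "(n, U, p) \<in> plots (prod_space X Y)" "u \<in> U"
  then show "p u \<in> points (prod_space X Y)" using dspace_points[OF X] dspace_points[OF Y]
    by (fastforce simp: mem_Times_iff)
next
  fix n U p q assume "(n, U, p) \<in> plots (prod_space X Y)" "\<And>u. u \<in> U \<Longrightarrow> p u = q u"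
  then show "(n, U, q) \<in> plots (prod_space X Y)"
    using dspace_cong[OF X, of n U "\<lambda>u. fst (p u)" "\<lambda>u. fst (q u)"]
      dspace_cong[OF Y, of n U "\<lambda>u. snd (p u)" "\<lambda>u. snd (q u)"] by simp
qed (auto dest: dspace_open[OF X] dspace_const[OF X] dspace_const[OF Y])

lemma points_seq_space [simp]: "points (seq_space X) = {x. \<forall>i. x i \<in> points X}"
  and plots_seq_space [simp]: "(n, U, p) \<in> plots (seq_space X) \<longleftrightarrow> (\<forall>i. (n, U, \<lambda>u. p u i) \<in> plots X)"
  by (simp_all add: seq_space_def)

lemma diffeological_space_seq:
  assumes X: "diffeological_space X"
  shows "diffeological_space (seq_space X)"
proof (rule diffeological_spaceI)
  fix n U p m V f
  assume "(n, U, p) \<in> plots (seq_space X)" "openin (Euclidean_space m) V" "smooth_between m V n U f"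
  then show "(m, V, p \<circ> f) \<in> plots (seq_space X)"
    using dspace_precomp[OF X, of n U "\<lambda>u. p u i" m V f for i] by (simp add: o_def)
next
  fix n U p
  assume U: "openin (Euclidean_space n) U"
    and loc: "\<And>u. u \<in> U \<Longrightarrow> \<exists>V. u \<in> V \<and> V \<subseteq> U \<and> (n, V, p) \<in> plots (seq_space X)"
  have "(n, U, \<lambda>u. p u i) \<in> plots X" for i by (rule dspace_local[OF X U], drule loc, erule ex_forward) simp
  then show "(n, U, p) \<in> plots (seq_space X)" by simp
next
  fix n U p q assume "(n, U, p) \<in> plots (seq_space X)" "\<And>u. u \<in> U \<Longrightarrow> p u = q u"
  then show "(n, U, q) \<in> plots (seq_space X)"
    using dspace_cong[OF X, of n U "\<lambda>u. p u i" "\<lambda>u. q u i" for i] by simp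
qed (auto dest: dspace_open[OF X] dspace_points[OF X] dspace_const[OF X])

lemma points_quotient_space [simp]: "points (quotient_space X R) = points X // R"
  and plots_quotient_space: "(n, U, p) \<in> plots (quotient_space X R) \<longleftrightarrow> openin (Euclidean_space n) U \<and>
        (\<forall>u\<in>U. \<exists>V q. u \<in> V \<and> V \<subseteq> U \<and> (n, V, q) \<in> plots X \<and> (\<forall>v\<in>V. p v = R `` {q v}))"
  by (simp_all add: quotient_space_def)

lemma diffeological_space_quotient:
  assumes X: "diffeological_space X"
  shows "diffeological_space (quotient_space X R)"
proof (rule diffeological_spaceI)
  fix n U p m V f
  assume p: "(n, U, p) \<in> plots (quotient_space X R)" and V: "openin (Euclidean_space m) V"
    and f: "smooth_between m V n U f"
  have U: "openin (Euclidean_space n) U" using p by (simp add: plots_quotient_space)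
  show "(m, V, p \<circ> f) \<in> plots (quotient_space X R)"
    unfolding plots_quotient_space
  proof (intro conjI V ballI)
    fix v assume v: "v \<in> V"
    then have "f v \<in> U" by (rule smooth_between_mem[OF f])
    then obtain W q where W: "f v \<in> W" "W \<subseteq> U" "(n, W, q) \<in> plots X" "\<forall>w\<in>W. p w = R `` {q w}"
      using p unfolding plots_quotient_space by metis
    \<comment> \<open>The lift \<open>q\<close> exists only on \<open>W\<close>, so the composite is
      lifted on the part of \<open>V\<close> that \<open>f\<close> maps there.\<close>
    define V' where "V' = {u\<in>V. f u \<in> W}"
    have V': "openin (Euclidean_space m) V'"
      unfolding V'_def by (rule smooth_between_preimage[OF V U f dspace_open[OF X W(3)]])
    have "smooth_between m V' n W f"
      by (rule smooth_between_subset[OF f]) (auto simp: V'_def)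
    then have "(m, V', q \<circ> f) \<in> plots X" by (rule dspace_precomp[OF X W(3) V'])
    then show "\<exists>V' q. v \<in> V' \<and> V' \<subseteq> V \<and> (m, V', q) \<in> plots X \<and> (\<forall>v\<in>V'. (p \<circ> f) v = R `` {q v})"
      using W v by (intro exI[of _ V'] exI[of _ "q \<circ> f"]) (auto simp: V'_def)
  qed
next
  fix n U p u assume "(n, U, p) \<in> plots (quotient_space X R)" "u \<in> U"
  then obtain V q where "u \<in> V" "(n, V, q) \<in> plots X" "\<forall>v\<in>V. p v = R `` {q v}"
    unfolding plots_quotient_space by metis
  then show "p u \<in> points (quotient_space X R)" using dspace_points[OF X]
    by (auto simp: quotient_def)
next
  fix n U p q assume "(n, U, p) \<in> plots (quotient_space X R)" "\<And>u. u \<in> U \<Longrightarrow> p u = q u"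
  then show "(n, U, q) \<in> plots (quotient_space X R)" unfolding plots_quotient_space by (metis subsetD)
next
  fix n U x assume x: "x \<in> points (quotient_space X R)" and U: "openin (Euclidean_space n) U"
  then obtain y where y: "y \<in> points X" "x = R `` {y}" by (auto simp: quotient_def)
  show "(n, U, \<lambda>_. x) \<in> plots (quotient_space X R)" unfolding plots_quotient_space
    using U y dspace_const[OF X y(1) U] by blast
next
  fix n U p
  assume U: "openin (Euclidean_space n) U"
    and loc: "\<And>u. u \<in> U \<Longrightarrow> \<exists>V. u \<in> V \<and> V \<subseteq> U \<and> (n, V, p) \<in> plots (quotient_space X R)"
  show "(n, U, p) \<in> plots (quotient_space X R)" unfolding plots_quotient_space
  proof (intro conjI U ballI)
    fix u assume "u \<in> U"
    then obtain V where V: "u \<in> V" "V \<subseteq> U" "(n, V, p) \<in> plots (quotient_space X R)" using loc by metis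
    then obtain W q where "u \<in> W" "W \<subseteq> V" "(n, W, q) \<in> plots X" "\<forall>v\<in>W. p v = R `` {q v}"
      unfolding plots_quotient_space by metis
    then show "\<exists>V q. u \<in> V \<and> V \<subseteq> U \<and> (n, V, q) \<in> plots X \<and> (\<forall>v\<in>V. p v = R `` {q v})"
      using V(2) by blast
  qed
qed (simp add: plots_quotient_space)

section \<open>Linear maps on finitely supported families\<close>

lemma sum_fun_apply: "(\<Sum>a\<in>A. f a) x = (\<Sum>a\<in>A. f a x)"
  by (induction A rule: infinite_finite_induct) auto

definition finsupp :: "('i \<Rightarrow> 'v::real_vector) set" where
  "finsupp = {\<phi>. finite {P. \<phi> P \<noteq> 0}}"

text \<open>The map out of a direct sum that is induced by linear maps \<open>J P\<close> on the
  summands.\<close>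

definition lin_ext :: "('i \<Rightarrow> 'v \<Rightarrow> 'c) \<Rightarrow> ('i \<Rightarrow> 'v::real_vector) \<Rightarrow> 'c::real_vector" where
  "lin_ext J \<phi> = (\<Sum>P | \<phi> P \<noteq> 0. J P (\<phi> P))"

lemma finsupp_add: "\<phi> \<in> finsupp \<Longrightarrow> \<psi> \<in> finsupp \<Longrightarrow> \<phi> + \<psi> \<in> finsupp"
  unfolding finsupp_def
  by (auto intro: finite_subset[of _ "{P. \<phi> P \<noteq> 0} \<union> {P. \<psi> P \<noteq> 0}"])

lemma finsupp_scaleR: "\<phi> \<in> finsupp \<Longrightarrow> c *\<^sub>R \<phi> \<in> finsupp"
  unfolding finsupp_def
  by (auto simp: scaleR_fun_def intro: finite_subset[of _ "{P. \<phi> P \<noteq> 0}"])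

lemma subspace_finsupp: "subspace finsupp"
  by (rule subspaceI) (simp_all add: finsupp_add finsupp_scaleR, simp add: finsupp_def)

lemma incl_finsupp: "incl P v \<in> finsupp"
  unfolding finsupp_def incl_def by (auto intro: finite_subset[of _ "{P}"])

lemma lin_ext_superset:
  assumes "\<forall>P. linear (J P)" "finite A" "{P. \<phi> P \<noteq> 0} \<subseteq> A"
  shows "lin_ext J \<phi> = (\<Sum>P\<in>A. J P (\<phi> P))"
  unfolding lin_ext_def using assms by (intro sum.mono_neutral_left) (auto simp: linear_0)

lemma lin_ext_add:
  assumes J: "\<forall>P. linear (J P)" and "\<phi> \<in> finsupp" "\<psi> \<in> finsupp"
  shows "lin_ext J (\<phi> + \<psi>) = lin_ext J \<phi> + lin_ext J \<psi>"
proof -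
  let ?A = "{P. \<phi> P \<noteq> 0} \<union> {P. \<psi> P \<noteq> 0}"
  have A: "finite ?A" using assms by (simp add: finsupp_def)
  have "lin_ext J \<phi> = (\<Sum>P\<in>?A. J P (\<phi> P))" "lin_ext J \<psi> = (\<Sum>P\<in>?A. J P (\<psi> P))"
    by (rule lin_ext_superset[OF J A], blast)+
  moreover have "lin_ext J (\<phi> + \<psi>) = (\<Sum>P\<in>?A. J P ((\<phi> + \<psi>) P))"
    by (rule lin_ext_superset[OF J A]) auto
  ultimately show ?thesis by (simp add: linear_add[OF J[rule_format]] sum.distrib)
qed

lemma lin_ext_scaleR:
  assumes J: "\<forall>P. linear (J P)" and "\<phi> \<in> finsupp"
  shows "lin_ext J (c *\<^sub>R \<phi>) = c *\<^sub>R lin_ext J \<phi>"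
proof -
  have A: "finite {P. \<phi> P \<noteq> 0}" using assms by (simp add: finsupp_def)
  have "lin_ext J (c *\<^sub>R \<phi>) = (\<Sum>P | \<phi> P \<noteq> 0. J P ((c *\<^sub>R \<phi>) P))"
    by (rule lin_ext_superset[OF J A]) (auto simp: scaleR_fun_def)
  then show ?thesis by (simp add: lin_ext_def scaleR_fun_def linear_scale[OF J[rule_format]] scaleR_sum_right)
qed

lemma lin_ext_diff:
  assumes J: "\<forall>P. linear (J P)" and "\<phi> \<in> finsupp" "\<psi> \<in> finsupp"
  shows "lin_ext J (\<phi> - \<psi>) = lin_ext J \<phi> - lin_ext J \<psi>"
  using lin_ext_add[OF J assms(2) finsupp_scaleR[OF assms(3), of "-1"]] lin_ext_scaleR[OF J assms(3), of "-1"]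
  by simp

lemma lin_ext_incl:
  assumes "\<forall>P. linear (J P)"
  shows "lin_ext J (incl P v) = J P v"
proof -
  have "{Q. incl P v Q \<noteq> 0} \<subseteq> {P}" by (auto simp: incl_def)
  from lin_ext_superset[OF assms _ this] show ?thesis by (simp add: incl_def)
qed

lemma lin_ext_sum:
  assumes J: "\<forall>P. linear (J P)" and "\<And>a. a \<in> A \<Longrightarrow> f a \<in> finsupp"
  shows "lin_ext J (\<Sum>a\<in>A. f a) = (\<Sum>a\<in>A. lin_ext J (f a))"
  using assms(2)
proof (induction A rule: infinite_finite_induct)
  case (insert a A)
  then have "lin_ext J (f a + sum f A) = lin_ext J (f a) + lin_ext J (sum f A)"
    by (intro lin_ext_add[OF J] subspace_sum[OF subspace_finsupp]) auto
  moreover have "lin_ext J (sum f A) = (\<Sum>a\<in>A. lin_ext J (f a))"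
    by (rule insert.IH) (use insert.prems in blast)
  ultimately show ?case unfolding sum.insert[OF insert(1,2)] by (simp only:)
qed (simp_all add: lin_ext_def)

lemma finsupp_eq_sum_incl: "\<phi> \<in> finsupp \<Longrightarrow> \<phi> = (\<Sum>P | \<phi> P \<noteq> 0. incl P (\<phi> P))"
  by (auto simp: fun_eq_iff sum_fun_apply incl_def finsupp_def if_distrib[of "\<lambda>f. f _"] cong: if_cong)

lemma linear_incl: "linear (incl P)"
  by (rule linearI) (auto simp: incl_def fun_eq_iff scaleR_fun_def)

section \<open>Tangent spaces\<close>

lemma subspace_tangent_relations: "subspace (tangent_relations X x)"
  by (simp add: tangent_relations_def)

lemma tangent_sum_alt:
  "tangent_sum X x = finsupp \<inter> {\<phi>. \<forall>P. \<phi> P \<in> Rn (fst P) \<and> (P \<notin> plots_at X x \<longrightarrow> \<phi> P = 0)}"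
  by (auto simp: tangent_sum_def finsupp_def)

lemma subspace_tangent_sum: "subspace (tangent_sum X x)"
proof -
  have "subspace {\<phi> :: 'a plot \<Rightarrow> rvec. \<forall>P. \<phi> P \<in> Rn (fst P) \<and> (P \<notin> plots_at X x \<longrightarrow> \<phi> P = 0)}"
    by (rule subspaceI) (auto simp: scaleR_fun_def fun_eq_iff)
  then show ?thesis unfolding tangent_sum_alt by (rule subspace_inter[OF subspace_finsupp])
qed

lemma tangent_sum_finsupp: "\<phi> \<in> tangent_sum X x \<Longrightarrow> \<phi> \<in> finsupp"
  by (simp add: tangent_sum_alt)

lemma incl_tangent_sum: "P \<in> plots_at X x \<Longrightarrow> v \<in> Rn (fst P) \<Longrightarrow> incl P v \<in> tangent_sum X x"
  unfolding tangent_sum_alt using incl_finsupp[of P v] by (auto simp: incl_def)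

lemma tangent_sum_memD:
  assumes "\<phi> \<in> tangent_sum X x" "\<phi> P \<noteq> 0"
  shows "P \<in> plots_at X x \<and> \<phi> P \<in> Rn (fst P)"
proof -
  have "{P. \<phi> P \<noteq> 0} \<subseteq> plots_at X x" "\<forall>P. \<phi> P \<in> Rn (fst P)"
    using assms(1) unfolding tangent_sum_def by blast+
  then show ?thesis using assms(2) by blast
qed

lemma tangent_class_eq_iff:
  "tangent_class X x \<phi> = tangent_class X x \<psi> \<longleftrightarrow> \<phi> - \<psi> \<in> tangent_relations X x"
proof -
  let ?R = "tangent_relations X x"
  note S = subspace_tangent_relations[of X x]
  have "{\<phi> + \<nu> |\<nu>. \<nu> \<in> ?R} = {\<psi> + \<nu> |\<nu>. \<nu> \<in> ?R} \<longleftrightarrow> \<phi> - \<psi> \<in> ?R"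
  proof
    assume "{\<phi> + \<nu> |\<nu>. \<nu> \<in> ?R} = {\<psi> + \<nu> |\<nu>. \<nu> \<in> ?R}"
    moreover have "\<phi> + 0 \<in> {\<phi> + \<nu> |\<nu>. \<nu> \<in> ?R}" using subspace_0[OF S] by blast
    ultimately obtain \<nu> where "\<nu> \<in> ?R" "\<phi> + 0 = \<psi> + \<nu>" by auto
    then show "\<phi> - \<psi> \<in> ?R" by simp
  next
    assume d: "\<phi> - \<psi> \<in> ?R"
    show "{\<phi> + \<nu> |\<nu>. \<nu> \<in> ?R} = {\<psi> + \<nu> |\<nu>. \<nu> \<in> ?R}"
    proof safe
      fix \<nu> assume "\<nu> \<in> ?R"
      then show "\<exists>\<nu>'. \<phi> + \<nu> = \<psi> + \<nu>' \<and> \<nu>' \<in> ?R"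
        using subspace_add[OF S d] by (intro exI[of _ "\<phi> - \<psi> + \<nu>"]) simp
    next
      fix \<nu> assume "\<nu> \<in> ?R"
      then show "\<exists>\<nu>'. \<psi> + \<nu> = \<phi> + \<nu>' \<and> \<nu>' \<in> ?R"
        using subspace_diff[OF S _ d] by (intro exI[of _ "\<nu> - (\<phi> - \<psi>)"]) simp
    qed
  qed
  then show ?thesis by (simp add: tangent_class_def)
qed

lemma fst_tangent_class [simp]: "fst (tangent_class X x \<phi>) = x"
  by (simp add: tangent_class_def)

lemma carrier_tangent_space: "carrier (tangent_space X x) = tangent_class X x ` tangent_sum X x"
  by (simp add: tangent_space_def)

lemma zero_tangent_space: "\<zero>\<^bsub>tangent_space X x\<^esub> = tangent_class X x 0"
  by (simp add: tangent_space_def)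

lemma add_tangent_class:
  "tangent_class X x \<phi> \<oplus>\<^bsub>tangent_space X x\<^esub> tangent_class X x \<psi> = tangent_class X x (\<phi> + \<psi>)"
proof -
  let ?R = "tangent_relations X x"
  note S = subspace_tangent_relations[of X x]
  have "{\<phi>' + \<psi>' |\<phi>' \<psi>'. \<phi>' \<in> {\<phi> + \<nu> |\<nu>. \<nu> \<in> ?R} \<and> \<psi>' \<in> {\<psi> + \<nu> |\<nu>. \<nu> \<in> ?R}} = {\<phi> + \<psi> + \<nu> |\<nu>. \<nu> \<in> ?R}"
  proof safe
    fix \<mu> \<nu> assume "\<mu> \<in> ?R" "\<nu> \<in> ?R"
    then show "\<exists>\<nu>'. (\<phi> + \<mu>) + (\<psi> + \<nu>) = \<phi> + \<psi> + \<nu>' \<and> \<nu>' \<in> ?R"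
      using subspace_add[OF S] by (intro exI[of _ "\<mu> + \<nu>"]) (simp add: add_ac)
  next
    fix \<nu> assume "\<nu> \<in> ?R"
    moreover have "\<phi> = \<phi> + 0" "\<phi> + \<psi> + \<nu> = \<phi> + (\<psi> + \<nu>)" by (simp_all add: add.assoc)
    ultimately show "\<exists>\<phi>' \<psi>'. \<phi> + \<psi> + \<nu> = \<phi>' + \<psi>' \<and> \<phi>' \<in> {\<phi> + \<nu> |\<nu>. \<nu> \<in> ?R} \<and> \<psi>' \<in> {\<psi> + \<nu> |\<nu>. \<nu> \<in> ?R}"
      using subspace_0[OF S] by blast
  qed
  then show ?thesis by (simp add: tangent_space_def tangent_class_def)
qed

lemma smult_tangent_class:
  "c \<odot>\<^bsub>tangent_space X x\<^esub> tangent_class X x \<phi> = tangent_class X x (c *\<^sub>R \<phi>)"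
proof -
  let ?R = "tangent_relations X x"
  note S = subspace_tangent_relations[of X x]
  have "{c *\<^sub>R \<phi>' + \<nu> |\<phi>' \<nu>. \<phi>' \<in> {\<phi> + \<nu> |\<nu>. \<nu> \<in> ?R} \<and> \<nu> \<in> ?R} = {c *\<^sub>R \<phi> + \<nu> |\<nu>. \<nu> \<in> ?R}"
  proof safe
    fix \<mu> \<nu> assume "\<mu> \<in> ?R" "\<nu> \<in> ?R"
    then show "\<exists>\<nu>'. c *\<^sub>R (\<phi> + \<mu>) + \<nu> = c *\<^sub>R \<phi> + \<nu>' \<and> \<nu>' \<in> ?R"
      using subspace_add[OF S subspace_scale[OF S]]
      by (intro exI[of _ "c *\<^sub>R \<mu> + \<nu>"]) (simp add: scaleR_add_right add.assoc)
  next
    fix \<nu> assume "\<nu> \<in> ?R"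
    moreover have "\<phi> = \<phi> + 0" by simp
    ultimately show "\<exists>\<phi>' \<nu>'. c *\<^sub>R \<phi> + \<nu> = c *\<^sub>R \<phi>' + \<nu>' \<and> \<phi>' \<in> {\<phi> + \<nu> |\<nu>. \<nu> \<in> ?R} \<and> \<nu>' \<in> ?R"
      using subspace_0[OF S] by blast
  qed
  then show ?thesis by (simp add: tangent_space_def tangent_class_def)
qed

lemma tangent_space_cases:
  assumes "a \<in> carrier (tangent_space X x)"
  obtains \<phi> where "\<phi> \<in> tangent_sum X x" "a = tangent_class X x \<phi>"
  using assms by (auto simp: carrier_tangent_space)

lemma cring_real_ring: "cring real_ring"
proof (rule cringI)
  show "abelian_group real_ring"
    by (rule abelian_groupI) (auto simp: real_ring_def intro: exI[of _ "- x" for x])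
  show "comm_monoid real_ring"
    by (rule comm_monoidI) (auto simp: real_ring_def)
qed (simp add: real_ring_def algebra_simps)

lemma module_tangent_space: "Module.module real_ring (tangent_space X x)"
proof (rule moduleI)
  note S = subspace_tangent_sum[of X x]
  let ?T = "tangent_space X x"
  show "cring real_ring" by (rule cring_real_ring)
  have cl: "tangent_class X x \<phi> \<in> carrier ?T" if "\<phi> \<in> tangent_sum X x" for \<phi>
    using that by (simp add: carrier_tangent_space)
  show "abelian_group ?T"
  proof (rule abelian_groupI)
    fix a assume "a \<in> carrier ?T"
    then obtain \<phi> where \<phi>: "\<phi> \<in> tangent_sum X x" "a = tangent_class X x \<phi>" by (rule tangent_space_cases)
    show "\<zero>\<^bsub>?T\<^esub> \<oplus>\<^bsub>?T\<^esub> a = a" by (simp add: \<phi> zero_tangent_space add_tangent_class)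
    show "\<exists>b\<in>carrier ?T. b \<oplus>\<^bsub>?T\<^esub> a = \<zero>\<^bsub>?T\<^esub>"
      using subspace_neg[OF S \<phi>(1)] by (intro bexI[of _ "tangent_class X x (- \<phi>)"]) (auto simp: \<phi> zero_tangent_space add_tangent_class cl)
  next
    fix a b assume "a \<in> carrier ?T" "b \<in> carrier ?T"
    then show "a \<oplus>\<^bsub>?T\<^esub> b \<in> carrier ?T" "a \<oplus>\<^bsub>?T\<^esub> b = b \<oplus>\<^bsub>?T\<^esub> a"
      using subspace_add[OF S] by (auto elim!: tangent_space_cases simp: add_tangent_class add.commute intro!: cl)
  next
    fix a b c assume "a \<in> carrier ?T" "b \<in> carrier ?T" "c \<in> carrier ?T"
    then show "a \<oplus>\<^bsub>?T\<^esub> b \<oplus>\<^bsub>?T\<^esub> c = a \<oplus>\<^bsub>?T\<^esub> (b \<oplus>\<^bsub>?T\<^esub> c)"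
      by (auto elim!: tangent_space_cases simp: add_tangent_class add.assoc)
  next
    show "\<zero>\<^bsub>?T\<^esub> \<in> carrier ?T" using subspace_0[OF S] by (simp add: zero_tangent_space cl)
  qed
  fix c a assume "a \<in> carrier ?T"
  then show "c \<odot>\<^bsub>?T\<^esub> a \<in> carrier ?T"
    using subspace_scale[OF S] by (auto elim!: tangent_space_cases simp: smult_tangent_class intro!: cl)
qed (auto elim!: tangent_space_cases simp: smult_tangent_class add_tangent_class real_ring_def
      scaleR_add_left scaleR_add_right)

lemma tangent_points_cases:
  assumes "a \<in> tangent_points X"
  obtains x \<phi> where "x \<in> points X" "\<phi> \<in> tangent_sum X x" "a = tangent_class X x \<phi>"
  using assms by (auto simp: tangent_points_def carrier_tangent_space)

lemma tangent_class_points: "x \<in> points X \<Longrightarrow> \<phi> \<in> tangent_sum X x \<Longrightarrow> tangent_class X x \<phi> \<in> tangent_points X"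
  by (auto simp: tangent_points_def carrier_tangent_space)

lemma tangent_relations_arrow:
  "P \<in> plots_at X x \<Longrightarrow> Q \<in> plots_at X x \<Longrightarrow> plot_arrow P Q f \<Longrightarrow> v \<in> Rn (fst P) \<Longrightarrow>
   incl P v - incl Q (differential (fst P) f 0 v) \<in> tangent_relations X x"
  unfolding tangent_relations_def by (rule span_base) blast

text \<open>This is the universal property of the colimit: the relations are a span, so
  compatibility with single arrows suffices. Finite support is carried along because additivity of
  \<open>lin_ext\<close> is available for such families.\<close>

lemma lin_ext_tangent_relations:
  assumes J: "\<forall>P. linear (J P)" and T: "subspace T"
    and arr: "\<And>P Q f v. P \<in> plots_at X x \<Longrightarrow> Q \<in> plots_at X x \<Longrightarrow> plot_arrow P Q f \<Longrightarrow> v \<in> Rn (fst P) \<Longrightarrow>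
      J P v - J Q (differential (fst P) f 0 v) \<in> T"
    and \<nu>: "\<nu> \<in> tangent_relations X x"
  shows "\<nu> \<in> finsupp \<and> lin_ext J \<nu> \<in> T"
proof -
  have S: "subspace {\<nu>. \<nu> \<in> finsupp \<and> lin_ext J \<nu> \<in> T}"
  proof (rule subspaceI)
    have "lin_ext J 0 = 0" by (simp add: lin_ext_def)
    then show "0 \<in> {\<nu>. \<nu> \<in> finsupp \<and> lin_ext J \<nu> \<in> T}"
      using subspace_0[OF subspace_finsupp] subspace_0[OF T] by simp
  qed (simp_all add: lin_ext_add[OF J] lin_ext_scaleR[OF J] subspace_add[OF T] subspace_scale[OF T]
         finsupp_add finsupp_scaleR)
  have "tangent_relations X x \<subseteq> {\<nu>. \<nu> \<in> finsupp \<and> lin_ext J \<nu> \<in> T}"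
    unfolding tangent_relations_def
  proof (rule span_minimal[OF _ S], safe)
    fix n U p m V q f v
    assume *: "(n, U, p) \<in> plots_at X x" "(m, V, q) \<in> plots_at X x" "plot_arrow (n, U, p) (m, V, q) f" "v \<in> Rn (fst (n, U, p))"
    show "incl (n, U, p) v - incl (m, V, q) (differential (fst (n, U, p)) f 0 v) \<in> finsupp"
      by (intro subspace_diff[OF subspace_finsupp] incl_finsupp)
    show "lin_ext J (incl (n, U, p) v - incl (m, V, q) (differential (fst (n, U, p)) f 0 v)) \<in> T"
      unfolding lin_ext_diff[OF J incl_finsupp incl_finsupp] lin_ext_incl[OF J] by (rule arr[OF *])
  qed
  then show ?thesis using \<nu> by blast
qed

lemma differential_eq:
  assumes "\<And>i j. i < n \<Longrightarrow> ((\<lambda>t. f ((\<lambda>_. 0)(i := t)) j) has_real_derivative d i j) (at 0)"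
  shows "differential n f 0 v = (\<lambda>j. \<Sum>i<n. v i * d i j)"
proof
  fix j
  have "deriv (\<lambda>t. f (0(i := t)) j) (0 i) = d i j" if "i < n" for i
    using DERIV_imp_deriv[OF assms[OF that, of j]] by (simp add: zero_fun_def)
  then show "differential n f 0 v j = (\<Sum>i<n. v i * d i j)" by (simp add: differential_def)
qed

lemma differential_id: "v \<in> Rn n \<Longrightarrow> differential n (\<lambda>x. x) 0 v = v"
proof -
  assume v: "v \<in> Rn n"
  have "((\<lambda>t. ((\<lambda>_. 0)(i := t)) j) has_real_derivative (if i = j then 1 else 0)) (at 0)" for i j :: nat
    by (cases "i = j") auto
  then have "differential n (\<lambda>x. x) 0 v = (\<lambda>j. \<Sum>i<n. v i * (if i = j then 1 else 0))"
    by (rule differential_eq)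
  also have "\<dots> = v" using v by (auto simp: fun_eq_iff if_distrib cong: if_cong)
  finally show ?thesis .
qed

lemma tangent_class_arrow:
  assumes "P \<in> plots_at X x" "Q \<in> plots_at X x" "plot_arrow P Q f" "v \<in> Rn (fst P)"
    and "differential (fst P) f 0 v = w"
  shows "tangent_class X x (incl P v) = tangent_class X x (incl Q w)"
  using tangent_relations_arrow[OF assms(1-4)] assms(5) by (simp add: tangent_class_eq_iff)

text \<open>The inclusion of domains is an arrow with identity differential. Hence shrinking the
  domain of a plot does not change the vectors it represents.\<close>

lemma tangent_class_restrict:
  assumes "(n, U, p) \<in> plots_at X x" "(n, V, q) \<in> plots_at X x" "U \<subseteq> V" "\<And>u. u \<in> U \<Longrightarrow> p u = q u" "v \<in> Rn n"
  shows "tangent_class X x (incl (n, U, p) v) = tangent_class X x (incl (n, V, q) v)"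
proof (rule tangent_class_arrow[OF assms(1,2)])
  show "plot_arrow (n, U, p) (n, V, q) (\<lambda>x. x)"
    using assms(3,4) smooth_between_id[of U V n] unfolding plot_arrow_def
    by (auto intro!: smooth_betweenI)
qed (use assms(5) differential_id in auto)

section \<open>Tangent maps\<close>

lemma push_plot_at:
  assumes "smooth_map X Y f" "P \<in> plots_at X x"
  shows "push_plot f P \<in> plots_at Y (f x)"
  using assms smooth_map_plots[OF assms(1)] by (auto simp: plots_at_def push_plot_def o_def)

lemma fst_push_plot [simp]: "fst (push_plot f P) = fst P"
  by (simp add: push_plot_def split: prod.split)

lemma push_plot_arrow: "plot_arrow P Q h \<Longrightarrow> plot_arrow (push_plot f P) (push_plot f Q) h"
  by (auto simp: plot_arrow_def push_plot_def split: prod.splits)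

text \<open>Grouping the support by composite plot gives \<open>push_sum\<close>; adding the
  inclusions one by one gives the linear extension, to which the additivity lemmas apply.\<close>

lemma push_sum_eq_lin_ext:
  assumes "\<phi> \<in> finsupp"
  shows "push_sum f \<phi> = lin_ext (\<lambda>P. incl (push_plot f P)) \<phi>"
proof
  fix Q
  have fin: "finite {P. \<phi> P \<noteq> 0}" using assms by (simp add: finsupp_def)
  have "lin_ext (\<lambda>P. incl (push_plot f P)) \<phi> Q = (\<Sum>P | \<phi> P \<noteq> 0. if push_plot f P = Q then \<phi> P else 0)"
    by (auto simp: lin_ext_def sum_fun_apply incl_def intro!: sum.cong)
  also have "\<dots> = (\<Sum>P | \<phi> P \<noteq> 0 \<and> push_plot f P = Q. \<phi> P)"
    unfolding sum.inter_filter[OF fin, symmetric] by (rule sum.cong) simp_all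
  finally show "push_sum f \<phi> Q = lin_ext (\<lambda>P. incl (push_plot f P)) \<phi> Q" by (simp add: push_sum_def)
qed

lemma push_sum_incl: "push_sum f (incl P v) = incl (push_plot f P) v"
  by (simp add: push_sum_eq_lin_ext incl_finsupp lin_ext_incl linear_incl)

lemma lin_ext_tangent_sum:
  assumes T: "subspace T" and "\<And>P v. P \<in> plots_at X x \<Longrightarrow> v \<in> Rn (fst P) \<Longrightarrow> J P v \<in> T"
    and "\<phi> \<in> tangent_sum X x"
  shows "lin_ext J \<phi> \<in> T"
  unfolding lin_ext_def by (rule subspace_sum[OF T]) (use assms(2) tangent_sum_memD[OF assms(3)] in simp)

lemma push_tangent_sum:
  assumes f: "smooth_map X Y f" and \<phi>: "\<phi> \<in> tangent_sum X x"
  shows "push_sum f \<phi> \<in> tangent_sum Y (f x)"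
  unfolding push_sum_eq_lin_ext[OF tangent_sum_finsupp[OF \<phi>]]
  by (rule lin_ext_tangent_sum[OF subspace_tangent_sum _ \<phi>]) (intro incl_tangent_sum push_plot_at[OF f], auto)

text \<open>Composing plots with \<open>f\<close> keeps every arrow an arrow with the same
  underlying map, so relations go to relations. The union in \<open>pushforward\<close> therefore
  consists of copies of one coset.\<close>

lemma pushforward_tangent_class:
  assumes f: "smooth_map X Y f" and \<phi>: "\<phi> \<in> finsupp"
  shows "pushforward X Y f (tangent_class X x \<phi>) = tangent_class Y (f x) (push_sum f \<phi>)"
proof -
  let ?R = "tangent_relations X x"
  have lin: "\<forall>P :: 'a plot. linear (incl (push_plot f P))" by (simp add: linear_incl)
  have rel: "\<nu> \<in> finsupp \<and> push_sum f \<nu> \<in> tangent_relations Y (f x)" if \<nu>: "\<nu> \<in> ?R" for \<nu>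
  proof -
    have "\<nu> \<in> finsupp \<and> lin_ext (\<lambda>P. incl (push_plot f P)) \<nu> \<in> tangent_relations Y (f x)"
    proof (rule lin_ext_tangent_relations[OF lin subspace_tangent_relations _ \<nu>])
      fix P Q h v assume "P \<in> plots_at X x" "Q \<in> plots_at X x" "plot_arrow P Q h" "v \<in> Rn (fst P)"
      then show "incl (push_plot f P) v - incl (push_plot f Q) (differential (fst P) h 0 v) \<in> tangent_relations Y (f x)"
        using tangent_relations_arrow[OF push_plot_at[OF f] push_plot_at[OF f] push_plot_arrow, of P x Q h v] by simp
    qed
    then show ?thesis using push_sum_eq_lin_ext by metis
  qed
  have "tangent_class Y (f x) (push_sum f (\<phi> + \<nu>)) = tangent_class Y (f x) (push_sum f \<phi>)" if "\<nu> \<in> ?R" for \<nu>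
  proof -
    have "push_sum f (\<phi> + \<nu>) = push_sum f \<phi> + push_sum f \<nu>"
      using rel[OF that] \<phi> lin_ext_add[OF lin, of \<phi> \<nu>] by (simp only: push_sum_eq_lin_ext finsupp_add)
    then show ?thesis using rel[OF that] by (simp add: tangent_class_eq_iff)
  qed
  moreover have "0 \<in> ?R" by (rule subspace_0[OF subspace_tangent_relations])
  ultimately have "(\<Union>\<psi>\<in>snd (tangent_class X x \<phi>). snd (tangent_class Y (f x) (push_sum f \<psi>)))
      = snd (tangent_class Y (f x) (push_sum f \<phi>))"
    unfolding tangent_class_def[of X] by auto
  then show ?thesis by (simp add: pushforward_def) (simp add: tangent_class_def)
qed

lemma pushforward_incl:
  "smooth_map X Y f \<Longrightarrow> pushforward X Y f (tangent_class X x (incl P v)) = tangent_class Y (f x) (incl (push_plot f P) v)"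
  by (simp add: pushforward_tangent_class incl_finsupp push_sum_incl)

section \<open>Recentred plots and velocities of curves\<close>

lemma connected_Rn: "connected (Rn n)"
  using connected_Euclidean_space[of n]
  unfolding connectedin_topspace[symmetric] connectedin_subtopology
  by (simp add: Euclidean_space_def euclidean_product_topology connectedin_subtopology)

lemma openin_Rn [simp]: "openin (Euclidean_space n) (Rn n)"
  by (rule openin_topspace)

lemma plots_atI:
  "(n, U, p) \<in> plots X \<Longrightarrow> connected U \<Longrightarrow> 0 \<in> U \<Longrightarrow> p 0 = x \<Longrightarrow> (n, U, p) \<in> plots_at X x"
  by (simp add: plots_at_def)

lemma openin_translate:
  assumes U: "openin (Euclidean_space n) U" and u: "u \<in> U"
  shows "openin (Euclidean_space n) {w. u + w \<in> U}"
proof -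
  have uR: "u \<in> Rn n" by (rule openin_Euclidean_subset[OF U u])
  have sub: "{w. u + w \<in> U} \<subseteq> Rn n"
  proof
    fix w assume "w \<in> {w. u + w \<in> U}"
    then have "u + w \<in> Rn n" using openin_Euclidean_subset[OF U] by blast
    then show "w \<in> Rn n" using uR by simp
  qed
  have "smooth_between n (Rn n) n (Rn n) (\<lambda>w. u + w)"
    by (rule smooth_betweenI) (use uR in \<open>auto intro: smooth_fun_add\<close>)
  from smooth_between_preimage[OF openin_Rn openin_Rn this U]
  have "openin (Euclidean_space n) {w \<in> Rn n. u + w \<in> U}" .
  moreover have "{w \<in> Rn n. u + w \<in> U} = {w. u + w \<in> U}" using sub by blast
  ultimately show ?thesis by simp
qed

lemma smooth_between_translate:
  "W \<subseteq> {w. u + w \<in> U} \<Longrightarrow> smooth_between n W n U (\<lambda>w. u + w)"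
  by (rule smooth_betweenI) (auto intro: smooth_fun_add)

text \<open>The composite of \<open>p\<close> with the translated plot used in
  \<open>domain_tvec\<close>. In these terms every value of \<open>plot_tangent\<close> is the class
  of a single inclusion.\<close>

definition germ_plot :: "nat \<Rightarrow> rvec set \<Rightarrow> (rvec \<Rightarrow> 'a) \<Rightarrow> rvec \<Rightarrow> 'a plot" where
  "germ_plot n U p u = (n, connected_component_set {w. u + w \<in> U} 0, \<lambda>w. p (u + w))"

lemma germ_domain:
  assumes U: "openin (Euclidean_space n) U" and u: "u \<in> U"
  shows "openin (Euclidean_space n) (connected_component_set {w. u + w \<in> U} 0)"
    "0 \<in> connected_component_set {w. u + w \<in> U} 0"
    "connected_component_set {w. u + w \<in> U} 0 \<subseteq> {w. u + w \<in> U}"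
  using connected_component_openin_Euclidean[OF openin_translate[OF U u]] u
  by (auto intro: connected_component_refl dest: connected_component_in)

lemma germ_plot_at:
  assumes X: "diffeological_space X" and p: "(n, U, p) \<in> plots X" and u: "u \<in> U"
  shows "germ_plot n U p u \<in> plots_at X (p u)"
proof -
  note U = dspace_open[OF X p]
  note g = germ_domain[OF U u]
  have "(n, connected_component_set {w. u + w \<in> U} 0, p \<circ> (\<lambda>w. u + w)) \<in> plots X"
    by (rule dspace_precomp[OF X p g(1) smooth_between_translate[OF g(3)]])
  then show ?thesis unfolding germ_plot_def
    by (intro plots_atI g(2) connected_connected_component) (simp_all add: o_def)
qed

lemma smooth_map_domain_space:
  assumes X: "diffeological_space X" and p: "(n, U, p) \<in> plots X"
  shows "smooth_map (domain_space n U) X p"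
proof (rule smooth_mapI)
  fix u assume "u \<in> points (domain_space n U)"
  then show "p u \<in> points X" using dspace_points[OF X p] by (simp add: domain_space_def)
next
  fix m V f assume "(m, V, f) \<in> plots (domain_space n U)"
  then show "(m, V, \<lambda>u. p (f u)) \<in> plots X"
    using dspace_precomp[OF X p, of m V f] by (simp add: domain_space_def o_def)
qed

lemma plot_tangent_eq:
  assumes X: "diffeological_space X" and p: "(n, U, p) \<in> plots X"
  shows "plot_tangent X (n, U, p) (u, v) = tangent_class X (p u) (incl (germ_plot n U p u) v)"
  by (simp add: plot_tangent_def domain_tvec_def pushforward_incl[OF smooth_map_domain_space[OF X p]]
      push_plot_def germ_plot_def o_def)

abbreviation unit_rvec :: rvec where "unit_rvec \<equiv> (\<lambda>i. if i = 0 then 1 else 0)"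

lemma velocity_eq:
  assumes "smooth_map real_space D g"
  shows "velocity D g t = tangent_class D (g t) (incl (1, Rn 1, \<lambda>w. g (t + w 0)) unit_rvec)"
  unfolding velocity_def d_dt_def pushforward_incl[OF assms] by (simp add: push_plot_def o_def)

lemma curve_plot_at:
  assumes "smooth_map real_space D g"
  shows "(1, Rn 1, \<lambda>w. g (t + w 0)) \<in> plots_at D (g t)"
proof (rule plots_atI)
  show "(1, Rn 1, \<lambda>w. g (t + w 0)) \<in> plots D"
    by (rule smooth_map_plots[OF assms]) (simp add: smooth_fun_add)
qed (simp_all add: connected_Rn)

lemma velocity_push:
  assumes g: "smooth_map real_space X g" and f: "smooth_map X Y f"
  shows "velocity Y (\<lambda>t. f (g t)) t = pushforward X Y f (velocity X g t)"
  using velocity_eq[OF smooth_map_compose[OF g f], of t]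
  by (simp add: velocity_eq[OF g] pushforward_incl[OF f] push_plot_def o_def)

lemma differential_1:
  assumes "\<And>j. ((\<lambda>t. f ((\<lambda>_. 0)(0 := t)) j) has_real_derivative d j) (at 0)"
  shows "differential 1 f 0 unit_rvec = d"
  using differential_eq[of 1 f "\<lambda>_ j. d j" unit_rvec] assms by simp

lemma incl_zero [simp]: "incl P 0 = 0"
  by (auto simp: incl_def fun_eq_iff)

text \<open>Collapsing the line to the origin is an arrow from the constant plot to itself, and its
  differential is zero.\<close>

lemma velocity_const:
  assumes D: "diffeological_space D" and x: "x \<in> points D"
  shows "velocity D (\<lambda>_. x) t = tangent_class D x 0"
proof -
  have c: "smooth_map real_space D (\<lambda>_. x)"
    by (rule smooth_mapI) (use x dspace_const[OF D x] in auto)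
  have P: "(1, Rn 1, \<lambda>w. x) \<in> plots_at D x" using curve_plot_at[OF c] .
  have "tangent_class D x (incl (1, Rn 1, \<lambda>w. x) unit_rvec) = tangent_class D x (incl (1, Rn 1, \<lambda>w. x) 0)"
  proof (rule tangent_class_arrow[OF P P, of "\<lambda>_. 0"])
    show "plot_arrow (1, Rn 1, \<lambda>w. x) (1, Rn 1, \<lambda>w. x) (\<lambda>_. 0)"
      by (auto simp: plot_arrow_def intro!: smooth_betweenI)
    have "differential 1 (\<lambda>_. 0) 0 unit_rvec = (\<lambda>_. 0)"
      by (rule differential_1) simp
    then show "differential (fst (1::nat, Rn 1, \<lambda>w::rvec. x)) (\<lambda>_. 0) 0 unit_rvec = 0" by (simp add: zero_fun_def)
  qed simp
  then show ?thesis using velocity_eq[OF c] by simp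
qed

section \<open>Curves in diffeological groups\<close>

lemma
  assumes "diffeological_group G D"
  shows diffeological_group_group: "group G"
    and diffeological_group_space: "diffeological_space D"
    and diffeological_group_points: "points D = carrier G"
  using assms by (auto simp: diffeological_group_def)

lemma diffeological_group_mult:
  assumes G: "diffeological_group G D" and "(n, U, p) \<in> plots D" "(n, U, q) \<in> plots D"
  shows "(n, U, \<lambda>u. p u \<otimes>\<^bsub>G\<^esub> q u) \<in> plots D"
proof -
  have "smooth_map (prod_space D D) D (\<lambda>(g, h). g \<otimes>\<^bsub>G\<^esub> h)" using G by (simp add: diffeological_group_def)
  from smooth_map_plots[OF this, of n U "\<lambda>u. (p u, q u)"] show ?thesis using assms(2,3) by simp
qed

lemma diffeological_group_inv:
  assumes G: "diffeological_group G D" and "(n, U, p) \<in> plots D"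
  shows "(n, U, \<lambda>u. inv\<^bsub>G\<^esub> p u) \<in> plots D"
proof -
  have "smooth_map D D (\<lambda>g. inv\<^bsub>G\<^esub> g)" using G by (simp add: diffeological_group_def)
  from smooth_map_plots[OF this assms(2)] show ?thesis .
qed

text \<open>The plot \<open>(r, s) \<mapsto> g r \<otimes> h s\<close> of the plane contains all
  three curves: the axes give \<open>g\<close> and \<open>h\<close>, the diagonal gives the product,
  and the tangent vector (1, 1) of the diagonal is (1, 0) + (0, 1).\<close>

lemma velocity_mult:
  assumes G: "diffeological_group G D"
    and g: "smooth_map real_space D g" "g 0 = \<one>\<^bsub>G\<^esub>" and h: "smooth_map real_space D h" "h 0 = \<one>\<^bsub>G\<^esub>"
  shows "smooth_map real_space D (\<lambda>t. g t \<otimes>\<^bsub>G\<^esub> h t)"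
    and "velocity D (\<lambda>t. g t \<otimes>\<^bsub>G\<^esub> h t) 0 =
      velocity D g 0 \<oplus>\<^bsub>tangent_space D \<one>\<^bsub>G\<^esub>\<^esub> velocity D h 0"
proof -
  interpret group G by (rule diffeological_group_group[OF G])
  note car = diffeological_group_points[OF G]
  have gc: "g t \<in> carrier G" and hc: "h t \<in> carrier G" for t
    using smooth_map_points[OF g(1), of t] smooth_map_points[OF h(1), of t] car by simp_all
  show gh: "smooth_map real_space D (\<lambda>t. g t \<otimes>\<^bsub>G\<^esub> h t)"
  proof (rule smooth_mapI)
    show "g t \<otimes>\<^bsub>G\<^esub> h t \<in> points D" for t using gc hc car by simp
    fix n U and p :: "rvec \<Rightarrow> real" assume "(n, U, p) \<in> plots real_space"
    from smooth_map_plots[OF g(1) this] smooth_map_plots[OF h(1) this]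
    show "(n, U, \<lambda>u. g (p u) \<otimes>\<^bsub>G\<^esub> h (p u)) \<in> plots D" by (rule diffeological_group_mult[OF G])
  qed
  define Q where "Q = (2::nat, Rn 2, \<lambda>z::rvec. g (z 0) \<otimes>\<^bsub>G\<^esub> h (z 1))"
  have Q: "Q \<in> plots_at D \<one>\<^bsub>G\<^esub>" unfolding Q_def
  proof (rule plots_atI)
    have "(2, Rn 2, \<lambda>z. z i) \<in> plots real_space" for i by simp
    from smooth_map_plots[OF g(1) this[of 0]] smooth_map_plots[OF h(1) this[of 1]]
    show "(2, Rn 2, \<lambda>z. g (z 0) \<otimes>\<^bsub>G\<^esub> h (z 1)) \<in> plots D" by (rule diffeological_group_mult[OF G])
  qed (use g h in \<open>simp_all add: connected_Rn\<close>)
  \<comment> \<open>\<open>A\<close> is the set of coordinates along which \<open>c\<close> moves: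
    one index for an axis, both for the diagonal.\<close>
  have arrow: "velocity D c 0 = tangent_class D \<one>\<^bsub>G\<^esub> (incl Q (\<lambda>j. if j \<in> A then 1 else 0))"
    if c: "smooth_map real_space D c" "c 0 = \<one>\<^bsub>G\<^esub>"
      and A: "A \<subseteq> {0, 1}" "\<And>t. c t = g (if 0 \<in> A then t else 0) \<otimes>\<^bsub>G\<^esub> h (if 1 \<in> A then t else 0)"
    for c and A :: "nat set"
  proof -
    define f where "f w = (\<lambda>j. if j \<in> A then w 0 else 0)" for w :: rvec
    have "tangent_class D \<one>\<^bsub>G\<^esub> (incl (1, Rn 1, \<lambda>w. c (0 + w 0)) unit_rvec)
        = tangent_class D \<one>\<^bsub>G\<^esub> (incl Q (\<lambda>j. if j \<in> A then 1 else 0))"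
    proof (rule tangent_class_arrow[OF _ Q, of _ f])
      show "(1, Rn 1, \<lambda>w. c (0 + w 0)) \<in> plots_at D \<one>\<^bsub>G\<^esub>" using curve_plot_at[OF c(1), of 0] c(2) by simp
      have "smooth_between 1 (Rn 1) 2 (Rn 2) f"
      proof (rule smooth_betweenI)
        have "j \<notin> A" if "2 \<le> j" for j using A(1) that by auto
        then show "f ` Rn 1 \<subseteq> Rn 2" by (auto simp: f_def)
        show "smooth_fun 1 (Rn 1) (\<lambda>u. f u j)" for j by (cases "j \<in> A") (simp_all add: f_def)
      qed
      then show "plot_arrow (1, Rn 1, \<lambda>w. c (0 + w 0)) Q f"
        unfolding plot_arrow_def Q_def using A(2) by (auto simp: f_def)
      have "differential 1 f 0 unit_rvec = (\<lambda>j. if j \<in> A then 1 else 0)"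
        by (rule differential_1) (simp add: f_def)
      then show "differential (fst (1::nat, Rn 1, \<lambda>w::rvec. c (0 + w 0))) f 0 unit_rvec = (\<lambda>j. if j \<in> A then 1 else 0)" by simp
    qed simp
    then show ?thesis using velocity_eq[OF c(1), of 0] c(2) by simp
  qed
  have "incl Q (\<lambda>j. if j \<in> {0, 1} then 1 else 0) =
      incl Q (\<lambda>j. if j \<in> {0} then 1 else 0) + incl Q (\<lambda>j. if j \<in> {1} then 1 else 0)"
    by (auto simp: incl_def fun_eq_iff)
  moreover have "velocity D (\<lambda>t. g t \<otimes>\<^bsub>G\<^esub> h t) 0 = tangent_class D \<one>\<^bsub>G\<^esub> (incl Q (\<lambda>j. if j \<in> {0, 1} then 1 else 0))"
    by (rule arrow[OF gh]) (use g h in simp_all)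
  moreover have "velocity D g 0 = tangent_class D \<one>\<^bsub>G\<^esub> (incl Q (\<lambda>j. if j \<in> {0} then 1 else 0))"
    by (rule arrow[OF g]) (use h gc in simp_all)
  moreover have "velocity D h 0 = tangent_class D \<one>\<^bsub>G\<^esub> (incl Q (\<lambda>j. if j \<in> {1} then 1 else 0))"
    by (rule arrow[OF h]) (use g hc in simp_all)
  ultimately show "velocity D (\<lambda>t. g t \<otimes>\<^bsub>G\<^esub> h t) 0 =
      velocity D g 0 \<oplus>\<^bsub>tangent_space D \<one>\<^bsub>G\<^esub>\<^esub> velocity D h 0"
    by (simp only: add_tangent_class)
qed

text \<open>A single plot gives a curve defined on all of \<open>\<real>\<close> by following the bounded
  reparametrisation \<open>t \<mapsto> \<epsilon> sin (t/\<epsilon>)\<close> of a line.\<close>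

lemma plot_vector_velocity:
  assumes D: "diffeological_space D" and P: "P \<in> plots_at D x" and v: "v \<in> Rn (fst P)"
  shows "\<exists>g. smooth_map real_space D g \<and> g 0 = x \<and> velocity D g 0 = tangent_class D x (incl P v)"
proof -
  obtain n U p where PU: "P = (n, U, p)" by (cases P)
  have p: "(n, U, p) \<in> plots D" and U0: "0 \<in> U" and p0: "p 0 = x" using P by (auto simp: PU plots_at_def)
  have vR: "v \<in> Rn n" using v PU by simp
  note U = dspace_open[OF D p]
  obtain \<delta> where \<delta>: "\<delta> > 0" "\<And>z. z \<in> Rn n \<Longrightarrow> (\<And>j. j < n \<Longrightarrow> \<bar>z j - 0 j\<bar> < \<delta>) \<Longrightarrow> z \<in> U"
    using openin_Euclidean_boxE[OF U U0] by metis
  \<comment> \<open>The summand 1 makes \<open>M\<close> positive even for \<open>v = 0\<close> and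
    a strict bound for every coordinate, so multiples of \<open>v\<close> by factors of size at most
    \<open>\<delta> / M\<close> stay in the cube.\<close>
  define M where "M = (\<Sum>j<n. \<bar>v j\<bar>) + 1"
  have Mj: "\<bar>v j\<bar> < M" if "j < n" for j
    using that member_le_sum[of j "{..<n}" "\<lambda>j. \<bar>v j\<bar>"] by (auto simp: M_def)
  have M0: "M > 0" by (simp add: M_def add_nonneg_pos sum_nonneg)
  define \<epsilon> where "\<epsilon> = \<delta> / M"
  have e: "\<epsilon> > 0" using \<delta>(1) M0 by (simp add: \<epsilon>_def)
  define \<sigma> where "\<sigma> t = \<epsilon> * sin (t / \<epsilon>)" for t
  have \<sigma>0: "\<sigma> 0 = 0" by (simp add: \<sigma>_def)
  have \<sigma>': "(\<sigma> has_real_derivative 1) (at 0)"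
    unfolding \<sigma>_def using e by (auto intro!: derivative_eq_intros)
  define L where "L t = (\<lambda>j. \<sigma> t * v j)" for t
  have LU: "L t \<in> U" for t
  proof (rule \<delta>(2))
    show "L t \<in> Rn n" using vR by (simp add: L_def)
    fix j assume j: "j < n"
    have "\<bar>\<sigma> t\<bar> \<le> \<epsilon> * 1" unfolding \<sigma>_def abs_mult using e by (intro mult_mono) auto
    then have "\<bar>\<sigma> t * v j\<bar> \<le> \<epsilon> * \<bar>v j\<bar>" unfolding abs_mult by (intro mult_right_mono) auto
    also have "\<dots> < \<epsilon> * M" using e Mj[OF j] by (intro mult_strict_left_mono) auto
    also have "\<dots> = \<delta>" using M0 by (simp add: \<epsilon>_def)
    finally show "\<bar>L t j - 0 j\<bar> < \<delta>" by (simp add: L_def)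
  qed
  have L_smooth: "smooth_between m V n U (\<lambda>z. L (f z))" if "smooth_fun m V f" for m V f
  proof (rule smooth_betweenI)
    show "(\<lambda>z. L (f z)) ` V \<subseteq> U" using LU by blast
    have "smooth_fun m V (\<lambda>z. \<epsilon> * sin (f z * (1 / \<epsilon>)) * v j)" for j
      by (intro smooth_fun_mult smooth_fun_sin smooth_fun_const that)
    then show "smooth_fun m V (\<lambda>u. L (f u) j)" for j by (simp add: L_def \<sigma>_def)
  qed
  have g: "smooth_map real_space D (\<lambda>t. p (L t))"
  proof (rule smooth_mapI)
    show "p (L t) \<in> points D" for t using dspace_points[OF D p LU] .
    fix m V and f :: "rvec \<Rightarrow> real" assume "(m, V, f) \<in> plots real_space"
    then show "(m, V, \<lambda>u. p (L (f u))) \<in> plots D"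
      using dspace_precomp[OF D p, of m V "\<lambda>z. L (f z)"] L_smooth by (simp add: o_def)
  qed
  have L0: "L 0 = 0" by (auto simp: L_def \<sigma>0)
  have "tangent_class D x (incl (1, Rn 1, \<lambda>w. p (L (0 + w 0))) unit_rvec) = tangent_class D x (incl P v)"
  proof (rule tangent_class_arrow[OF _ P, of _ "\<lambda>w. L (w 0)"])
    show "(1, Rn 1, \<lambda>w. p (L (0 + w 0))) \<in> plots_at D x" using curve_plot_at[OF g, of 0] L0 p0 by simp
    have "smooth_between 1 (Rn 1) n U (\<lambda>w. L (w 0))" by (rule L_smooth) simp
    then show "plot_arrow (1, Rn 1, \<lambda>w. p (L (0 + w 0))) P (\<lambda>w. L (w 0))"
      unfolding plot_arrow_def PU by (simp add: L0)
    have "differential 1 (\<lambda>w. L (w 0)) 0 unit_rvec = v"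
      by (rule differential_1) (use \<sigma>' in \<open>auto simp: L_def intro!: derivative_eq_intros\<close>)
    then show "differential (fst (1::nat, Rn 1, \<lambda>w::rvec. p (L (0 + w 0)))) (\<lambda>w. L (w 0)) 0 unit_rvec = v" by simp
  qed simp
  then have "velocity D (\<lambda>t. p (L t)) 0 = tangent_class D x (incl P v)"
    using velocity_eq[OF g, of 0] L0 p0 by simp
  then show ?thesis using g L0 p0 by (intro exI[of _ "\<lambda>t. p (L t)"]) simp
qed

text \<open>A representative is a finite sum of inclusions. Each inclusion is the velocity of a
  curve by \<open>plot_vector_velocity\<close>, and multiplying curves adds velocities. This
  supplies the curve that \<open>fundamental_vector\<close> asks for.\<close>

lemma lie_space_velocity:
  assumes G: "diffeological_group G D" and \<xi>: "\<xi> \<in> carrier (lie_space G D)"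
  shows "\<exists>g. smooth_map real_space D g \<and> g 0 = \<one>\<^bsub>G\<^esub> \<and> velocity D g 0 = \<xi>"
proof -
  interpret group G by (rule diffeological_group_group[OF G])
  note D = diffeological_group_space[OF G] and car = diffeological_group_points[OF G]
  obtain \<phi> where \<phi>: "\<phi> \<in> tangent_sum D \<one>\<^bsub>G\<^esub>" "\<xi> = tangent_class D \<one>\<^bsub>G\<^esub> \<phi>"
    using \<xi> unfolding lie_space_def by (rule tangent_space_cases)
  have "\<exists>g. smooth_map real_space D g \<and> g 0 = \<one>\<^bsub>G\<^esub> \<and>
      velocity D g 0 = tangent_class D \<one>\<^bsub>G\<^esub> (\<Sum>P\<in>A. incl P (\<phi> P))"
    if "finite A" "\<And>P. P \<in> A \<Longrightarrow> \<phi> P \<noteq> 0" for A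
    using that
  proof (induction A rule: finite_induct)
    case empty
    have "smooth_map real_space D (\<lambda>_. \<one>\<^bsub>G\<^esub>)"
      by (rule smooth_mapI) (use dspace_const[OF D] car in auto)
    moreover have "velocity D (\<lambda>_. \<one>\<^bsub>G\<^esub>) 0 = tangent_class D \<one>\<^bsub>G\<^esub> (\<Sum>P\<in>{}. incl P (\<phi> P))"
      unfolding sum.empty by (rule velocity_const[OF D]) (simp add: car)
    ultimately show ?case by blast
  next
    case (insert P A)
    from insert.prems have "P \<in> plots_at D \<one>\<^bsub>G\<^esub>" "\<phi> P \<in> Rn (fst P)"
      using tangent_sum_memD[OF \<phi>(1), of P] by blast+
    from plot_vector_velocity[OF D this] obtain g where
      g: "smooth_map real_space D g" "g 0 = \<one>\<^bsub>G\<^esub>" "velocity D g 0 = tangent_class D \<one>\<^bsub>G\<^esub> (incl P (\<phi> P))" by metis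
    obtain h where h: "smooth_map real_space D h" "h 0 = \<one>\<^bsub>G\<^esub>"
      "velocity D h 0 = tangent_class D \<one>\<^bsub>G\<^esub> (\<Sum>P\<in>A. incl P (\<phi> P))"
      using insert by auto
    show ?case
    proof (intro exI conjI)
      show "smooth_map real_space D (\<lambda>t. g t \<otimes>\<^bsub>G\<^esub> h t)" by (rule velocity_mult(1)[OF G g(1,2) h(1,2)])
      show "g 0 \<otimes>\<^bsub>G\<^esub> h 0 = \<one>\<^bsub>G\<^esub>" using g h by simp
      show "velocity D (\<lambda>t. g t \<otimes>\<^bsub>G\<^esub> h t) 0 = tangent_class D \<one>\<^bsub>G\<^esub> (\<Sum>P\<in>insert P A. incl P (\<phi> P))"
        unfolding velocity_mult(2)[OF G g(1,2) h(1,2)] g(3) h(3) add_tangent_class sum.insert[OF insert(1,2)] ..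
    qed
  qed
  note ex = this
  have "finite {P. \<phi> P \<noteq> 0}" using tangent_sum_finsupp[OF \<phi>(1)] by (simp add: finsupp_def)
  then have "\<exists>g. smooth_map real_space D g \<and> g 0 = \<one>\<^bsub>G\<^esub> \<and>
      velocity D g 0 = tangent_class D \<one>\<^bsub>G\<^esub> (\<Sum>P | \<phi> P \<noteq> 0. incl P (\<phi> P))"
    by (rule ex) (rule CollectD)
  moreover have "tangent_class D \<one>\<^bsub>G\<^esub> (\<Sum>P | \<phi> P \<noteq> 0. incl P (\<phi> P)) = \<xi>"
    unfolding \<phi>(2) by (rule arg_cong[OF finsupp_eq_sum_incl[OF tangent_sum_finsupp[OF \<phi>(1)], symmetric]])
  ultimately show ?thesis by (simp only:)
qed

section \<open>Smooth fibrewise linear maps out of the tangent bundle\<close>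

lemma fibrewise_add_plots:
  assumes F: "vector_pseudo_bundle F Y fst V" and "(n, U, a) \<in> plots F" "(n, U, b) \<in> plots F"
    and "\<And>u. u \<in> U \<Longrightarrow> fst (a u) = y" "\<And>u. u \<in> U \<Longrightarrow> fst (b u) = y"
    and dF: "diffeological_space F"
  shows "(n, U, \<lambda>u. a u \<oplus>\<^bsub>V y\<^esub> b u) \<in> plots F"
proof -
  have "smooth_map (subspace_of (prod_space F F) {(a, b). fst a = fst b}) F (\<lambda>(a, b). a \<oplus>\<^bsub>V (fst a)\<^esub> b)"
    using F by (simp add: vector_pseudo_bundle_def)
  from smooth_map_plots[OF this, of n U "\<lambda>u. (a u, b u)"]
  have "(n, U, \<lambda>u. a u \<oplus>\<^bsub>V (fst (a u))\<^esub> b u) \<in> plots F"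
    using assms(2-5) by (simp add: image_subset_iff)
  then show ?thesis by (rule dspace_cong[OF dF]) (simp add: assms(4))
qed

lemma fibrewise_smult_plots:
  assumes F: "vector_pseudo_bundle F Y fst V" and "(n, U, c) \<in> plots real_space" "(n, U, a) \<in> plots F"
    and "\<And>u. u \<in> U \<Longrightarrow> fst (a u) = y"
    and dF: "diffeological_space F"
  shows "(n, U, \<lambda>u. c u \<odot>\<^bsub>V y\<^esub> a u) \<in> plots F"
proof -
  have "smooth_map (prod_space real_space F) F (\<lambda>(c, a). c \<odot>\<^bsub>V (fst a)\<^esub> a)"
    using F by (simp add: vector_pseudo_bundle_def)
  from smooth_map_plots[OF this, of n U "\<lambda>u. (c u, a u)"]
  have "(n, U, \<lambda>u. c u \<odot>\<^bsub>V (fst (a u))\<^esub> a u) \<in> plots F"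
    using assms(2-4) by simp
  then show ?thesis by (rule dspace_cong[OF dF]) (simp add: assms(4))
qed

text \<open>Since the plots of \<open>TY\<close> form the intersection of all admissible diffeologies \<open>\<Q>\<close>, it
  suffices that each \<open>\<omega>\<^sup>*\<Q>\<close> is admissible on \<open>TX\<close>.\<close>

lemma smooth_map_tangent_bundle:
  fixes X :: "'a dspace" and Y :: "'b dspace"
  assumes X: "diffeological_space X"
    and carr: "\<And>a. \<omega> a \<in> carrier (tangent_space Y y)" and y: "y \<in> points Y"
    and add: "\<And>x a b. x \<in> points X \<Longrightarrow> a \<in> carrier (tangent_space X x) \<Longrightarrow> b \<in> carrier (tangent_space X x) \<Longrightarrow>
      \<omega> (a \<oplus>\<^bsub>tangent_space X x\<^esub> b) = \<omega> a \<oplus>\<^bsub>tangent_space Y y\<^esub> \<omega> b"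
    and smult: "\<And>x a c. x \<in> points X \<Longrightarrow> a \<in> carrier (tangent_space X x) \<Longrightarrow>
      \<omega> (c \<odot>\<^bsub>tangent_space X x\<^esub> a) = c \<odot>\<^bsub>tangent_space Y y\<^esub> \<omega> a"
    and smooth: "\<And>\<Q> n U p m V a b. admissible_tangent_diffeology Y \<Q> \<Longrightarrow> (n, U, p) \<in> plots X \<Longrightarrow>
      openin (Euclidean_space m) V \<Longrightarrow> smooth_between m V n U a \<Longrightarrow> smooth_between m V n (Rn n) b \<Longrightarrow>
      (m, V, \<lambda>s. \<omega> (plot_tangent X (n, U, p) (a s, b s))) \<in> \<Q>"
  shows "smooth_map (tangent_bundle X) (subspace_of (tangent_bundle Y) (carrier (tangent_space Y y))) \<omega>"
proof -
  have fst_\<omega>: "fst (\<omega> a) = y" for a using carr[of a] by (auto elim!: tangent_space_cases)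
  have \<omega>_points: "\<omega> a \<in> tangent_points Y" for a using carr[of a] y by (auto simp: tangent_points_def)
  \<comment> \<open>The condition on \<open>fst \<circ> q\<close> makes the projection to
    \<open>X\<close> smooth; the condition on \<open>\<omega> \<circ> q\<close> alone would not
    control the base point.\<close>
  have adm: "admissible_tangent_diffeology X
      {(n, U, q). (\<forall>u\<in>U. q u \<in> tangent_points X) \<and> (n, U, fst \<circ> q) \<in> plots X \<and> (n, U, \<omega> \<circ> q) \<in> \<Q>}"
    (is "admissible_tangent_diffeology X ?P")
    if adm\<Q>: "admissible_tangent_diffeology Y \<Q>" for \<Q>
  proof -
    define F where "F = \<lparr>points = tangent_points Y, plots = \<Q>\<rparr>"
    define E where "E = \<lparr>points = tangent_points X, plots = ?P\<rparr>"
    have F: "diffeological_space F" and vF: "vector_pseudo_bundle F Y fst (tangent_space Y)"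
      using adm\<Q> by (simp_all add: admissible_tangent_diffeology_def F_def Let_def)
    have pE: "points E = tangent_points X" by (simp add: E_def)
    have plE: "(n, U, q) \<in> plots E \<longleftrightarrow>
        (\<forall>u\<in>U. q u \<in> tangent_points X) \<and> (n, U, \<lambda>u. fst (q u)) \<in> plots X \<and> (n, U, \<lambda>u. \<omega> (q u)) \<in> plots F" for n U q
      by (simp add: E_def F_def o_def)
    have E: "diffeological_space E"
    proof (rule diffeological_spaceI)
      fix n U p m V f
      assume *: "(n, U, p) \<in> plots E" "openin (Euclidean_space m) V" "smooth_between m V n U f"
      show "(m, V, p \<circ> f) \<in> plots E"
        using *(1) smooth_between_mem[OF *(3)] dspace_precomp[OF X _ *(2,3), of "\<lambda>u. fst (p u)"]
          dspace_precomp[OF F _ *(2,3), of "\<lambda>u. \<omega> (p u)"]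
        by (simp add: plE o_def)
    next
      fix n U p
      assume U: "openin (Euclidean_space n) U"
        and loc: "\<And>u. u \<in> U \<Longrightarrow> \<exists>V. u \<in> V \<and> V \<subseteq> U \<and> (n, V, p) \<in> plots E"
      have "p u \<in> tangent_points X" if "u \<in> U" for u
        using loc[OF that] by (auto simp: plE)
      moreover have "(n, U, \<lambda>u. fst (p u)) \<in> plots X"
        by (rule dspace_local[OF X U], drule loc, erule ex_forward) (simp add: plE)
      moreover have "(n, U, \<lambda>u. \<omega> (p u)) \<in> plots F"
        by (rule dspace_local[OF F U], drule loc, erule ex_forward) (simp add: plE)
      ultimately show "(n, U, p) \<in> plots E" by (simp add: plE)
    next
      fix n U p q assume "(n, U, p) \<in> plots E" and eq: "\<And>u. u \<in> U \<Longrightarrow> p u = q u"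
      then show "(n, U, q) \<in> plots E"
        using dspace_cong[OF X, of n U "\<lambda>u. fst (p u)" "\<lambda>u. fst (q u)"]
          dspace_cong[OF F, of n U "\<lambda>u. \<omega> (p u)" "\<lambda>u. \<omega> (q u)"] by (simp add: plE)
    next
      fix n U a assume a: "a \<in> points E" and U: "openin (Euclidean_space n) U"
      then have "fst a \<in> points X" by (auto simp: pE elim!: tangent_points_cases)
      then show "(n, U, \<lambda>_. a) \<in> plots E"
        using a dspace_const[OF X _ U, of "fst a"] dspace_const[OF F _ U, of "\<omega> a"] \<omega>_points
        by (simp add: plE pE F_def)
    next
      show "openin (Euclidean_space n) U" if "(n, U, p) \<in> plots E" for n U p
        using that dspace_open[OF X, of n U "\<lambda>u. fst (p u)"] by (simp add: plE)
      show "p u \<in> points E" if "(n, U, p) \<in> plots E" "u \<in> U" for n U p u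
        using that by (simp add: plE pE)
    qed
    have tp: "smooth_map (prod_space (domain_space n U) (domain_space n (Rn n))) E (plot_tangent X (n, U, p))"
      if p: "(n, U, p) \<in> plots X" for n U p
    proof -
      have mem: "plot_tangent X (n, U, p) (u, v) \<in> tangent_points X"
        if "u \<in> U" "v \<in> Rn n" for u v
        unfolding plot_tangent_eq[OF X p]
        by (intro tangent_class_points dspace_points[OF X p] incl_tangent_sum germ_plot_at[OF X p] that)
           (use that in \<open>simp add: germ_plot_def\<close>)
      show ?thesis
      proof (rule smooth_mapI)
        fix uv assume "uv \<in> points (prod_space (domain_space n U) (domain_space n (Rn n)))"
        then show "plot_tangent X (n, U, p) uv \<in> points E"
          using mem[of "fst uv" "snd uv"] by (simp add: pE domain_space_def mem_Times_iff)
      next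
        fix m V and ab :: "rvec \<Rightarrow> rvec \<times> rvec"
        assume "(m, V, ab) \<in> plots (prod_space (domain_space n U) (domain_space n (Rn n)))"
        then have V: "openin (Euclidean_space m) V" and a: "smooth_between m V n U (\<lambda>s. fst (ab s))"
          and b: "smooth_between m V n (Rn n) (\<lambda>s. snd (ab s))"
          by (simp_all add: domain_space_def)
        have m: "plot_tangent X (n, U, p) (ab s) \<in> tangent_points X" if "s \<in> V" for s
          using mem[OF smooth_between_mem[OF a that] smooth_between_mem[OF b that]] by simp
        have f: "fst (plot_tangent X (n, U, p) (ab s)) = p (fst (ab s))" for s
          using plot_tangent_eq[OF X p, of "fst (ab s)" "snd (ab s)"] by simp
        have "(m, V, \<lambda>s. p (fst (ab s))) \<in> plots X"
          using dspace_precomp[OF X p V a] by (simp add: o_def)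
        then show "(m, V, \<lambda>s. plot_tangent X (n, U, p) (ab s)) \<in> plots E"
          using m smooth[OF adm\<Q> p V a b] by (simp add: plE f F_def)
      qed
    qed
    note addF = fibrewise_add_plots[OF vF] and smultF = fibrewise_smult_plots[OF vF]
    have mem_carrier: "a \<in> carrier (tangent_space X (fst a))" "fst a \<in> points X" if "a \<in> tangent_points X" for a
      using that by (auto elim!: tangent_points_cases simp: carrier_tangent_space)
    have add_points: "a \<oplus>\<^bsub>tangent_space X (fst a)\<^esub> b \<in> tangent_points X \<and>
        fst (a \<oplus>\<^bsub>tangent_space X (fst a)\<^esub> b) = fst a \<and>
        \<omega> (a \<oplus>\<^bsub>tangent_space X (fst a)\<^esub> b) = \<omega> a \<oplus>\<^bsub>tangent_space Y y\<^esub> \<omega> b"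
      if ab: "a \<in> tangent_points X" "b \<in> tangent_points X" "fst a = fst b" for a b
    proof -
      have a: "a \<in> carrier (tangent_space X (fst a))" and b: "b \<in> carrier (tangent_space X (fst a))"
        using mem_carrier[OF ab(1)] mem_carrier[OF ab(2)] ab(3) by simp_all
      obtain \<phi> \<psi> where *: "\<phi> \<in> tangent_sum X (fst a)" "a = tangent_class X (fst a) \<phi>"
          "\<psi> \<in> tangent_sum X (fst a)" "b = tangent_class X (fst a) \<psi>"
        using a b by (metis tangent_space_cases)
      have e: "a \<oplus>\<^bsub>tangent_space X (fst a)\<^esub> b = tangent_class X (fst a) (\<phi> + \<psi>)"
        using *(2,4) add_tangent_class by metis
      have "\<phi> + \<psi> \<in> tangent_sum X (fst a)" by (intro subspace_add[OF subspace_tangent_sum] *)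
      then show ?thesis
        using add[OF mem_carrier(2)[OF ab(1)] a b] tangent_class_points[OF mem_carrier(2)[OF ab(1)]]
        unfolding e by simp
    qed
    have smult_points: "c \<odot>\<^bsub>tangent_space X (fst a)\<^esub> a \<in> tangent_points X \<and>
        fst (c \<odot>\<^bsub>tangent_space X (fst a)\<^esub> a) = fst a \<and>
        \<omega> (c \<odot>\<^bsub>tangent_space X (fst a)\<^esub> a) = c \<odot>\<^bsub>tangent_space Y y\<^esub> \<omega> a"
      if a': "a \<in> tangent_points X" for a c
    proof -
      note a = mem_carrier[OF a']
      obtain \<phi> where *: "\<phi> \<in> tangent_sum X (fst a)" "a = tangent_class X (fst a) \<phi>"
        using a(1) by (metis tangent_space_cases)
      have e: "c \<odot>\<^bsub>tangent_space X (fst a)\<^esub> a = tangent_class X (fst a) (c *\<^sub>R \<phi>)"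
        using *(2) smult_tangent_class by metis
      have "c *\<^sub>R \<phi> \<in> tangent_sum X (fst a)" by (intro subspace_scale[OF subspace_tangent_sum] *)
      then show ?thesis
        using smult[OF a(2,1), of c] tangent_class_points[OF a(2)] unfolding e by simp
    qed
    have zero_points: "tangent_class X x 0 \<in> tangent_points X" "\<omega> (tangent_class X x 0) = tangent_class Y y 0"
      if x: "x \<in> points X" for x
    proof -
      have 0: "(0 :: 'a plot \<Rightarrow> rvec) \<in> tangent_sum X x" by (rule subspace_0[OF subspace_tangent_sum])
      then show "tangent_class X x 0 \<in> tangent_points X" by (rule tangent_class_points[OF x])
      obtain \<phi> where \<phi>: "\<omega> (tangent_class X x 0) = tangent_class Y y \<phi>"
        using carr[of "tangent_class X x 0"] by (rule tangent_space_cases)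
      \<comment> \<open>Homogeneity with factor 0 shows that zero vectors go to the zero
        vector.\<close>
      have "\<omega> (0 \<odot>\<^bsub>tangent_space X x\<^esub> tangent_class X x 0) = 0 \<odot>\<^bsub>tangent_space Y y\<^esub> \<omega> (tangent_class X x 0)"
        by (rule smult[OF x]) (use 0 in \<open>simp add: carrier_tangent_space\<close>)
      then show "\<omega> (tangent_class X x 0) = tangent_class Y y 0"
        unfolding \<phi> smult_tangent_class scaleR_zero_left scaleR_zero_right using \<phi> by simp
    qed
    have smooth_add: "smooth_map (subspace_of (prod_space E E) {(a, b). fst a = fst b}) E
        (\<lambda>(a, b). a \<oplus>\<^bsub>tangent_space X (fst a)\<^esub> b)"
    proof (rule smooth_mapI)
      fix ab assume "ab \<in> points (subspace_of (prod_space E E) {(a, b). fst a = fst b})"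
      then show "(case ab of (a, b) \<Rightarrow> a \<oplus>\<^bsub>tangent_space X (fst a)\<^esub> b) \<in> points E"
        using add_points[of "fst ab" "snd ab"] by (auto simp: pE)
    next
      fix n U ab assume "(n, U, ab) \<in> plots (subspace_of (prod_space E E) {(a, b). fst a = fst b})"
      then have a: "(n, U, \<lambda>u. fst (ab u)) \<in> plots E" and b: "(n, U, \<lambda>u. snd (ab u)) \<in> plots E"
        and eq: "\<And>u. u \<in> U \<Longrightarrow> fst (fst (ab u)) = fst (snd (ab u))"
        by (simp_all add: image_subset_iff case_prod_unfold)
      let ?s = "\<lambda>u. fst (ab u) \<oplus>\<^bsub>tangent_space X (fst (fst (ab u)))\<^esub> snd (ab u)"
      have s: "?s u \<in> tangent_points X \<and> fst (?s u) = fst (fst (ab u)) \<and>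
          \<omega> (?s u) = \<omega> (fst (ab u)) \<oplus>\<^bsub>tangent_space Y y\<^esub> \<omega> (snd (ab u))" if "u \<in> U" for u
        using a b eq[OF that] that by (intro add_points) (auto simp: plE)
      have "(n, U, \<lambda>u. \<omega> (fst (ab u)) \<oplus>\<^bsub>tangent_space Y y\<^esub> \<omega> (snd (ab u))) \<in> plots F"
        by (rule addF) (use a b fst_\<omega> F in \<open>simp_all add: plE\<close>)
      then have "(n, U, \<lambda>u. \<omega> (?s u)) \<in> plots F"
        by (rule dspace_cong[OF F]) (simp add: s)
      moreover have "(n, U, \<lambda>u. fst (?s u)) \<in> plots X"
        by (rule dspace_cong[OF X, of _ _ "\<lambda>u. fst (fst (ab u))"]) (use a s in \<open>simp_all add: plE\<close>)
      ultimately have "(n, U, ?s) \<in> plots E" using s by (simp add: plE)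
      then show "(n, U, \<lambda>u. case ab u of (a, b) \<Rightarrow> a \<oplus>\<^bsub>tangent_space X (fst a)\<^esub> b) \<in> plots E"
        by (simp add: case_prod_unfold)
    qed
    have smooth_smult: "smooth_map (prod_space real_space E) E (\<lambda>(c, a). c \<odot>\<^bsub>tangent_space X (fst a)\<^esub> a)"
    proof (rule smooth_mapI)
      fix ca assume "ca \<in> points (prod_space real_space E)"
      then show "(case ca of (c, a) \<Rightarrow> c \<odot>\<^bsub>tangent_space X (fst a)\<^esub> a) \<in> points E"
        using smult_points[of "snd ca" "fst ca"] by (auto simp: pE)
    next
      fix n U ca assume "(n, U, ca) \<in> plots (prod_space real_space E)"
      then have c: "(n, U, \<lambda>u. fst (ca u)) \<in> plots real_space" and a: "(n, U, \<lambda>u. snd (ca u)) \<in> plots E"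
        by (simp_all only: plots_prod_space)
      let ?s = "\<lambda>u. fst (ca u) \<odot>\<^bsub>tangent_space X (fst (snd (ca u)))\<^esub> snd (ca u)"
      have s: "?s u \<in> tangent_points X \<and> fst (?s u) = fst (snd (ca u)) \<and>
          \<omega> (?s u) = fst (ca u) \<odot>\<^bsub>tangent_space Y y\<^esub> \<omega> (snd (ca u))" if "u \<in> U" for u
        using a that by (intro smult_points) (auto simp: plE)
      have "(n, U, \<lambda>u. fst (ca u) \<odot>\<^bsub>tangent_space Y y\<^esub> \<omega> (snd (ca u))) \<in> plots F"
        by (rule smultF[OF c]) (use a fst_\<omega> F in \<open>simp_all add: plE\<close>)
      then have "(n, U, \<lambda>u. \<omega> (?s u)) \<in> plots F"
        by (rule dspace_cong[OF F]) (simp add: s)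
      moreover have "(n, U, \<lambda>u. fst (?s u)) \<in> plots X"
        by (rule dspace_cong[OF X, of _ _ "\<lambda>u. fst (snd (ca u))"]) (use a s in \<open>simp_all add: plE\<close>)
      ultimately have "(n, U, ?s) \<in> plots E" using s by (simp add: plE)
      then show "(n, U, \<lambda>u. case ca u of (c, a) \<Rightarrow> c \<odot>\<^bsub>tangent_space X (fst a)\<^esub> a) \<in> plots E"
        by (simp add: case_prod_unfold)
    qed
    have smooth_zero: "smooth_map X E (\<lambda>x. \<zero>\<^bsub>tangent_space X x\<^esub>)"
      unfolding zero_tangent_space
    proof (rule smooth_mapI)
      show "tangent_class X x 0 \<in> points E" if "x \<in> points X" for x
        unfolding pE by (rule zero_points(1)[OF that])
      fix n U p assume p: "(n, U, p) \<in> plots X"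
      have "tangent_class Y y 0 \<in> points F"
        unfolding F_def using tangent_class_points[OF y subspace_0[OF subspace_tangent_sum]] by simp
      then have "(n, U, \<lambda>_. tangent_class Y y 0) \<in> plots F" by (rule dspace_const[OF F _ dspace_open[OF X p]])
      then have "(n, U, \<lambda>u. \<omega> (tangent_class X (p u) 0)) \<in> plots F"
        by (rule dspace_cong[OF F]) (rule zero_points(2)[OF dspace_points[OF X p], symmetric])
      then show "(n, U, \<lambda>u. tangent_class X (p u) 0) \<in> plots E"
        using p zero_points(1)[OF dspace_points[OF X p]] by (simp add: plE)
    qed
    have fibre: "carrier (tangent_space X x) = {a \<in> points E. fst a = x}" if x: "x \<in> points X" for x
      using x mem_carrier by (auto simp: pE elim!: tangent_space_cases intro: tangent_class_points)
    \<comment> \<open>The operations of one fibre are restrictions of the fibrewise operations just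
      shown to be smooth.\<close>
    have fibre_dvs: "diffeological_vector_space (tangent_space X x) (subspace_of E (carrier (tangent_space X x)))"
      if x: "x \<in> points X" for x
    proof -
      let ?T = "tangent_space X x" and ?S = "subspace_of E (carrier (tangent_space X x))"
      interpret M: Module.module real_ring ?T by (rule module_tangent_space)
      have 1: "fst a = x" if "a \<in> carrier ?T" for a using that fibre[OF x] by blast
      have "smooth_map (prod_space ?S ?S) ?S (\<lambda>(a, b). a \<oplus>\<^bsub>?T\<^esub> b)"
      proof (rule smooth_mapI)
        fix ab assume "ab \<in> points (prod_space ?S ?S)"
        then show "(case ab of (a, b) \<Rightarrow> a \<oplus>\<^bsub>?T\<^esub> b) \<in> points ?S"
          using fibre[OF x] M.a_closed by auto
      next
        fix n U ab assume "(n, U, ab) \<in> plots (prod_space ?S ?S)"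
        then have a: "(n, U, \<lambda>u. fst (ab u)) \<in> plots E" "\<And>u. u \<in> U \<Longrightarrow> fst (ab u) \<in> carrier ?T"
          and b: "(n, U, \<lambda>u. snd (ab u)) \<in> plots E" "\<And>u. u \<in> U \<Longrightarrow> snd (ab u) \<in> carrier ?T"
          by (auto simp: image_subset_iff)
        have "(n, U, ab) \<in> plots (subspace_of (prod_space E E) {(a, b). fst a = fst b})"
          using a b 1 by (auto simp: image_subset_iff case_prod_unfold)
        from smooth_map_plots[OF smooth_add this]
        have "(n, U, \<lambda>u. case ab u of (a, b) \<Rightarrow> a \<oplus>\<^bsub>?T\<^esub> b) \<in> plots E"
          by (rule dspace_cong[OF E]) (use a(2) 1 in \<open>auto simp: case_prod_unfold\<close>)
        then show "(n, U, \<lambda>u. case ab u of (a, b) \<Rightarrow> a \<oplus>\<^bsub>?T\<^esub> b) \<in> plots ?S"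
          using a(2) b(2) M.a_closed by (auto simp: image_subset_iff case_prod_unfold)
      qed
      moreover have "smooth_map (prod_space real_space ?S) ?S (\<lambda>(c, a). c \<odot>\<^bsub>?T\<^esub> a)"
      proof (rule smooth_mapI)
        have cl: "c \<odot>\<^bsub>?T\<^esub> a \<in> carrier ?T" if "a \<in> carrier ?T" for c a
          using M.smult_closed[OF _ that, of c] by (simp add: real_ring_def)
        show "(case ca of (c, a) \<Rightarrow> c \<odot>\<^bsub>?T\<^esub> a) \<in> points ?S" if "ca \<in> points (prod_space real_space ?S)" for ca
          using that fibre[OF x] cl by auto
        fix n U ca assume "(n, U, ca) \<in> plots (prod_space real_space ?S)"
        then have c: "(n, U, \<lambda>u. fst (ca u)) \<in> plots real_space"
          and a: "(n, U, \<lambda>u. snd (ca u)) \<in> plots E" "\<And>u. u \<in> U \<Longrightarrow> snd (ca u) \<in> carrier ?T"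
          unfolding plots_prod_space plots_subspace_of by auto
        have "(n, U, ca) \<in> plots (prod_space real_space E)" unfolding plots_prod_space using a c by blast
        from smooth_map_plots[OF smooth_smult this]
        have "(n, U, \<lambda>u. case ca u of (c, a) \<Rightarrow> c \<odot>\<^bsub>?T\<^esub> a) \<in> plots E"
          by (rule dspace_cong[OF E]) (use a(2) 1 in \<open>auto simp: case_prod_unfold\<close>)
        then show "(n, U, \<lambda>u. case ca u of (c, a) \<Rightarrow> c \<odot>\<^bsub>?T\<^esub> a) \<in> plots ?S"
          using a(2) cl by (auto simp: image_subset_iff case_prod_unfold)
      qed
      moreover have "points ?S = carrier ?T" using fibre[OF x] by auto
      ultimately show ?thesis
        unfolding diffeological_vector_space_def
        by (intro conjI module_tangent_space diffeological_space_subspace[OF E])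
    qed
    have "vector_pseudo_bundle E X fst (tangent_space X)"
      unfolding vector_pseudo_bundle_def
    proof (intro conjI ballI smooth_add smooth_smult smooth_zero)
      show "smooth_map E X fst"
      proof (rule smooth_mapI)
        show "fst a \<in> points X" if "a \<in> points E" for a
          by (rule mem_carrier(2)) (use that in \<open>simp only: pE\<close>)
      qed (simp add: plE)
      show "fst ` points E = points X"
      proof
        show "fst ` points E \<subseteq> points X" unfolding pE by (rule image_subsetI) (rule mem_carrier(2))
        show "points X \<subseteq> fst ` points E"
        proof
          fix x assume "x \<in> points X"
          then show "x \<in> fst ` points E"
            unfolding pE by (intro image_eqI[of _ _ "tangent_class X x 0"] zero_points(1)) simp_all
        qed
      qed
    qed (fact fibre fibre_dvs)+
    then show ?thesis
      unfolding admissible_tangent_diffeology_def Let_def E_def[symmetric] using E tp by blast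
  qed
  show ?thesis
  proof (rule smooth_mapI)
    show "\<omega> a \<in> points (subspace_of (tangent_bundle Y) (carrier (tangent_space Y y)))" for a
      using carr \<omega>_points by (simp add: tangent_bundle_def)
    fix n U q assume q: "(n, U, q) \<in> plots (tangent_bundle X)"
    have "(n, U, \<lambda>u. \<omega> (q u)) \<in> \<Q>" if "admissible_tangent_diffeology Y \<Q>" for \<Q>
    proof -
      have "(n, U, q) \<in> \<Inter>{\<P>. admissible_tangent_diffeology X \<P>}"
        using q by (simp only: tangent_bundle_def dspace.simps)
      from InterD[OF this, unfolded mem_Collect_eq, OF adm[OF that]] show ?thesis by (simp add: o_def)
    qed
    then show "(n, U, \<lambda>u. \<omega> (q u)) \<in> plots (subspace_of (tangent_bundle Y) (carrier (tangent_space Y y)))"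
      using carr[of "q _"] by (simp add: tangent_bundle_def image_subset_iff)
  qed
qed

section \<open>The Milnor construction\<close>

locale diff_group = group G for G (structure) and D +
  assumes diffeological_group: "diffeological_group G D"
begin

lemma space_D: "diffeological_space D"
  and points_D [simp]: "points D = carrier G"
  using diffeological_group diffeological_group_space diffeological_group_points by blast+

abbreviation "S \<equiv> milnor_S D"
abbreviation "EG \<equiv> milnor_E D"
abbreviation cls :: "'a milnor_pre \<Rightarrow> 'a milnor_pre set" where "cls x \<equiv> milnor_rel D `` {x}"
abbreviation "translate \<equiv> milnor_act G D"

lemma points_S: "(t, g) \<in> points S \<longleftrightarrow>
    (\<forall>i. t i \<in> {0..1}) \<and> (\<forall>i. g i \<in> carrier G) \<and> finite {i. t i \<noteq> 0} \<and> (\<Sum>i | t i \<noteq> 0. t i) = 1"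
  unfolding milnor_S_def by auto

text \<open>The subset diffeologies of the interval and of the simplex contribute only a pointwise
  condition, so the coordinates may be treated as smooth real functions.\<close>

lemma plots_S: "(n, U, q) \<in> plots S \<longleftrightarrow> openin (Euclidean_space n) U \<and>
    (\<forall>i. smooth_fun n U (\<lambda>u. fst (q u) i)) \<and> (\<forall>i. (n, U, \<lambda>u. snd (q u) i) \<in> plots D) \<and> (\<forall>u\<in>U. q u \<in> points S)"
    (is "?l \<longleftrightarrow> ?r")
proof
  let ?A = "{(t, g). finite {i. t i \<noteq> 0} \<and> (\<Sum>i | t i \<noteq> 0. t i) = 1} :: 'a milnor_pre set"
  assume l: ?l
  then have 1: "(n, U, \<lambda>u. fst (q u) i) \<in> plots real_space" "\<forall>u\<in>U. fst (q u) i \<in> {0..1}"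
    and 2: "(n, U, \<lambda>u. snd (q u) i) \<in> plots D" and 3: "\<forall>u\<in>U. q u \<in> ?A" for i
    unfolding milnor_S_def plots_subspace_of plots_prod_space plots_seq_space by (auto simp: image_subset_iff)
  have "q u \<in> points S" if "u \<in> U" for u
    using 1(2) dspace_points[OF space_D 2 that] 3 that points_S[of "fst (q u)" "snd (q u)"] by (simp add: case_prod_unfold)
  then show ?r using 1(1) 2 by simp
next
  assume r: ?r
  have "q u \<in> {(t, g). finite {i. t i \<noteq> 0} \<and> (\<Sum>i | t i \<noteq> 0. t i) = 1}" "fst (q u) i \<in> {0..1}" if "u \<in> U" for u i
    using r that points_S[of "fst (q u)" "snd (q u)"] by (auto simp: case_prod_unfold)
  then show ?l using r
    unfolding milnor_S_def plots_subspace_of plots_prod_space plots_seq_space by (simp add: image_subset_iff)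
qed

lemma space_S: "diffeological_space S"
  unfolding milnor_S_def
  by (intro diffeological_space_subspace diffeological_space_prod diffeological_space_seq
      diffeological_space_real space_D)

lemma space_EG: "diffeological_space EG"
  unfolding milnor_E_def by (rule diffeological_space_quotient[OF space_S])

section \<open>Classes and their coordinates\<close>

lemma mem_cls: "(t', g') \<in> cls (t, g) \<longleftrightarrow>
    (t, g) \<in> points S \<and> (t', g') \<in> points S \<and> t' = t \<and> (\<forall>i. t i \<noteq> 0 \<longrightarrow> g i = g' i)"
  by (auto simp: milnor_rel_def)

lemma cls_eqI:
  assumes "(t, g) \<in> points S" "(t, g') \<in> points S" "\<And>i. t i \<noteq> 0 \<Longrightarrow> g i = g' i"
  shows "cls (t, g) = cls (t, g')"
proof -
  have "(t'', g'') \<in> cls (t, g) \<longleftrightarrow> (t'', g'') \<in> cls (t, g')" for t'' g''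
    unfolding mem_cls using assms by metis
  then show ?thesis by (simp add: set_eq_iff split_paired_all)
qed

text \<open>All members of a class share their first component, so the choice of representative is
  immaterial.\<close>

definition tc :: "'a milnor_pre set \<Rightarrow> nat \<Rightarrow> real" where "tc y = fst (SOME x. x \<in> y)"

text \<open>Only meaningful at indices with \<open>tc y i \<noteq> 0\<close>.\<close>

definition gc :: "'a milnor_pre set \<Rightarrow> nat \<Rightarrow> 'a" where "gc y = snd (SOME x. x \<in> y)"

lemma
  assumes "(t, g) \<in> points S"
  shows tc_cls: "tc (cls (t, g)) = t"
    and gc_cls: "t i \<noteq> 0 \<Longrightarrow> gc (cls (t, g)) i = g i"
proof -
  have "(t, g) \<in> cls (t, g)" using assms unfolding mem_cls by blast
  then have "(SOME x. x \<in> cls (t, g)) \<in> cls (t, g)" by (rule someI)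
  then have *: "(tc (cls (t, g)), gc (cls (t, g))) \<in> cls (t, g)" unfolding tc_def gc_def prod.collapse .
  show "tc (cls (t, g)) = t" using * unfolding mem_cls by blast
  show "t i \<noteq> 0 \<Longrightarrow> gc (cls (t, g)) i = g i" using * unfolding mem_cls by simp
qed

lemma points_EG: "y \<in> points EG \<longleftrightarrow> (\<exists>x\<in>points S. y = cls x)"
  unfolding milnor_E_def points_quotient_space by (auto simp: quotient_def)

lemma EG_cases:
  assumes "y \<in> points EG"
  obtains t g where "(t, g) \<in> points S" "y = cls (t, g)"
  using assms unfolding points_EG by auto

text \<open>Both coordinates come from the same choice, so together they form one member of
  \<open>y\<close>.\<close>

lemma EG_coords:
  assumes "y \<in> points EG"
  shows "(tc y, gc y) \<in> points S" "y = cls (tc y, gc y)"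
proof -
  obtain t g where tg: "(t, g) \<in> points S" "y = cls (t, g)" using assms by (rule EG_cases)
  have "(t, g) \<in> cls (t, g)" using tg(1) unfolding mem_cls by blast
  then have "(SOME x. x \<in> y) \<in> y" unfolding tg(2) by (rule someI)
  then have *: "(tc y, gc y) \<in> cls (t, g)" unfolding tc_def gc_def prod.collapse tg(2) .
  then show 1: "(tc y, gc y) \<in> points S" unfolding mem_cls by blast
  have "tc y = t" using * unfolding mem_cls by blast
  then show "y = cls (tc y, gc y)" unfolding tg(2)
    using cls_eqI[of t g "gc y"] tg 1 * unfolding mem_cls by simp
qed

lemma gc_carrier: "y \<in> points EG \<Longrightarrow> gc y i \<in> carrier G"
  using EG_coords(1) points_S by blast

lemma tc_range: "y \<in> points EG \<Longrightarrow> 0 \<le> tc y i" "y \<in> points EG \<Longrightarrow> finite {i. tc y i \<noteq> 0}"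
  "y \<in> points EG \<Longrightarrow> (\<Sum>i | tc y i \<noteq> 0. tc y i) = 1"
  using EG_coords(1)[of y] unfolding points_S by auto

section \<open>The action\<close>

lemma translate_S: "(t, g) \<in> points S \<Longrightarrow> h \<in> carrier G \<Longrightarrow> (t, \<lambda>i. g i \<otimes> inv h) \<in> points S"
  unfolding points_S by auto

lemma act_cls:
  assumes "(t, g) \<in> points S" "h \<in> carrier G"
  shows "translate h (cls (t, g)) = cls (t, \<lambda>i. g i \<otimes> inv h)"
proof -
  have "(t', g') \<in> translate h (cls (t, g)) \<longleftrightarrow> (t', g') \<in> cls (t, \<lambda>i. g i \<otimes> inv h)" (is "?l \<longleftrightarrow> ?r") for t' g'
  proof
    assume ?l
    then obtain t1 g1 where 1: "(t1, g1) \<in> cls (t, g)" "(t', g') \<in> cls (t1, \<lambda>i. g1 i \<otimes> inv h)"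
      unfolding milnor_act_def by auto
    then show ?r using translate_S[OF assms] unfolding mem_cls by (elim conjE) (intro conjI, simp_all)
  next
    assume r: ?r
    have "(t, g) \<in> cls (t, g)" using assms unfolding mem_cls by blast
    then have "(t, \<lambda>i. g i \<otimes> inv h) \<in> (\<lambda>(t, g). (t, \<lambda>i. g i \<otimes> inv h)) ` cls (t, g)"
      by (rule rev_image_eqI) simp
    moreover have "((t, \<lambda>i. g i \<otimes> inv h), (t', g')) \<in> milnor_rel D"
      using r by (simp only: Image_singleton_iff)
    ultimately show ?l unfolding milnor_act_def by (rule ImageI[rotated])
  qed
  then show ?thesis by (simp add: set_eq_iff split_paired_all)
qed

lemma
  assumes y: "y \<in> points EG" and h: "h \<in> carrier G"
  shows act_EG: "translate h y \<in> points EG"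
    and tc_act: "tc (translate h y) = tc y"
    and gc_act: "tc y i \<noteq> 0 \<Longrightarrow> gc (translate h y) i = gc y i \<otimes> inv h"
proof -
  note c = EG_coords[OF y]
  have a: "translate h y = cls (tc y, \<lambda>i. gc y i \<otimes> inv h)"
    by (subst c(2)) (rule act_cls[OF c(1) h])
  note s = translate_S[OF c(1) h]
  show "translate h y \<in> points EG" unfolding a points_EG using s by blast
  show "tc (translate h y) = tc y" unfolding a by (rule tc_cls[OF s])
  show "tc y i \<noteq> 0 \<Longrightarrow> gc (translate h y) i = gc y i \<otimes> inv h" unfolding a by (rule gc_cls[OF s])
qed

lemma act_one: "y \<in> points EG \<Longrightarrow> translate \<one> y = y"
proof -
  assume y: "y \<in> points EG"
  note c = EG_coords[OF y]
  have "translate \<one> y = cls (tc y, \<lambda>i. gc y i \<otimes> inv \<one>)"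
    by (subst c(2)) (rule act_cls[OF c(1)], simp)
  also have "\<dots> = cls (tc y, gc y)" using gc_carrier[OF y] by simp
  finally show ?thesis using c(2) by simp
qed

text \<open>Plots of a quotient lift only locally. The coordinates \<open>snd (q v) i\<close> of the
  lift are plots on all of \<open>V\<close>, and they replace \<open>gc\<close>, whose values are
  arbitrary where the coordinate \<open>tc\<close> vanishes.\<close>

lemma EG_plot_lift:
  assumes "(n, U, p) \<in> plots EG" "u \<in> U"
  obtains V q where "u \<in> V" "V \<subseteq> U" "openin (Euclidean_space n) V" "(n, V, q) \<in> plots S"
    "\<And>v. v \<in> V \<Longrightarrow> p v = cls (q v)"
    "\<And>v. v \<in> V \<Longrightarrow> tc (p v) = fst (q v)" "\<And>v i. v \<in> V \<Longrightarrow> tc (p v) i \<noteq> 0 \<Longrightarrow> gc (p v) i = snd (q v) i"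
proof -
  obtain V q where Vq: "u \<in> V" "V \<subseteq> U" "(n, V, q) \<in> plots S" "\<forall>v\<in>V. p v = cls (q v)"
    using assms unfolding milnor_E_def plots_quotient_space by metis
  have pv: "p v = cls (fst (q v), snd (q v))" and qS: "(fst (q v), snd (q v)) \<in> points S" if "v \<in> V" for v
    using Vq(4) that dspace_points[OF space_S Vq(3) that] by simp_all
  show ?thesis
  proof (rule that[OF Vq(1,2) dspace_open[OF space_S Vq(3)] Vq(3)])
    fix v assume v: "v \<in> V"
    show "p v = cls (q v)" using Vq(4) v by blast
    show t: "tc (p v) = fst (q v)" unfolding pv[OF v] by (rule tc_cls[OF qS[OF v]])
    show "gc (p v) i = snd (q v) i" if "tc (p v) i \<noteq> 0" for i
      using that unfolding t unfolding pv[OF v] by (rule gc_cls[OF qS[OF v]])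
  qed
qed

lemma smooth_cls: "smooth_map S EG cls"
proof (rule smooth_mapI)
  show "cls x \<in> points EG" if "x \<in> points S" for x using that points_EG by blast
  fix n U q assume q: "(n, U, q) \<in> plots S"
  then show "(n, U, \<lambda>u. cls (q u)) \<in> plots EG"
    unfolding milnor_E_def plots_quotient_space using dspace_open[OF space_S q] by blast
qed

lemma tc_smooth:
  assumes p: "(n, U, p) \<in> plots EG"
  shows "smooth_fun n U (\<lambda>u. tc (p u) i)"
proof (rule smooth_fun_local[OF dspace_open[OF space_EG p]])
  fix u assume "u \<in> U"
  from EG_plot_lift[OF p this] obtain V q where V: "u \<in> V" "V \<subseteq> U" "openin (Euclidean_space n) V"
    "(n, V, q) \<in> plots S" "\<And>v. v \<in> V \<Longrightarrow> tc (p v) = fst (q v)" by metis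
  have "smooth_fun n V (\<lambda>u. fst (q u) i)" using V(4) unfolding plots_S by blast
  then have "smooth_fun n V (\<lambda>u. tc (p u) i)"
    by (subst smooth_fun_cong[OF V(3), of _ "\<lambda>u. fst (q u) i"]) (simp_all add: V(5))
  then show "\<exists>V. u \<in> V \<and> V \<subseteq> U \<and> openin (Euclidean_space n) V \<and> smooth_fun n V (\<lambda>u. tc (p u) i)"
    using V(1-3) by blast
qed

lemma tc_nonzero_open:
  assumes p: "(n, U, p) \<in> plots EG"
  shows "openin (Euclidean_space n) {u\<in>U. tc (p u) i \<noteq> 0}"
  using smooth_fun_preimage[OF dspace_open[OF space_EG p] tc_smooth[OF p, of i], of "- {0}"]
  by (simp add: open_Compl)

lemma gc_plot:
  assumes p: "(n, U, p) \<in> plots EG"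
  shows "(n, {u\<in>U. tc (p u) i \<noteq> 0}, \<lambda>u. gc (p u) i) \<in> plots D"
proof (rule dspace_local[OF space_D tc_nonzero_open[OF p]])
  fix u assume u: "u \<in> {u\<in>U. tc (p u) i \<noteq> 0}"
  then have "u \<in> U" by blast
  from EG_plot_lift[OF p this] obtain V q where V: "u \<in> V" "V \<subseteq> U" "openin (Euclidean_space n) V"
    "(n, V, q) \<in> plots S" "\<And>v i. v \<in> V \<Longrightarrow> tc (p v) i \<noteq> 0 \<Longrightarrow> gc (p v) i = snd (q v) i" by metis
  define V' where "V' = V \<inter> {u\<in>U. tc (p u) i \<noteq> 0}"
  have V': "openin (Euclidean_space n) V'" unfolding V'_def by (intro openin_Int V(3) tc_nonzero_open[OF p])
  have "(n, V, \<lambda>u. snd (q u) i) \<in> plots D" using V(4) unfolding plots_S by blast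
  then have "(n, V', \<lambda>u. snd (q u) i) \<in> plots D"
    by (rule dspace_restrict[OF space_D _ V']) (simp add: V'_def)
  then have "(n, V', \<lambda>u. gc (p u) i) \<in> plots D"
    by (rule dspace_cong[OF space_D]) (simp add: V'_def V(5))
  then show "\<exists>V. u \<in> V \<and> V \<subseteq> {u\<in>U. tc (p u) i \<noteq> 0} \<and> (n, V, \<lambda>u. gc (p u) i) \<in> plots D"
    using V(1) u by (intro exI[of _ V']) (auto simp: V'_def)
qed

text \<open>Constant \<open>h\<close> gives smoothness of the action of one element, constant
  \<open>q\<close> that of an orbit map.\<close>

lemma translate_plot:
  assumes "(n, U, q) \<in> plots S" "(n, U, h) \<in> plots D"
  shows "(n, U, \<lambda>u. (fst (q u), \<lambda>i. snd (q u) i \<otimes> inv (h u))) \<in> plots S"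
proof -
  have q: "(n, U, \<lambda>u. snd (q u) i) \<in> plots D" for i using assms(1) unfolding plots_S by blast
  have "(n, U, \<lambda>u. snd (q u) i \<otimes> inv (h u)) \<in> plots D" for i
    by (rule diffeological_group_mult[OF diffeological_group q diffeological_group_inv[OF diffeological_group assms(2)]])
  moreover have "(fst (q u), \<lambda>i. snd (q u) i \<otimes> inv (h u)) \<in> points S" if "u \<in> U" for u
    using translate_S[of "fst (q u)" "snd (q u)" "h u"] assms(1) that dspace_points[OF space_D assms(2) that]
    unfolding plots_S by simp
  ultimately show ?thesis using assms(1) unfolding plots_S by simp
qed

lemma act_smooth:
  assumes h: "h \<in> carrier G"
  shows "smooth_map EG EG (translate h)"
proof (rule smooth_mapI)
  show "translate h y \<in> points EG" if "y \<in> points EG" for y by (rule act_EG[OF that h])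
  fix n U p assume p: "(n, U, p) \<in> plots EG"
  show "(n, U, \<lambda>u. translate h (p u)) \<in> plots EG"
  proof (rule dspace_local[OF space_EG dspace_open[OF space_EG p]])
    fix u assume "u \<in> U"
    from EG_plot_lift[OF p this] obtain V q where V: "u \<in> V" "V \<subseteq> U" "openin (Euclidean_space n) V"
      "(n, V, q) \<in> plots S" "\<And>v. v \<in> V \<Longrightarrow> p v = cls (q v)" by metis
    have "(n, V, \<lambda>_. h) \<in> plots D" by (rule dspace_const[OF space_D _ V(3)]) (simp add: h)
    from smooth_map_plots[OF smooth_cls translate_plot[OF V(4) this]]
    have "(n, V, \<lambda>u. translate h (p u)) \<in> plots EG"
    proof (rule dspace_cong[OF space_EG])
      fix v assume v: "v \<in> V"
      then have "(fst (q v), snd (q v)) \<in> points S" using V(4) unfolding plots_S by simp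
      from act_cls[OF this h] show "cls (fst (q v), \<lambda>i. snd (q v) i \<otimes> inv h) = translate h (p v)"
        by (simp add: V(5)[OF v])
    qed
    then show "\<exists>V. u \<in> V \<and> V \<subseteq> U \<and> (n, V, \<lambda>u. translate h (p u)) \<in> plots EG" using V(1,2) by blast
  qed
qed

lemma orbit_smooth:
  assumes y: "y \<in> points EG"
  shows "smooth_map D EG (\<lambda>h. translate h y)"
proof (rule smooth_mapI)
  show "translate h y \<in> points EG" if "h \<in> points D" for h using act_EG[OF y] that by simp
  fix n U h assume h: "(n, U, h) \<in> plots D"
  note c = EG_coords[OF y]
  have "(n, U, \<lambda>_. (tc y, gc y)) \<in> plots S" by (rule dspace_const[OF space_S c(1) dspace_open[OF space_D h]])
  from smooth_map_plots[OF smooth_cls translate_plot[OF this h]]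
  show "(n, U, \<lambda>u. translate (h u) y) \<in> plots EG"
  proof (rule dspace_cong[OF space_EG])
    fix u assume "u \<in> U"
    then have hu: "h u \<in> carrier G" using dspace_points[OF space_D h] by simp
    have "translate (h u) y = cls (tc y, \<lambda>i. gc y i \<otimes> inv (h u))"
      by (subst c(2)) (rule act_cls[OF c(1) hu])
    then show "cls (fst (tc y, gc y), \<lambda>i. snd (tc y, gc y) i \<otimes> inv (h u)) = translate (h u) y" by simp
  qed
qed

text \<open>The coordinates \<open>t\<^sub>i\<close> themselves need not be locally finite along a plot. Subtracting the
  preceding ones first makes all but finitely many of the following functions vanish near
  a given point, and \<open>flat\<close> keeps them smooth.\<close>

definition bump :: "'a milnor_pre set \<Rightarrow> nat \<Rightarrow> real" where
  "bump y i = flat 1 (tc y i - (\<Sum>j<i. tc y j))"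

text \<open>As \<open>bump\<close> vanishes wherever \<open>tc\<close> does, the sum over the
  support is the sum over all indices.\<close>

definition weight :: "'a milnor_pre set \<Rightarrow> nat \<Rightarrow> real" where
  "weight y i = bump y i * inverse (\<Sum>j | tc y j \<noteq> 0. bump y j)"

lemma flat_nonneg: "flat 1 s \<ge> 0" and flat_pos: "s > 0 \<Longrightarrow> flat 1 s > 0" and flat_eq_0: "s \<le> 0 \<Longrightarrow> flat 1 s = 0"
  by (auto simp: flat_def)

lemma bump_eq_0: "y \<in> points EG \<Longrightarrow> tc y i = 0 \<Longrightarrow> bump y i = 0"
  unfolding bump_def by (rule flat_eq_0) (simp add: sum_nonneg tc_range)

text \<open>At the first index with a nonzero coordinate nothing is subtracted, so that bump is
  positive; the others are nonnegative.\<close>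

lemma bump_sum_pos:
  assumes y: "y \<in> points EG"
  shows "(\<Sum>j | tc y j \<noteq> 0. bump y j) > 0"
proof -
  have "\<exists>i. tc y i \<noteq> 0"
  proof (rule ccontr)
    assume "\<nexists>i. tc y i \<noteq> 0"
    then have "{i. tc y i \<noteq> 0} = {}" by blast
    then show False using tc_range(3)[OF y] by simp
  qed
  then obtain i where i: "tc y i \<noteq> 0" "\<And>j. j < i \<Longrightarrow> tc y j = 0"
    using exists_least_iff[of "\<lambda>i. tc y i \<noteq> 0"] by auto
  have "bump y i > 0" unfolding bump_def
    by (rule flat_pos) (use i tc_range(1)[OF y, of i] in simp)
  moreover have "bump y i \<le> (\<Sum>j | tc y j \<noteq> 0. bump y j)"
    by (rule member_le_sum) (use i tc_range[OF y] in \<open>auto simp: bump_def flat_nonneg\<close>)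
  ultimately show ?thesis by linarith
qed

lemma sum_weight:
  assumes y: "y \<in> points EG"
  shows "(\<Sum>i | tc y i \<noteq> 0. weight y i) = 1"
  using bump_sum_pos[OF y] by (simp add: weight_def sum_distrib_right[symmetric])

lemma weight_eq_0: "y \<in> points EG \<Longrightarrow> tc y i = 0 \<Longrightarrow> weight y i = 0"
  by (simp add: weight_def bump_eq_0)

text \<open>The coordinates sum to 1, so a partial sum above 1/2 leaves less than 1/2 for each later
  coordinate, while at least that partial sum is subtracted from it.\<close>

lemma bump_eq_0_above:
  assumes y: "y \<in> points EG" and N: "(\<Sum>j<N. tc y j) > 1 / 2" and i: "i \<ge> N"
  shows "bump y i = 0"
proof -
  have "(\<Sum>j\<in>insert i {..<N}. tc y j) \<le> (\<Sum>j\<in>{j. tc y j \<noteq> 0} \<union> insert i {..<N}. tc y j)"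
    by (rule sum_mono2) (use tc_range[OF y] in auto)
  also have "\<dots> = (\<Sum>j | tc y j \<noteq> 0. tc y j)"
    by (rule sum.mono_neutral_right) (use tc_range[OF y] in auto)
  finally have "tc y i + (\<Sum>j<N. tc y j) \<le> 1" using tc_range(3)[OF y] i by simp
  moreover have "(\<Sum>j<N. tc y j) \<le> (\<Sum>j<i. tc y j)"
    by (rule sum_mono2) (use i tc_range(1)[OF y] in auto)
  ultimately show ?thesis unfolding bump_def using N by (intro flat_eq_0) linarith
qed

text \<open>The support of \<open>tc y\<close> changes with \<open>y\<close>. Smoothness of the
  denominator needs a sum over a range that is the same at all nearby points.\<close>

lemma sum_bump_below:
  assumes y: "y \<in> points EG" and N: "(\<Sum>j<N. tc y j) > 1 / 2"
  shows "(\<Sum>j | tc y j \<noteq> 0. bump y j) = (\<Sum>j<N. bump y j)"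
  by (rule sum.mono_neutral_cong)
     (use tc_range(2)[OF y] bump_eq_0[OF y] bump_eq_0_above[OF y N] in \<open>auto simp: not_less[symmetric]\<close>)

lemma exists_half:
  assumes y: "y \<in> points EG"
  shows "\<exists>N. (\<Sum>j<N. tc y j) > 1 / 2"
proof -
  obtain N where N: "{i. tc y i \<noteq> 0} \<subseteq> {..<N}"
    using tc_range(2)[OF y] finite_nat_bounded by blast
  have "(\<Sum>i | tc y i \<noteq> 0. tc y i) = (\<Sum>j<N. tc y j)"
    by (rule sum.mono_neutral_left[OF _ N]) auto
  then show ?thesis using tc_range(3)[OF y] by (intro exI[of _ N]) simp
qed

lemma weight_smooth:
  assumes p: "(n, U, p) \<in> plots EG" and N: "\<And>u. u \<in> U \<Longrightarrow> (\<Sum>j<N. tc (p u) j) > 1 / 2"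
  shows "smooth_fun n U (\<lambda>u. weight (p u) i)"
proof -
  note U = dspace_open[OF space_EG p] and E = dspace_points[OF space_EG p]
  have b: "smooth_fun n U (\<lambda>u. bump (p u) i)" for i unfolding bump_def
    by (intro smooth_fun_flat smooth_fun_diff smooth_fun_sum tc_smooth[OF p])
  have "smooth_fun n U (\<lambda>u. bump (p u) i * inverse (\<Sum>j<N. bump (p u) j))"
  proof (intro smooth_fun_mult smooth_fun_inverse smooth_fun_sum b)
    fix u assume u: "u \<in> U"
    show "(\<Sum>j<N. bump (p u) j) \<noteq> 0"
      using bump_sum_pos[OF E[OF u]] sum_bump_below[OF E[OF u] N[OF u]] by simp
  qed
  then show ?thesis
    by (subst smooth_fun_cong[OF U, of _ "\<lambda>u. bump (p u) i * inverse (\<Sum>j<N. bump (p u) j)"])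
       (simp_all add: weight_def sum_bump_below[OF E N])
qed

end

lemma linear_sum_scaleR:
  assumes "\<And>i. i \<in> A \<Longrightarrow> linear (f i)"
  shows "linear (\<lambda>v. \<Sum>i\<in>A. c i *\<^sub>R f i v)"
  using assms by (intro linear_compose_sum ballI linear_compose_scale_right) auto

text \<open>Representatives are to be compared modulo relations; this reduces the comparison to a
  single plot \<open>P\<close>.\<close>

lemma lin_ext_diff_mem:
  assumes T: "subspace T" and "\<And>P. \<phi> P \<noteq> 0 \<Longrightarrow> J P (\<phi> P) - K P (\<phi> P) \<in> T"
  shows "lin_ext J \<phi> - lin_ext K \<phi> \<in> T"
  unfolding lin_ext_def sum_subtractf[symmetric] by (rule subspace_sum[OF T]) (use assms(2) in simp)

lemma lin_ext_compose:
  assumes J: "\<forall>P. linear (J P)" and K: "\<And>P v. K P v \<in> finsupp"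
  shows "lin_ext J (lin_ext K \<phi>) = lin_ext (\<lambda>P v. lin_ext J (K P v)) \<phi>"
  unfolding lin_ext_def[of K] lin_ext_def[of "\<lambda>P v. lin_ext J (K P v)"] by (rule lin_ext_sum[OF J K])

section \<open>The connection form on single tangent vectors\<close>

context diff_group
begin

text \<open>For \<open>p 0 = y\<close> this plot passes through \<open>\<one>\<close> at the origin,
  and its derivative there is the \<open>i\<close>-th Maurer-Cartan form. Points with vanishing
  coordinate are removed because \<open>gc\<close> has no meaning there; the component is taken
  because objects of the colimit have connected domains.\<close>

definition triv_plot :: "'a milnor_pre set \<Rightarrow> nat \<Rightarrow> 'a milnor_pre set plot \<Rightarrow> 'a plot" where
  "triv_plot y i P = (case P of (n, U, p) \<Rightarrow>
     (n, connected_component_set {u\<in>U. tc (p u) i \<noteq> 0} 0, \<lambda>u. inv (gc (p u) i) \<otimes> gc y i))"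

lemma fst_triv_plot [simp]: "fst (triv_plot y i P) = fst P"
  by (simp add: triv_plot_def split: prod.split)

lemma triv_plot_plot:
  assumes p: "(n, U, p) \<in> plots EG" and y: "y \<in> points EG"
  shows "(n, {u\<in>U. tc (p u) i \<noteq> 0}, \<lambda>u. inv (gc (p u) i) \<otimes> gc y i) \<in> plots D"
proof -
  have "(n, {u\<in>U. tc (p u) i \<noteq> 0}, \<lambda>_. gc y i) \<in> plots D"
    by (rule dspace_const[OF space_D _ tc_nonzero_open[OF p]]) (simp add: gc_carrier[OF y])
  then show ?thesis
    by (rule diffeological_group_mult[OF diffeological_group diffeological_group_inv[OF diffeological_group gc_plot[OF p]]])
qed

lemma triv_plot_at:
  assumes P: "P \<in> plots_at EG y" and y: "y \<in> points EG" and i: "tc y i \<noteq> 0"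
  shows "triv_plot y i P \<in> plots_at D \<one>"
proof -
  obtain n U p where PU: "P = (n, U, p)" by (cases P)
  have p: "(n, U, p) \<in> plots EG" and U: "0 \<in> U" "p 0 = y" using P by (auto simp: PU plots_at_def)
  let ?C = "connected_component_set {u\<in>U. tc (p u) i \<noteq> 0} 0"
  have C: "openin (Euclidean_space n) ?C"
    by (rule connected_component_openin_Euclidean[OF tc_nonzero_open[OF p]])
  have "(n, ?C, \<lambda>u. inv (gc (p u) i) \<otimes> gc y i) \<in> plots D"
    by (rule dspace_restrict[OF space_D triv_plot_plot[OF p y] C connected_component_subset])
  then show ?thesis unfolding triv_plot_def PU prod.case
  proof (rule plots_atI[OF _ connected_connected_component])
    show "0 \<in> ?C" using U i by (simp add: connected_component_refl_eq)
    show "inv (gc (p 0) i) \<otimes> gc y i = \<one>" using gc_carrier[OF y] U by simp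
  qed
qed

text \<open>From \<open>q \<circ> f = p\<close> both plots have the same coordinates along
  \<open>f\<close>. Being continuous and fixing the origin, \<open>f\<close> maps the component of
  the origin into the component of the origin.\<close>

lemma triv_plot_arrow:
  assumes P: "P \<in> plots_at EG y" and Q: "Q \<in> plots_at EG y" and f: "plot_arrow P Q f"
    and i: "tc y i \<noteq> 0"
  shows "plot_arrow (triv_plot y i P) (triv_plot y i Q) f"
proof -
  obtain n U p where PU: "P = (n, U, p)" by (cases P)
  obtain m V q where QV: "Q = (m, V, q)" by (cases Q)
  have p: "(n, U, p) \<in> plots EG" and U: "0 \<in> U" "p 0 = y" using P by (auto simp: PU plots_at_def)
  have q: "(m, V, q) \<in> plots EG" using Q by (auto simp: QV plots_at_def)
  have f: "smooth_between n U m V f" "f 0 = 0" "\<And>u. u \<in> U \<Longrightarrow> q (f u) = p u"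
    using f by (auto simp: plot_arrow_def PU QV)
  let ?C = "connected_component_set {u\<in>U. tc (p u) i \<noteq> 0} 0"
  let ?C' = "connected_component_set {v\<in>V. tc (q v) i \<noteq> 0} 0"
  have CU: "?C \<subseteq> {u\<in>U. tc (p u) i \<noteq> 0}" by (rule connected_component_subset)
  have "continuous_on U f" by (rule smooth_between_continuous[OF dspace_open[OF space_EG q] f(1)])
  then have "continuous_on ?C f" by (rule continuous_on_subset) (use CU in blast)
  then have "connected (f ` ?C)" by (rule connected_continuous_image) (rule connected_connected_component)
  moreover have "0 \<in> f ` ?C"
    by (rule image_eqI[of _ _ 0]) (use f(2) U i in \<open>simp_all add: connected_component_refl_eq\<close>)
  moreover have "f ` ?C \<subseteq> {v\<in>V. tc (q v) i \<noteq> 0}"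
  proof (rule image_subsetI)
    fix u assume "u \<in> ?C"
    then have "u \<in> U" "tc (p u) i \<noteq> 0" using CU by auto
    then show "f u \<in> {v\<in>V. tc (q v) i \<noteq> 0}" using f(3) smooth_between_mem[OF f(1)] by simp
  qed
  ultimately have "f ` ?C \<subseteq> ?C'" by (intro connected_component_maximal)
  then have "smooth_between n ?C m ?C' f"
    by (intro smooth_between_subset[OF f(1)]) (use CU in auto)
  moreover have "q (f u) = p u" if "u \<in> ?C" for u using CU f(3) that by blast
  ultimately show ?thesis by (simp add: plot_arrow_def triv_plot_def PU QV f(2))
qed

text \<open>The weighted sum of the local forms on the generator \<open>incl P v\<close>, kept in
  the direct sum so that it can be extended linearly before passing to classes.\<close>

definition conn_incl :: "'a milnor_pre set \<Rightarrow> 'a milnor_pre set plot \<Rightarrow> rvec \<Rightarrow> 'a plot \<Rightarrow> rvec" where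
  "conn_incl y P v = (\<Sum>i | tc y i \<noteq> 0. weight y i *\<^sub>R incl (triv_plot y i P) v)"

lemma linear_conn_incl: "\<forall>P. linear (conn_incl y P)"
  unfolding conn_incl_def by (intro allI linear_sum_scaleR linear_incl)

lemma conn_incl_finsupp: "conn_incl y P v \<in> finsupp"
  unfolding conn_incl_def
  by (intro subspace_sum[OF subspace_finsupp] finsupp_scaleR incl_finsupp)

lemma conn_incl_tangent_sum:
  "y \<in> points EG \<Longrightarrow> P \<in> plots_at EG y \<Longrightarrow> v \<in> Rn (fst P) \<Longrightarrow> conn_incl y P v \<in> tangent_sum D \<one>"
  unfolding conn_incl_def
  by (intro subspace_sum[OF subspace_tangent_sum] subspace_scale[OF subspace_tangent_sum] incl_tangent_sum triv_plot_at)
     simp_all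

definition conn_sum :: "'a milnor_pre set \<Rightarrow> ('a milnor_pre set plot \<Rightarrow> rvec) \<Rightarrow> 'a plot \<Rightarrow> rvec" where
  "conn_sum y = lin_ext (conn_incl y)"

lemma conn_sum_tangent_sum:
  "y \<in> points EG \<Longrightarrow> \<phi> \<in> tangent_sum EG y \<Longrightarrow> conn_sum y \<phi> \<in> tangent_sum D \<one>"
  unfolding conn_sum_def by (rule lin_ext_tangent_sum[OF subspace_tangent_sum conn_incl_tangent_sum])

text \<open>The weights depend on the base point \<open>y\<close> but not on the plot, so an arrow
  can be treated index by index, where \<open>triv_plot_arrow\<close> yields a relation in
  \<open>G\<close>.\<close>

lemma conn_sum_relations:
  assumes y: "y \<in> points EG" and \<nu>: "\<nu> \<in> tangent_relations EG y"
  shows "\<nu> \<in> finsupp \<and> conn_sum y \<nu> \<in> tangent_relations D \<one>"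
  unfolding conn_sum_def
proof (rule lin_ext_tangent_relations[OF linear_conn_incl subspace_tangent_relations _ \<nu>])
  fix P Q f v
  assume P: "P \<in> plots_at EG y" and Q: "Q \<in> plots_at EG y" and f: "plot_arrow P Q f" and v: "v \<in> Rn (fst P)"
  show "conn_incl y P v - conn_incl y Q (differential (fst P) f 0 v) \<in> tangent_relations D \<one>"
    unfolding conn_incl_def sum_subtractf[symmetric] scaleR_diff_right[symmetric]
  proof (intro subspace_sum[OF subspace_tangent_relations] subspace_scale[OF subspace_tangent_relations])
    fix i assume "i \<in> {i. tc y i \<noteq> 0}"
    then have i: "tc y i \<noteq> 0" by simp
    show "incl (triv_plot y i P) v - incl (triv_plot y i Q) (differential (fst P) f 0 v) \<in> tangent_relations D \<one>"
      using tangent_relations_arrow[OF triv_plot_at[OF P y i] triv_plot_at[OF Q y i] triv_plot_arrow[OF P Q f i], of v] v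
      by simp
  qed
qed

text \<open>The zero vector as default keeps every value in the tangent space at
  \<open>\<one>\<close>, as \<open>smooth_map_tangent_bundle\<close> demands of all
  arguments.\<close>

definition conn_form :: "'a milnor_pre set tvec \<Rightarrow> 'a tvec" where
  "conn_form a = (if a \<in> tangent_points EG
     then tangent_class D \<one> (conn_sum (fst a) (SOME \<phi>. \<phi> \<in> tangent_sum EG (fst a) \<and> tangent_class EG (fst a) \<phi> = a))
     else tangent_class D \<one> 0)"

text \<open>Two representatives differ by a relation, and \<open>conn_sum\<close> sends relations to
  relations, so the choice in \<open>conn_form\<close> does not affect the class.\<close>

lemma conn_form_class:
  assumes y: "y \<in> points EG" and \<phi>: "\<phi> \<in> tangent_sum EG y"
  shows "conn_form (tangent_class EG y \<phi>) = tangent_class D \<one> (conn_sum y \<phi>)"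
proof -
  define \<psi> where "\<psi> = (SOME \<psi>. \<psi> \<in> tangent_sum EG y \<and> tangent_class EG y \<psi> = tangent_class EG y \<phi>)"
  have \<psi>: "\<psi> \<in> tangent_sum EG y \<and> tangent_class EG y \<psi> = tangent_class EG y \<phi>"
    unfolding \<psi>_def by (rule someI[of _ \<phi>]) (simp add: \<phi>)
  then have "\<psi> - \<phi> \<in> tangent_relations EG y" by (simp add: tangent_class_eq_iff)
  then have "conn_sum y (\<psi> - \<phi>) \<in> tangent_relations D \<one>" using conn_sum_relations[OF y] by blast
  moreover have "conn_sum y (\<psi> - \<phi>) = conn_sum y \<psi> - conn_sum y \<phi>"
    unfolding conn_sum_def
    by (rule lin_ext_diff[OF linear_conn_incl tangent_sum_finsupp[OF conjunct1[OF \<psi>]] tangent_sum_finsupp[OF \<phi>]])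
  ultimately have "tangent_class D \<one> (conn_sum y \<psi>) = tangent_class D \<one> (conn_sum y \<phi>)"
    by (simp add: tangent_class_eq_iff)
  then show ?thesis
    using tangent_class_points[OF y \<phi>] unfolding conn_form_def \<psi>_def by simp
qed

lemma conn_form_carrier: "conn_form a \<in> carrier (tangent_space D \<one>)"
proof (cases "a \<in> tangent_points EG")
  case True
  then obtain y \<phi> where y: "y \<in> points EG" "\<phi> \<in> tangent_sum EG y" "a = tangent_class EG y \<phi>"
    by (rule tangent_points_cases)
  show ?thesis unfolding y(3) conn_form_class[OF y(1,2)] carrier_tangent_space
    by (rule imageI) (rule conn_sum_tangent_sum[OF y(1,2)])
next
  case False
  then have "conn_form a = tangent_class D \<one> 0" by (simp only: conn_form_def if_False)
  then show ?thesis unfolding carrier_tangent_space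
    by (simp only:) (rule imageI[OF subspace_0[OF subspace_tangent_sum]])
qed

lemma conn_form_add:
  assumes y: "y \<in> points EG" and "a \<in> carrier (tangent_space EG y)" "b \<in> carrier (tangent_space EG y)"
  shows "conn_form (a \<oplus>\<^bsub>tangent_space EG y\<^esub> b) = conn_form a \<oplus>\<^bsub>tangent_space D \<one>\<^esub> conn_form b"
proof -
  obtain \<phi> where \<phi>: "\<phi> \<in> tangent_sum EG y" "a = tangent_class EG y \<phi>" using assms(2) by (rule tangent_space_cases)
  obtain \<psi> where \<psi>: "\<psi> \<in> tangent_sum EG y" "b = tangent_class EG y \<psi>" using assms(3) by (rule tangent_space_cases)
  have "conn_sum y (\<phi> + \<psi>) = conn_sum y \<phi> + conn_sum y \<psi>"
    unfolding conn_sum_def by (rule lin_ext_add[OF linear_conn_incl tangent_sum_finsupp[OF \<phi>(1)] tangent_sum_finsupp[OF \<psi>(1)]])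
  then show ?thesis
    unfolding \<phi>(2) \<psi>(2) add_tangent_class conn_form_class[OF y \<phi>(1)] conn_form_class[OF y \<psi>(1)]
      conn_form_class[OF y subspace_add[OF subspace_tangent_sum \<phi>(1) \<psi>(1)]] by (simp only:)
qed

lemma conn_form_smult:
  assumes y: "y \<in> points EG" and "a \<in> carrier (tangent_space EG y)"
  shows "conn_form (c \<odot>\<^bsub>tangent_space EG y\<^esub> a) = c \<odot>\<^bsub>tangent_space D \<one>\<^esub> conn_form a"
proof -
  obtain \<phi> where \<phi>: "\<phi> \<in> tangent_sum EG y" "a = tangent_class EG y \<phi>" using assms(2) by (rule tangent_space_cases)
  have "conn_sum y (c *\<^sub>R \<phi>) = c *\<^sub>R conn_sum y \<phi>"
    unfolding conn_sum_def by (rule lin_ext_scaleR[OF linear_conn_incl tangent_sum_finsupp[OF \<phi>(1)]])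
  then show ?thesis
    unfolding \<phi>(2) smult_tangent_class conn_form_class[OF y \<phi>(1)]
      conn_form_class[OF y subspace_scale[OF subspace_tangent_sum \<phi>(1)]] by (simp only:)
qed

section \<open>Equivariance and fundamental vectors\<close>

lemma weight_translate: "y \<in> points EG \<Longrightarrow> h \<in> carrier G \<Longrightarrow> weight (translate h y) i = weight y i"
  by (simp add: weight_def bump_def tc_act)

lemma conj_smooth:
  assumes h: "h \<in> carrier G"
  shows "smooth_map D D (\<lambda>k. h \<otimes> k \<otimes> inv h)"
proof (rule smooth_mapI)
  show "h \<otimes> k \<otimes> inv h \<in> points D" if "k \<in> points D" for k using h that by simp
  fix n U p assume p: "(n, U, p) \<in> plots D"
  have "(n, U, \<lambda>_. k) \<in> plots D" if "k \<in> carrier G" for k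
    by (rule dspace_const[OF space_D _ dspace_open[OF space_D p]]) (simp add: that)
  from this[OF h] this[OF inv_closed[OF h]] p show "(n, U, \<lambda>u. h \<otimes> p u \<otimes> inv h) \<in> plots D"
    by (intro diffeological_group_mult[OF diffeological_group])
qed

text \<open>Translation by \<open>h\<close> leaves the weights unchanged and turns
  \<open>inv (gc (p u) i) \<otimes> gc y i\<close> into its conjugate by \<open>h\<close>. So each
  \<open>triv_plot\<close> of the translated plot is, near the origin, the conjugate of the original
  one, and linearity does the rest.\<close>

lemma conn_form_equivariant:
  assumes h: "h \<in> carrier G" and a: "a \<in> tangent_points EG"
  shows "conn_form (pushforward EG EG (translate h) a) = adjoint G D h (conn_form a)"
proof -
  obtain y \<phi> where y: "y \<in> points EG" and \<phi>: "\<phi> \<in> tangent_sum EG y" and ay: "a = tangent_class EG y \<phi>"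
    using a by (rule tangent_points_cases)
  let ?C = "\<lambda>k. h \<otimes> k \<otimes> inv h" and ?y = "translate h y"
  note hy = act_EG[OF y h] and fin = tangent_sum_finsupp[OF \<phi>]
  have "adjoint G D h (conn_form a) = tangent_class D (?C \<one>) (push_sum ?C (conn_sum y \<phi>))"
    unfolding adjoint_def ay conn_form_class[OF y \<phi>]
    by (rule pushforward_tangent_class[OF conj_smooth[OF h] tangent_sum_finsupp[OF conn_sum_tangent_sum[OF y \<phi>]]])
  also have "?C \<one> = \<one>" using h by simp
  finally have adj: "adjoint G D h (conn_form a) = tangent_class D \<one> (push_sum ?C (conn_sum y \<phi>))" .
  have push: "conn_form (pushforward EG EG (translate h) a) = tangent_class D \<one> (conn_sum ?y (push_sum (translate h) \<phi>))"
    unfolding ay pushforward_tangent_class[OF act_smooth[OF h] fin]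
    by (rule conn_form_class[OF hy push_tangent_sum[OF act_smooth[OF h] \<phi>]])
  have li: "\<forall>P. linear (incl (push_plot ?C P))" by (simp add: linear_incl)
  have l: "conn_sum ?y (push_sum (translate h) \<phi>) = lin_ext (\<lambda>P v. conn_incl ?y (push_plot (translate h) P) v) \<phi>"
    unfolding conn_sum_def push_sum_eq_lin_ext[OF fin]
      lin_ext_compose[OF linear_conn_incl incl_finsupp] lin_ext_incl[OF linear_conn_incl] ..
  have r: "push_sum ?C (conn_sum y \<phi>) = lin_ext (\<lambda>P v. lin_ext (\<lambda>P. incl (push_plot ?C P)) (conn_incl y P v)) \<phi>"
    unfolding push_sum_eq_lin_ext[OF tangent_sum_finsupp[OF conn_sum_tangent_sum[OF y \<phi>]]] unfolding conn_sum_def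
    by (rule lin_ext_compose[OF li conn_incl_finsupp])
  have "conn_sum ?y (push_sum (translate h) \<phi>) - push_sum ?C (conn_sum y \<phi>) \<in> tangent_relations D \<one>"
    unfolding l r
  proof (rule lin_ext_diff_mem[OF subspace_tangent_relations])
    fix P assume "\<phi> P \<noteq> 0"
    then have P: "P \<in> plots_at EG y" and v: "\<phi> P \<in> Rn (fst P)" using tangent_sum_memD[OF \<phi>] by blast+
    let ?v = "\<phi> P"
    have "lin_ext (\<lambda>P. incl (push_plot ?C P)) (conn_incl y P ?v)
        = (\<Sum>i | tc y i \<noteq> 0. lin_ext (\<lambda>P. incl (push_plot ?C P)) (weight y i *\<^sub>R incl (triv_plot y i P) ?v))"
      unfolding conn_incl_def by (rule lin_ext_sum[OF li]) (intro finsupp_scaleR incl_finsupp)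
    also have "\<dots> = (\<Sum>i | tc y i \<noteq> 0. weight y i *\<^sub>R incl (push_plot ?C (triv_plot y i P)) ?v)"
      unfolding lin_ext_scaleR[OF li incl_finsupp] lin_ext_incl[OF li] ..
    finally have e: "lin_ext (\<lambda>P. incl (push_plot ?C P)) (conn_incl y P ?v) =
      (\<Sum>i | tc y i \<noteq> 0. weight y i *\<^sub>R incl (push_plot ?C (triv_plot y i P)) ?v)" .
    show "conn_incl ?y (push_plot (translate h) P) ?v - lin_ext (\<lambda>P. incl (push_plot ?C P)) (conn_incl y P ?v)
        \<in> tangent_relations D \<one>"
      unfolding e unfolding conn_incl_def tc_act[OF y h] weight_translate[OF y h]
        sum_subtractf[symmetric] scaleR_diff_right[symmetric]
    proof (intro subspace_sum[OF subspace_tangent_relations] subspace_scale[OF subspace_tangent_relations])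
      fix i assume "i \<in> {i. tc y i \<noteq> 0}"
      then have i: "tc y i \<noteq> 0" by simp
      obtain n U p where PU: "P = (n, U, p)" by (cases P)
      have p: "(n, U, p) \<in> plots EG" using P by (simp add: PU plots_at_def)
      note E = dspace_points[OF space_EG p]
      have sub: "connected_component_set {u\<in>U. tc (translate h (p u)) i \<noteq> 0} 0 \<subseteq>
          connected_component_set {u\<in>U. tc (p u) i \<noteq> 0} 0"
        using tc_act[OF E h] by (intro connected_component_mono) auto
      have "push_plot (translate h) P \<in> plots_at EG ?y" by (rule push_plot_at[OF act_smooth[OF h] P])
      then have A: "triv_plot ?y i (push_plot (translate h) P) \<in> plots_at D \<one>"
        by (rule triv_plot_at[OF _ hy]) (simp add: tc_act[OF y h] i)
      have B: "push_plot ?C (triv_plot y i P) \<in> plots_at D \<one>"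
        using push_plot_at[OF conj_smooth[OF h] triv_plot_at[OF P y i]] h by simp
      have "tangent_class D \<one> (incl (triv_plot ?y i (push_plot (translate h) P)) ?v)
          = tangent_class D \<one> (incl (push_plot ?C (triv_plot y i P)) ?v)"
        unfolding PU triv_plot_def push_plot_def prod.case o_def
      proof (rule tangent_class_restrict[OF
            A[unfolded PU triv_plot_def push_plot_def prod.case o_def]
            B[unfolded PU triv_plot_def push_plot_def prod.case o_def] sub _ v[unfolded PU fst_conv]])
        fix u assume "u \<in> connected_component_set {u\<in>U. tc (translate h (p u)) i \<noteq> 0} 0"
        then have "u \<in> {u\<in>U. tc (translate h (p u)) i \<noteq> 0}" by (rule subsetD[OF connected_component_subset])
        then have u: "u \<in> U" "tc (p u) i \<noteq> 0" using tc_act[OF E h, of u] by simp_all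
        have c: "gc (p u) i \<in> carrier G" "gc y i \<in> carrier G" using gc_carrier E[OF u(1)] y by blast+
        show "inv (gc (translate h (p u)) i) \<otimes> gc ?y i = h \<otimes> (inv (gc (p u) i) \<otimes> gc y i) \<otimes> inv h"
          unfolding gc_act[OF E[OF u(1)] h u(2)] gc_act[OF y h i] using c h by (simp add: inv_mult_group m_assoc)
      qed
      then show "incl (triv_plot ?y i (push_plot (translate h) P)) ?v - incl (push_plot ?C (triv_plot y i P)) ?v
          \<in> tangent_relations D \<one>" by (simp only: tangent_class_eq_iff)
    qed
  qed
  then show ?thesis unfolding push adj by (simp only: tangent_class_eq_iff)
qed

text \<open>For a plot \<open>p\<close> of \<open>G\<close> the orbit plot
  \<open>u \<mapsto> p u \<cdot> y\<close> has \<open>i\<close>-th coordinate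
  \<open>gc y i \<otimes> inv (p u)\<close>, so its \<open>triv_plot\<close> is \<open>p\<close>
  itself near the origin. Every index thus returns the original vector, and the weights sum to
  1.\<close>

lemma conn_form_orbit:
  assumes y: "y \<in> points EG" and \<phi>: "\<phi> \<in> tangent_sum D \<one>"
  shows "conn_form (pushforward D EG (\<lambda>h. translate h y) (tangent_class D \<one> \<phi>)) = tangent_class D \<one> \<phi>"
proof -
  let ?\<alpha> = "\<lambda>h. translate h y"
  note \<alpha> = orbit_smooth[OF y] and fin = tangent_sum_finsupp[OF \<phi>]
  have one: "?\<alpha> \<one> = y" by (rule act_one[OF y])
  have push: "push_sum ?\<alpha> \<phi> \<in> tangent_sum EG y" using push_tangent_sum[OF \<alpha> \<phi>] one by simp
  have e: "conn_form (pushforward D EG ?\<alpha> (tangent_class D \<one> \<phi>)) = tangent_class D \<one> (conn_sum y (push_sum ?\<alpha> \<phi>))"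
    unfolding pushforward_tangent_class[OF \<alpha> fin] one by (rule conn_form_class[OF y push])
  have l: "conn_sum y (push_sum ?\<alpha> \<phi>) = lin_ext (\<lambda>P v. conn_incl y (push_plot ?\<alpha> P) v) \<phi>"
    unfolding conn_sum_def push_sum_eq_lin_ext[OF fin]
      lin_ext_compose[OF linear_conn_incl incl_finsupp] lin_ext_incl[OF linear_conn_incl] ..
  have r: "\<phi> = lin_ext incl \<phi>" unfolding lin_ext_def by (rule finsupp_eq_sum_incl[OF fin])
  have "lin_ext (\<lambda>P v. conn_incl y (push_plot ?\<alpha> P) v) \<phi> - lin_ext incl \<phi> \<in> tangent_relations D \<one>"
  proof (rule lin_ext_diff_mem[OF subspace_tangent_relations])
    fix P assume "\<phi> P \<noteq> 0"
    then have P: "P \<in> plots_at D \<one>" and v: "\<phi> P \<in> Rn (fst P)" using tangent_sum_memD[OF \<phi>] by blast+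
    let ?v = "\<phi> P"
    have "incl P ?v = (\<Sum>i | tc y i \<noteq> 0. weight y i *\<^sub>R incl P ?v)"
      unfolding scaleR_left.sum[symmetric] sum_weight[OF y] by simp
    then have "conn_incl y (push_plot ?\<alpha> P) ?v - incl P ?v =
        (\<Sum>i | tc y i \<noteq> 0. weight y i *\<^sub>R (incl (triv_plot y i (push_plot ?\<alpha> P)) ?v - incl P ?v))"
      by (simp only: conn_incl_def sum_subtractf scaleR_diff_right)
    also have "\<dots> \<in> tangent_relations D \<one>"
    proof (intro subspace_sum[OF subspace_tangent_relations] subspace_scale[OF subspace_tangent_relations])
      fix i assume "i \<in> {i. tc y i \<noteq> 0}"
      then have i: "tc y i \<noteq> 0" by simp
      obtain n U p where PU: "P = (n, U, p)" by (cases P)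
      have p: "(n, U, p) \<in> plots D" using P by (simp add: PU plots_at_def)
      have E: "p u \<in> carrier G" if "u \<in> U" for u using dspace_points[OF space_D p that] by simp
      have "push_plot ?\<alpha> P \<in> plots_at EG y" using push_plot_at[OF \<alpha> P] one by simp
      from triv_plot_at[OF this y i] have A: "triv_plot y i (push_plot ?\<alpha> P) \<in> plots_at D \<one>" .
      have sub: "connected_component_set {u\<in>U. tc (translate (p u) y) i \<noteq> 0} 0 \<subseteq> U"
        using connected_component_subset by blast
      have "tangent_class D \<one> (incl (triv_plot y i (push_plot ?\<alpha> P)) ?v) = tangent_class D \<one> (incl P ?v)"
        unfolding PU triv_plot_def push_plot_def prod.case o_def
      proof (rule tangent_class_restrict[OF
            A[unfolded PU triv_plot_def push_plot_def prod.case o_def] P[unfolded PU] sub _ v[unfolded PU fst_conv]])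
        fix u assume "u \<in> connected_component_set {u\<in>U. tc (translate (p u) y) i \<noteq> 0} 0"
        then have u: "p u \<in> carrier G" using sub E by blast
        then show "inv (gc (translate (p u) y) i) \<otimes> gc y i = p u"
          unfolding gc_act[OF y u i] using gc_carrier[OF y, of i] by (simp add: inv_mult_group m_assoc)
      qed
      then show "incl (triv_plot y i (push_plot ?\<alpha> P)) ?v - incl P ?v \<in> tangent_relations D \<one>"
        by (simp only: tangent_class_eq_iff)
    qed
    finally show "conn_incl y (push_plot ?\<alpha> P) ?v - incl P ?v \<in> tangent_relations D \<one>" .
  qed
  then have "conn_sum y (push_sum ?\<alpha> \<phi>) - \<phi> \<in> tangent_relations D \<one>"
    unfolding l unfolding r[symmetric] .
  then show ?thesis unfolding e by (simp only: tangent_class_eq_iff)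
qed

lemma total_milnor_bundle [simp]: "total (milnor_bundle G D) = EG" and act_milnor_bundle [simp]: "act (milnor_bundle G D) = translate"
  by (simp_all add: milnor_bundle_def)

text \<open>By functoriality the velocity of \<open>g t \<cdot> y\<close> is the image of \<xi>
  under the tangent map of the orbit map. It depends on the curve only through \<xi>, which settles
  the definite description, and \<open>conn_form_orbit\<close> applies.\<close>

lemma conn_form_fundamental:
  assumes y: "y \<in> points EG" and \<xi>: "\<xi> \<in> carrier (lie_space G D)"
  shows "conn_form (fundamental_vector G D (milnor_bundle G D) \<xi> y) = \<xi>"
proof -
  have vel: "velocity EG (\<lambda>t. translate (g t) y) 0 = pushforward D EG (\<lambda>h. translate h y) (velocity D g 0)"
    if "smooth_map real_space D g" for g
    by (rule velocity_push[OF that orbit_smooth[OF y]])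
  obtain g where g: "smooth_map real_space D g" "g 0 = \<one>" "velocity D g 0 = \<xi>"
    using lie_space_velocity[OF diffeological_group \<xi>] by blast
  have "fundamental_vector G D (milnor_bundle G D) \<xi> y = pushforward D EG (\<lambda>h. translate h y) \<xi>"
    unfolding fundamental_vector_def total_milnor_bundle act_milnor_bundle
  proof (rule the_equality)
    show "\<exists>g. smooth_map real_space D g \<and> g 0 = \<one> \<and> velocity D g 0 = \<xi> \<and>
        pushforward D EG (\<lambda>h. translate h y) \<xi> = velocity EG (\<lambda>t. translate (g t) y) 0"
      using g vel[OF g(1)] by (intro exI[of _ g]) simp
    fix v assume "\<exists>g. smooth_map real_space D g \<and> g 0 = \<one> \<and> velocity D g 0 = \<xi> \<and>
        v = velocity EG (\<lambda>t. translate (g t) y) 0"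
    then show "v = pushforward D EG (\<lambda>h. translate h y) \<xi>" using vel by auto
  qed
  moreover obtain \<phi> where "\<phi> \<in> tangent_sum D \<one>" "\<xi> = tangent_class D \<one> \<phi>"
    using \<xi> unfolding lie_space_def by (rule tangent_space_cases)
  ultimately show ?thesis using conn_form_orbit[OF y] by simp
qed

end

section \<open>Two vectors of R^n as one vector of R^(2n)\<close>

definition rpair :: "nat \<Rightarrow> rvec \<Rightarrow> rvec \<Rightarrow> rvec" where
  "rpair n u u' = (\<lambda>j. if j < n then u j else u' (j - n))"

definition rfst :: "nat \<Rightarrow> rvec \<Rightarrow> rvec" where "rfst n z = (\<lambda>j. if j < n then z j else 0)"

definition rsnd :: "nat \<Rightarrow> rvec \<Rightarrow> rvec" where "rsnd n z = (\<lambda>j. if j < n then z (n + j) else 0)"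

lemma rfst_rpair: "u \<in> Rn n \<Longrightarrow> rfst n (rpair n u u') = u"
  by (auto simp: rfst_def rpair_def fun_eq_iff)

lemma rsnd_rpair: "u' \<in> Rn n \<Longrightarrow> rsnd n (rpair n u u') = u'"
  by (auto simp: rsnd_def rpair_def fun_eq_iff)

lemma rpair_Rn: "u' \<in> Rn n \<Longrightarrow> rpair n u u' \<in> Rn (n + n)"
  by (auto simp: rpair_def)

lemma rpair_add: "rpair n u u' + rpair n w w' = rpair n (u + w) (u' + w')"
  by (auto simp: rpair_def fun_eq_iff)

lemma smooth_rfst: "smooth_between (n + n) (Rn (n + n)) n (Rn n) (rfst n)"
  and smooth_rsnd: "smooth_between (n + n) (Rn (n + n)) n (Rn n) (rsnd n)"
  by (rule smooth_betweenI; auto simp: rfst_def rsnd_def)+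

lemma smooth_rpair:
  assumes "\<And>s. s \<in> V \<Longrightarrow> rpair n (a s) (b s) \<in> W"
    and "\<And>j. j < n \<Longrightarrow> smooth_fun m V (\<lambda>s. a s j)" "\<And>j. j < n \<Longrightarrow> smooth_fun m V (\<lambda>s. b s j)"
  shows "smooth_between m V (n + n) W (\<lambda>s. rpair n (a s) (b s))"
proof (rule smooth_betweenI)
  show "(\<lambda>s. rpair n (a s) (b s)) ` V \<subseteq> W" using assms(1) by blast
  show "smooth_fun m V (\<lambda>s. rpair n (a s) (b s) j)" if "j < n + n" for j
    using assms(2)[of j] assms(3)[of "j - n"] that by (cases "j < n") (simp_all add: rpair_def)
qed

lemma differential_rpair:
  assumes v: "v \<in> Rn n"
  shows "differential n (rpair n 0) 0 v = rpair n 0 v"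
proof -
  have "((\<lambda>t. rpair n 0 ((\<lambda>_. 0)(i := t)) j) has_real_derivative (if j < n then 0 else if j - n = i then 1 else 0)) (at 0)" for i j
    by (simp add: rpair_def)
  then have "differential n (rpair n 0) 0 v = (\<lambda>j. \<Sum>i<n. v i * (if j < n then 0 else if j - n = i then 1 else 0))"
    by (rule differential_eq)
  also have "\<dots> = rpair n 0 v"
    using v by (auto simp: rpair_def fun_eq_iff if_distrib cong: if_cong)
  finally show ?thesis .
qed

lemma smooth_between_coord: "smooth_between m V n U f \<Longrightarrow> j < n \<Longrightarrow> smooth_fun m V (\<lambda>s. f s j)"
  by (simp add: smooth_between_def)

text \<open>A pseudo-bundle has smooth addition of two vectors and smooth scaling, which gives sums
  whose number of terms is constant along the plot. This is where local finiteness of the weights is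
  used.\<close>

lemma tangent_class_sum_plots:
  fixes N :: nat
  assumes F: "diffeological_space F" "vector_pseudo_bundle F Y fst (tangent_space Y)" and V: "openin (Euclidean_space m) V"
    and zero: "tangent_class Y y 0 \<in> points F"
    and "\<And>i. i < N \<Longrightarrow> smooth_fun m V (c i)" "\<And>i. i < N \<Longrightarrow> (m, V, \<lambda>s. tangent_class Y y (\<theta> i s)) \<in> plots F"
  shows "(m, V, \<lambda>s. tangent_class Y y (\<Sum>i<N. c i s *\<^sub>R \<theta> i s)) \<in> plots F"
  using assms(5,6)
proof (induction N)
  case 0
  show ?case unfolding lessThan_0 sum.empty by (rule dspace_const[OF F(1) zero V])
next
  case (Suc N)
  have "(m, V, \<lambda>s. c N s \<odot>\<^bsub>tangent_space Y y\<^esub> tangent_class Y y (\<theta> N s)) \<in> plots F"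
    by (rule fibrewise_smult_plots[OF F(2) _ _ _ F(1)]) (use Suc.prems V in simp_all)
  then have 1: "(m, V, \<lambda>s. tangent_class Y y (c N s *\<^sub>R \<theta> N s)) \<in> plots F"
    unfolding smult_tangent_class .
  have 2: "(m, V, \<lambda>s. tangent_class Y y (\<Sum>i<N. c i s *\<^sub>R \<theta> i s)) \<in> plots F"
    by (rule Suc.IH) (use Suc.prems in simp_all)
  have "(m, V, \<lambda>s. tangent_class Y y (\<Sum>i<N. c i s *\<^sub>R \<theta> i s) \<oplus>\<^bsub>tangent_space Y y\<^esub> tangent_class Y y (c N s *\<^sub>R \<theta> N s)) \<in> plots F"
    by (rule fibrewise_add_plots[OF F(2) 2 1 _ _ F(1)]) simp_all
  then show ?case unfolding add_tangent_class sum.lessThan_Suc .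
qed

section \<open>Smoothness of the connection form\<close>

context diff_group
begin

text \<open>Separate variables for the base point and the moving point put the local forms at all
  base points into one plot, which is constantly \<open>\<one>\<close> on the diagonal.\<close>

lemma translate_quotient_plot:
  assumes W: "openin (Euclidean_space n) W" and g: "(n, W, g) \<in> plots D"
  shows "(n + n, {z \<in> Rn (n + n). rfst n z \<in> W \<and> rsnd n z \<in> W}, \<lambda>z. inv (g (rsnd n z)) \<otimes> g (rfst n z)) \<in> plots D"
    (is "(_, ?Z, _) \<in> _")
proof -
  have "openin (Euclidean_space (n + n)) ({z \<in> Rn (n + n). rfst n z \<in> W} \<inter> {z \<in> Rn (n + n). rsnd n z \<in> W})"
    by (intro openin_Int smooth_between_preimage[OF openin_Rn openin_Rn smooth_rfst W]
        smooth_between_preimage[OF openin_Rn openin_Rn smooth_rsnd W])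
  moreover have "{z \<in> Rn (n + n). rfst n z \<in> W} \<inter> {z \<in> Rn (n + n). rsnd n z \<in> W} = ?Z" by blast
  ultimately have Z: "openin (Euclidean_space (n + n)) ?Z" by simp
  have "smooth_between (n + n) ?Z n W (rfst n)" "smooth_between (n + n) ?Z n W (rsnd n)"
    by (rule smooth_between_subset[OF smooth_rfst], auto, rule smooth_between_subset[OF smooth_rsnd], auto)
  from dspace_precomp[OF space_D g Z this(1)] dspace_precomp[OF space_D g Z this(2)]
  show ?thesis unfolding o_def
    by (intro diffeological_group_mult[OF diffeological_group] diffeological_group_inv[OF diffeological_group])
qed

text \<open>The vector \<open>d/dw (g\<^sub>i(u+w)\<inverse> g\<^sub>i(u))\<close> is the image of \<open>(0, v)\<close> under the tangent map of
  \<open>(u, u') \<mapsto> g\<^sub>i(u')\<inverse> g\<^sub>i(u)\<close> at the diagonal, and so depends smoothly on \<open>(u, v)\<close>.\<close>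

lemma triv_plot_eq_quotient:
  assumes p: "(n, U, p) \<in> plots EG" and W: "openin (Euclidean_space n) W" "W \<subseteq> U" and g: "(n, W, g) \<in> plots D"
    and gc: "\<And>u. u \<in> W \<Longrightarrow> tc (p u) i \<noteq> 0 \<Longrightarrow> gc (p u) i = g u"
    and u: "u \<in> W" "tc (p u) i \<noteq> 0" and v: "v \<in> Rn n"
  shows "tangent_class D \<one> (incl (triv_plot (p u) i (germ_plot n U p u)) v) =
    tangent_class D \<one> (incl (germ_plot (n + n) {z \<in> Rn (n + n). rfst n z \<in> W \<and> rsnd n z \<in> W}
      (\<lambda>z. inv (g (rsnd n z)) \<otimes> g (rfst n z)) (rpair n u u)) (rpair n 0 v))"
proof -
  define Z where "Z = {z \<in> Rn (n + n). rfst n z \<in> W \<and> rsnd n z \<in> W}"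
  define h where "h z = inv (g (rsnd n z)) \<otimes> g (rfst n z)" for z
  \<comment> \<open>On \<open>W'\<close> both descriptions are available: \<open>gc\<close> is
    meaningful and agrees with \<open>g\<close>. Both sides of the claim are compared with the germ
    at \<open>u\<close> of the plot \<open>k\<close> on \<open>W'\<close>.\<close>
  define W' where "W' = {w\<in>W. tc (p w) i \<noteq> 0}"
  define k where "k w = inv (gc (p w) i) \<otimes> gc (p u) i" for w
  have uU: "u \<in> U" using u W by blast
  have y: "p u \<in> points EG" by (rule dspace_points[OF space_EG p uU])
  have uR: "u \<in> Rn n" using openin_Euclidean_subset[OF W(1) u(1)] .
  have W'_eq: "W' = W \<inter> {w\<in>U. tc (p w) i \<noteq> 0}" using W(2) by (auto simp: W'_def)
  have W'o: "openin (Euclidean_space n) W'" unfolding W'_eq by (intro openin_Int W(1) tc_nonzero_open[OF p])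
  have kp: "(n, W', k) \<in> plots D" unfolding k_def
    by (rule dspace_restrict[OF space_D triv_plot_plot[OF p y] W'o]) (simp add: W'_eq)
  have uW': "u \<in> W'" using u by (simp add: W'_def)
  have ku: "k u = \<one>" using gc_carrier[OF y] by (simp add: k_def)
  have K: "germ_plot n W' k u \<in> plots_at D \<one>" using germ_plot_at[OF space_D kp uW'] ku by simp
  have T: "triv_plot (p u) i (germ_plot n U p u) \<in> plots_at D \<one>"
    by (rule triv_plot_at[OF germ_plot_at[OF space_EG p uU] y u(2)])
  have hZ: "(n + n, Z, h) \<in> plots D" unfolding Z_def h_def by (rule translate_quotient_plot[OF W(1) g])
  have uuZ: "rpair n u u \<in> Z"
    unfolding Z_def using rpair_Rn[OF uR] rfst_rpair[OF uR] rsnd_rpair[OF uR] u by simp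
  have "h (rpair n u u) = \<one>"
    using dspace_points[OF space_D g u(1)] by (simp add: h_def rfst_rpair[OF uR] rsnd_rpair[OF uR])
  then have H: "germ_plot (n + n) Z h (rpair n u u) \<in> plots_at D \<one>"
    using germ_plot_at[OF space_D hZ uuZ] by simp
  let ?K = "connected_component_set {w. u + w \<in> W'} 0"
  have Ksub: "?K \<subseteq> {w. u + w \<in> W'}" by (rule connected_component_subset)
  have K0: "0 \<in> ?K" using germ_domain(2)[OF W'o uW'] .
  have Kconn: "connected ?K" by (rule connected_connected_component)
  have "tangent_class D \<one> (incl (germ_plot n W' k u) v) = tangent_class D \<one> (incl (triv_plot (p u) i (germ_plot n U p u)) v)"
    unfolding germ_plot_def triv_plot_def prod.case
  proof (rule tangent_class_restrict[OF K[unfolded germ_plot_def] T[unfolded germ_plot_def triv_plot_def prod.case] _ _ v])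
    have "?K \<subseteq> connected_component_set {w. u + w \<in> U} 0"
      by (rule connected_component_maximal[OF K0 Kconn]) (use Ksub W'_eq in blast)
    then have "?K \<subseteq> {w \<in> connected_component_set {w. u + w \<in> U} 0. tc (p (u + w)) i \<noteq> 0}"
      using Ksub W'_eq by blast
    then show "?K \<subseteq> connected_component_set {w \<in> connected_component_set {w. u + w \<in> U} 0. tc (p (u + w)) i \<noteq> 0} 0"
      by (rule connected_component_maximal[OF K0 Kconn])
  qed (simp add: k_def)
  moreover have "tangent_class D \<one> (incl (germ_plot n W' k u) v) =
      tangent_class D \<one> (incl (germ_plot (n + n) Z h (rpair n u u)) (rpair n 0 v))"
  proof (rule tangent_class_arrow[OF K H])
    \<comment> \<open>The arrow \<open>rpair n 0\<close> keeps the base point in the first block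
      fixed and moves the second block by \<open>w\<close>.\<close>
    have sm: "smooth_between n (Rn n) (n + n) (Rn (n + n)) (rpair n 0)"
      by (rule smooth_rpair) (use rpair_Rn in auto)
    have KR: "?K \<subseteq> Rn n" using openin_subset[OF germ_domain(1)[OF W'o uW']] .
    have z: "rpair n u u + rpair n 0 w = rpair n u (u + w)" for w by (simp add: rpair_add)
    have inZ: "rpair n u (u + w) \<in> Z" if "w \<in> ?K" for w
    proof -
      have "u + w \<in> W" using that Ksub W'_eq by blast
      moreover from this have "u + w \<in> Rn n" by (rule openin_Euclidean_subset[OF W(1)])
      ultimately show ?thesis unfolding Z_def
        using rpair_Rn[of "u + w" n u] rfst_rpair[OF uR, of "u + w"] rsnd_rpair[of "u + w" n u] u(1) by simp
    qed
    have z0: "rpair n 0 0 = 0" by (auto simp: rpair_def)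
    have "rpair n 0 ` ?K \<subseteq> connected_component_set {w. rpair n u u + w \<in> Z} 0"
    proof (rule connected_component_maximal)
      show "0 \<in> rpair n 0 ` ?K" by (rule image_eqI[of _ _ 0]) (simp_all only: z0 K0)
      show "connected (rpair n 0 ` ?K)"
        by (rule connected_continuous_image[OF continuous_on_subset[OF smooth_between_continuous[OF openin_Rn sm] KR] Kconn])
      show "rpair n 0 ` ?K \<subseteq> {w. rpair n u u + w \<in> Z}" using inZ unfolding z[symmetric] by blast
    qed
    then have "smooth_between n ?K (n + n) (connected_component_set {w. rpair n u u + w \<in> Z} 0) (rpair n 0)"
      by (rule smooth_between_subset[OF sm KR])
    moreover have "h (rpair n u u + rpair n 0 w) = k (u + w)" if w: "w \<in> ?K" for w
    proof -
      have w': "u + w \<in> W" "tc (p (u + w)) i \<noteq> 0" using w Ksub by (auto simp: W'_def)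
      then have "u + w \<in> Rn n" using openin_Euclidean_subset[OF W(1)] by blast
      then show ?thesis unfolding z h_def k_def
        by (simp only: rfst_rpair[OF uR] rsnd_rpair gc[OF w'] gc[OF u])
    qed
    ultimately show "plot_arrow (germ_plot n W' k u) (germ_plot (n + n) Z h (rpair n u u)) (rpair n 0)"
      unfolding plot_arrow_def germ_plot_def prod.case using z0 by blast
    show "v \<in> Rn (fst (germ_plot n W' k u))" using v by (simp add: germ_plot_def)
    show "differential (fst (germ_plot n W' k u)) (rpair n 0) 0 v = rpair n 0 v"
      using differential_rpair[OF v] by (simp add: germ_plot_def)
  qed
  ultimately show ?thesis unfolding Z_def h_def by simp
qed

text \<open>Near a parameter \<open>s0\<close> the form is a sum over a fixed range
  \<open>i < N\<close> of smooth weights times vectors, and each vector is a value of the tangent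
  map of one fixed plot of \<open>G\<close> at smoothly varying arguments. Every admissible
  diffeology makes such sums smooth.\<close>

lemma conn_form_plots:
  assumes \<Q>: "admissible_tangent_diffeology D \<Q>" and p: "(n, U, p) \<in> plots EG"
    and V: "openin (Euclidean_space m) V" and a: "smooth_between m V n U a" and b: "smooth_between m V n (Rn n) b"
  shows "(m, V, \<lambda>s. conn_form (plot_tangent EG (n, U, p) (a s, b s))) \<in> \<Q>"
proof -
  define F where "F = \<lparr>points = tangent_points D, plots = \<Q>\<rparr>"
  have F: "diffeological_space F" "vector_pseudo_bundle F D fst (tangent_space D)"
    and tp: "\<And>n U p. (n, U, p) \<in> plots D \<Longrightarrow>
      smooth_map (prod_space (domain_space n U) (domain_space n (Rn n))) F (plot_tangent D (n, U, p))"
    using \<Q> by (auto simp: admissible_tangent_diffeology_def F_def Let_def)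
  note U = dspace_open[OF space_EG p]
  have "(m, V, \<lambda>s. conn_form (plot_tangent EG (n, U, p) (a s, b s))) \<in> plots F"
  proof (rule dspace_local[OF F(1) V])
    fix s0 assume s0: "s0 \<in> V"
    have u0: "a s0 \<in> U" by (rule smooth_between_mem[OF a s0])
    from EG_plot_lift[OF p u0] obtain W q where W: "a s0 \<in> W" "W \<subseteq> U" "openin (Euclidean_space n) W" "(n, W, q) \<in> plots S"
      and tcq: "\<And>v i. v \<in> W \<Longrightarrow> tc (p v) i \<noteq> 0 \<Longrightarrow> gc (p v) i = snd (q v) i" by metis
    obtain N where N: "(\<Sum>j<N. tc (p (a s0)) j) > 1 / 2"
      using exists_half[OF dspace_points[OF space_EG p u0]] by blast
    \<comment> \<open>The strict inequality is an open condition, so the same cutoff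
      \<open>N\<close> serves a whole neighbourhood.\<close>
    define W' where "W' = W \<inter> {u\<in>U. (\<Sum>j<N. tc (p u) j) \<in> {1 / 2<..}}"
    have W'o: "openin (Euclidean_space n) W'" unfolding W'_def
      by (intro openin_Int W(3) smooth_fun_preimage[OF U] smooth_fun_sum tc_smooth[OF p]) simp
    have W'U: "W' \<subseteq> U" by (auto simp: W'_def)
    define V' where "V' = {s\<in>V. a s \<in> W'}"
    have V'o: "openin (Euclidean_space m) V'" unfolding V'_def by (rule smooth_between_preimage[OF V U a W'o])
    have V'V: "V' \<subseteq> V" by (simp add: V'_def)
    have s0V': "s0 \<in> V'" using s0 u0 W(1) N by (simp add: V'_def W'_def)
    have aW': "a s \<in> W'" if "s \<in> V'" for s using that by (simp add: V'_def)
    have a': "smooth_between m V' n W' a" by (rule smooth_between_subset[OF a V'V]) (use aW' in blast)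
    have b': "smooth_between m V' n (Rn n) b"
      by (rule smooth_between_subset[OF b V'V]) (use smooth_between_mem[OF b] V'V in blast)
    have gp: "(n, W', \<lambda>u. snd (q u) i) \<in> plots D" for i
    proof (rule dspace_restrict[OF space_D _ W'o])
      show "(n, W, \<lambda>u. snd (q u) i) \<in> plots D" using W(4) unfolding plots_S by blast
    qed (simp add: W'_def)
    define Z where "Z = {z \<in> Rn (n + n). rfst n z \<in> W' \<and> rsnd n z \<in> W'}"
    \<comment> \<open>Using the lift \<open>q\<close> instead of \<open>gc\<close> keeps
      \<open>h i\<close> a plot also across points where the \<open>i\<close>-th coordinate
      vanishes. At such points it need not represent the local form, but there its weight is
      0.\<close>
    define h where "h i z = inv (snd (q (rsnd n z)) i) \<otimes> snd (q (rfst n z)) i" for i z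
    have hp: "(n + n, Z, h i) \<in> plots D" for i unfolding Z_def h_def by (rule translate_quotient_plot[OF W'o gp])
    define \<theta> where "\<theta> i s = incl (germ_plot (n + n) Z (h i) (rpair n (a s) (a s))) (rpair n 0 (b s))" for i s
    have aR: "a s \<in> Rn n" if "s \<in> V'" for s using openin_Euclidean_subset[OF W'o aW'[OF that]] .
    have aa: "rpair n (a s) (a s) \<in> Z" if "s \<in> V'" for s
      unfolding Z_def using rpair_Rn[OF aR[OF that]] rfst_rpair[OF aR[OF that]] rsnd_rpair[OF aR[OF that]] aW'[OF that] by simp
    have h1: "h i (rpair n (a s) (a s)) = \<one>" if "s \<in> V'" for i s
      using dspace_points[OF space_D gp aW'[OF that]] by (simp add: h_def rfst_rpair[OF aR[OF that]] rsnd_rpair[OF aR[OF that]])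
    have \<theta>_plot: "(m, V', \<lambda>s. tangent_class D \<one> (\<theta> i s)) \<in> plots F" for i
    proof -
      have "smooth_between m V' (n + n) Z (\<lambda>s. rpair n (a s) (a s))"
        by (rule smooth_rpair[OF aa smooth_between_coord[OF a'] smooth_between_coord[OF a']])
      moreover have "smooth_between m V' (n + n) (Rn (n + n)) (\<lambda>s. rpair n 0 (b s))"
        by (rule smooth_rpair[OF rpair_Rn[OF smooth_between_mem[OF b']] _ smooth_between_coord[OF b']]) simp_all
      ultimately have "(m, V', \<lambda>s. (rpair n (a s) (a s), rpair n 0 (b s))) \<in>
          plots (prod_space (domain_space (n + n) Z) (domain_space (n + n) (Rn (n + n))))"
        unfolding plots_prod_space using V'o by (simp add: domain_space_def)
      from smooth_map_plots[OF tp[OF hp] this]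
      show ?thesis
        by (rule dspace_cong[OF F(1)]) (simp add: plot_tangent_eq[OF space_D hp] h1 \<theta>_def)
    qed
    have w: "smooth_fun m V' (\<lambda>s. weight (p (a s)) i)" for i
    proof (rule weight_smooth)
      have "smooth_between m V' n U a" by (rule smooth_between_subset[OF a V'V]) (use aW' W'U in blast)
      from dspace_precomp[OF space_EG p V'o this] show "(m, V', \<lambda>s. p (a s)) \<in> plots EG" unfolding o_def .
      show "(\<Sum>j<N. tc (p (a s)) j) > 1 / 2" if "s \<in> V'" for s using aW'[OF that] by (simp add: W'_def)
    qed
    have "tangent_class D \<one> 0 \<in> points F"
      unfolding F_def using tangent_class_points[of "\<one>" D 0] subspace_0[OF subspace_tangent_sum[of D "\<one>"]] by simp
    from tangent_class_sum_plots[OF F V'o this, of N, OF w \<theta>_plot]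
    have "(m, V', \<lambda>s. conn_form (plot_tangent EG (n, U, p) (a s, b s))) \<in> plots F"
    proof (rule dspace_cong[OF F(1)])
      fix s assume s: "s \<in> V'"
      let ?u = "a s" and ?v = "b s" and ?y = "p (a s)"
      let ?P = "germ_plot n U p (a s)"
      have u: "?u \<in> U" "?u \<in> W'" using aW'[OF s] W'U by blast+
      have v: "?v \<in> Rn n" by (rule smooth_between_mem[OF b' s])
      note y = dspace_points[OF space_EG p u(1)]
      have P: "?P \<in> plots_at EG ?y" by (rule germ_plot_at[OF space_EG p u(1)])
      have fP: "fst ?P = n" by (simp add: germ_plot_def)
      have half: "(\<Sum>j<N. tc ?y j) > 1 / 2" using u(2) by (simp add: W'_def)
      have zero: "weight ?y i = 0" if "i \<ge> N" for i
        using bump_eq_0_above[OF y half that] by (simp add: weight_def)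
      have 1: "conn_form (plot_tangent EG (n, U, p) (?u, ?v)) = tangent_class D \<one> (conn_incl ?y ?P ?v)"
        unfolding plot_tangent_eq[OF space_EG p]
          conn_form_class[OF y incl_tangent_sum[OF P, unfolded fP, OF v]] conn_sum_def lin_ext_incl[OF linear_conn_incl] ..
      \<comment> \<open>Weights vanish outside the support and from \<open>N\<close> on, so the sum
        over the support and the sum over \<open>i < N\<close> both reduce to this common index set,
        on which the local forms can be identified.\<close>
      let ?A = "{i. tc ?y i \<noteq> 0} \<inter> {..<N}"
      have A: "(\<Sum>i | tc ?y i \<noteq> 0. weight ?y i *\<^sub>R f i) = (\<Sum>i\<in>?A. weight ?y i *\<^sub>R f i)"
        "(\<Sum>i<N. weight ?y i *\<^sub>R f i) = (\<Sum>i\<in>?A. weight ?y i *\<^sub>R f i)" for f :: "nat \<Rightarrow> 'a plot \<Rightarrow> rvec"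
        by (rule sum.mono_neutral_right;
            use tc_range(2)[OF y] zero weight_eq_0[OF y] in \<open>auto simp: not_less\<close>)+
      have "(\<Sum>i<N. weight ?y i *\<^sub>R \<theta> i s) - conn_incl ?y ?P ?v =
          (\<Sum>i\<in>?A. weight ?y i *\<^sub>R (\<theta> i s - incl (triv_plot ?y i ?P) ?v))"
        unfolding conn_incl_def A by (simp only: sum_subtractf scaleR_diff_right)
      also have "\<dots> \<in> tangent_relations D \<one>"
      proof (intro subspace_sum[OF subspace_tangent_relations] subspace_scale[OF subspace_tangent_relations])
        fix i assume "i \<in> ?A"
        then have i: "tc ?y i \<noteq> 0" by simp
        have gcq: "gc (p u) i = snd (q u) i" if "u \<in> W'" "tc (p u) i \<noteq> 0" for u
          by (rule tcq) (use that in \<open>simp_all add: W'_def\<close>)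
        show "\<theta> i s - incl (triv_plot ?y i ?P) ?v \<in> tangent_relations D \<one>"
          unfolding tangent_class_eq_iff[symmetric] \<theta>_def Z_def h_def
          by (rule triv_plot_eq_quotient[OF p W'o W'U gp gcq u(2) i v, symmetric])
      qed
      finally show "tangent_class D \<one> (\<Sum>i<N. weight ?y i *\<^sub>R \<theta> i s) = conn_form (plot_tangent EG (n, U, p) (?u, ?v))"
        unfolding 1 tangent_class_eq_iff .
    qed
    then show "\<exists>V'. s0 \<in> V' \<and> V' \<subseteq> V \<and> (m, V', \<lambda>s. conn_form (plot_tangent EG (n, U, p) (a s, b s))) \<in> plots F"
      using s0V' V'V by blast
  qed
  then show ?thesis by (simp add: F_def)
qed

theorem connection_form_conn_form: "connection_form G D (milnor_bundle G D) conn_form"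
  unfolding connection_form_def total_milnor_bundle act_milnor_bundle
proof (intro conjI ballI allI)
  show "smooth_map (tangent_bundle EG) (subspace_of (tangent_bundle D) (carrier (lie_space G D))) conn_form"
    unfolding lie_space_def
    by (rule smooth_map_tangent_bundle[OF space_EG conn_form_carrier _ conn_form_add conn_form_smult conn_form_plots]) simp_all
  show "conn_form (pushforward EG EG (translate h) a) = adjoint G D h (conn_form a)"
    if "h \<in> carrier G" "a \<in> points (tangent_bundle EG)" for h a
    using conn_form_equivariant that by (simp add: tangent_bundle_def)
qed (simp_all add: lie_space_def conn_form_add conn_form_smult conn_form_fundamental)

end

theorem theorem4p9:
  fixes G :: "('g, 'm) monoid_scheme" and D :: "'g dspace"
  assumes "diffeological_group G D"
  shows "\<exists>\<omega>. connection_form G D (milnor_bundle G D) \<omega>"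
proof -
  interpret group G by (rule diffeological_group_group[OF assms])
  interpret diff_group G D by unfold_locales (rule assms)
  show ?thesis using connection_form_conn_form by blast
qed

end
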